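(* Let $d\ge 1$, let $A,B$ be standard Borel spaces, let $X=(X_i)_{i\in\mathbb{Z}^d}$ be an i.i.d. $A$-valued random field, and let $Y=\varphi(X)$ for some finitary coding $\varphi:A^{\mathbb{Z}^d}\to B^{\mathbb{Z}^d}$ (finitary with respect to the law of $X$). If the coding satisfies the short-range factorization property with constant $\alpha\in(0,1]$, then for every local function $f:B^{\mathbb{Z}^d}\to\mathbb{R}$ with the bounded-difference property, $$\log \mathbb{E}\big[\exp\{\lambda(f(Y)-\mathbb{E} f(Y))\}\big]\le 3\,\alpha^{-d}\,\lambda^2\,\big(\mathbb{E}\big[(2r_\varphi(X)+1)^{d}\big]\big)^2\,\|\delta f\|_2^2,\qquad \forall\,\lambda>0 .$$
   Context: Codings. $T^j$ and $S^j$ ($j\in\mathbb{Z}^d$) denote the shifts $(T^jx)_i=x_{i+j}$ on $A^{\mathbb{Z}^d}$ and $(S^jy)_i=y_{i+j}$ on $B^{\mathbb{Z}^d}$. $B_\infty(j,r)=\{i\in\mathbb{Z}^d:\|i-j\|_\infty\le r\}$. A coding map is a measurable $\varphi:A^{\mathbb{Z}^d}\to B^{\mathbb{Z}^d}$ with $\varphi\circ T^j=S^j\circ\varphi$ for all $j$. Its coding radius at the origin is $$r_\varphi(x)=\inf\{r\in\mathbb{N}_0:\ \forall x'\in A^{\mathbb{Z}^d},\ x'_{B_\infty(0,r)}=x_{B_\infty(0,r)}\Rightarrow\varphi(x')_0=\varphi(x)_0\}$$ ($=\infty$ if the set is empty), and the radius at site $j$ is $r_j(x):=r_\varphi(T^jx)$.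 $\varphi$ is finitary (with respect to the law of a shift-invariant field $X$) if $r_\varphi(X)<\infty$ almost surely. Short-range factorization property with constant $\alpha\in(0,1]$: for all $k,\ell,i\in\mathbb{Z}^d$ such that $\max\{\|\ell-i\|_\infty,\|k-i\|_\infty,\|\ell-k\|_\infty\}=\|\ell-i\|_\infty$, $$\mathbb{E}\big[\mathbf 1\{\|k-i\|_\infty\le r_k(X)\}\,\mathbf 1\{\|\ell-k\|_\infty\le r_\ell(X)\}\big]\le \mathbb{E}\big[\mathbf 1\{\|k-i\|_\infty\le r_k(X)\}\big]\;\mathbb{E}\big[\mathbf 1\{\alpha\|\ell-k\|_\infty\le r_\ell(X)\}\big].$$ Oscillations. For measurable $f:B^{\mathbb{Z}^d}\to\mathbb{R}$, $\delta_jf=\sup\{|f(y)-f(y')|: y_\ell=y'_\ell\ \forall \ell\ne j\}\in[0,\infty]$, $\mathrm{dep}(f)=\{j:\delta_jf>0\}$. $f$ is local if $\mathrm{dep}(f)$ is finite (and $f$ depends only on the coordinates in $\mathrm{dep}(f)$); it has the bounded-difference property if $\delta_jf<\infty$ for all $j$. $\|\delta f\|_2^2=\sum_j(\delta_jf)^2$. *)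

theory Defs
  imports "HOL-Probability.Probability"
begin

text \<open>
  The lattice is \<^typ>\<open>int ^ 'd\<close> with \<^term>\<open>CARD('d)\<close> as its dimension, which is
  automatically positive.  For a measurable space \<open>A\<close>, the configuration space is the product
  space of \<open>A\<close> over the lattice; its points are all functions into \<^term>\<open>space A\<close>.
\<close>

definition standard_borel :: "'a measure \<Rightarrow> bool" where
  "standard_borel A \<longleftrightarrow>
     (\<exists>\<T>. completely_metrizable_space \<T> \<and> separable_space \<T> \<and>
          sets A = sets (sigma (topspace \<T>) {U. openin \<T> U}))"

abbreviation config_space :: "'a measure \<Rightarrow> (int ^ 'd::finite \<Rightarrow> 'a) measure" where
  "config_space A \<equiv> (\<Pi>\<^sub>M i \<in> UNIV. A)"

definition iid_field :: "'w measure \<Rightarrow> 'a measure \<Rightarrow> (int ^ 'd::finite \<Rightarrow> 'w \<Rightarrow> 'a) \<Rightarrow> bool" where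
  "iid_field M A X \<longleftrightarrow>
     prob_space.indep_vars M (\<lambda>_. A) X UNIV \<and>
     (\<forall>i j. distr M A (X i) = distr M A (X j))"

definition linf :: "int ^ 'd::finite \<Rightarrow> nat" where
  "linf v = Max (range (\<lambda>i. nat \<bar>v $ i\<bar>))"

definition ball_inf :: "int ^ 'd::finite \<Rightarrow> nat \<Rightarrow> (int ^ 'd) set" where
  "ball_inf j r = {i. linf (i - j) \<le> r}"

definition shift :: "int ^ 'd::finite \<Rightarrow> (int ^ 'd \<Rightarrow> 'a) \<Rightarrow> (int ^ 'd \<Rightarrow> 'a)" where
  "shift j x = (\<lambda>i. x (i + j))"

definition coding ::
  "'a measure \<Rightarrow> 'b measure \<Rightarrow> ((int ^ 'd::finite \<Rightarrow> 'a) \<Rightarrow> (int ^ 'd \<Rightarrow> 'b)) \<Rightarrow> bool" where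
  "coding A B \<phi> \<longleftrightarrow>
     \<phi> \<in> measurable (config_space A) (config_space B) \<and>
     (\<forall>j. \<forall>x\<in>space (config_space A). \<phi> (shift j x) = shift j (\<phi> x))"

text \<open>In \<^typ>\<open>enat\<close>, the infimum of the empty set is \<open>\<infinity>\<close>.\<close>

definition coding_radius ::
  "'a measure \<Rightarrow> ((int ^ 'd::finite \<Rightarrow> 'a) \<Rightarrow> (int ^ 'd \<Rightarrow> 'b)) \<Rightarrow> (int ^ 'd \<Rightarrow> 'a) \<Rightarrow> enat" where
  "coding_radius A \<phi> x =
     Inf (enat ` {r. \<forall>x'\<in>space (config_space A).
                       (\<forall>i\<in>ball_inf 0 r. x' i = x i) \<longrightarrow> \<phi> x' 0 = \<phi> x 0})"

definition site_radius ::
  "'a measure \<Rightarrow> ((int ^ 'd::finite \<Rightarrow> 'a) \<Rightarrow> (int ^ 'd \<Rightarrow> 'b)) \<Rightarrow> int ^ 'd \<Rightarrow> (int ^ 'd \<Rightarrow> 'a) \<Rightarrow> enat"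
  where "site_radius A \<phi> j x = coding_radius A \<phi> (shift j x)"

text \<open>
  For standard Borel \<open>A\<close> and \<open>B\<close> and a coding \<open>\<phi>\<close>, the set where the radius is at most \<open>r\<close> is in
  general only co-analytic, hence universally measurable, but not necessarily measurable in the
  product sigma-algebra.  Expectations of functions of the radius are therefore taken with respect
  to the completion of the underlying probability measure.
\<close>

definition finitary ::
  "'w measure \<Rightarrow> 'a measure \<Rightarrow> (int ^ 'd::finite \<Rightarrow> 'w \<Rightarrow> 'a) \<Rightarrow>
    ((int ^ 'd \<Rightarrow> 'a) \<Rightarrow> (int ^ 'd \<Rightarrow> 'b)) \<Rightarrow> bool" where
  "finitary M A X \<phi> \<longleftrightarrow> (AE \<omega> in completion M. coding_radius A \<phi> (\<lambda>i. X i \<omega>) < \<infinity>)"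

definition short_range_factorization ::
  "'w measure \<Rightarrow> 'a measure \<Rightarrow> (int ^ 'd::finite \<Rightarrow> 'w \<Rightarrow> 'a) \<Rightarrow>
    ((int ^ 'd \<Rightarrow> 'a) \<Rightarrow> (int ^ 'd \<Rightarrow> 'b)) \<Rightarrow> real \<Rightarrow> bool" where
  "short_range_factorization M A X \<phi> \<alpha> \<longleftrightarrow>
     (\<forall>k l i. max (linf (l - i)) (max (linf (k - i)) (linf (l - k))) = linf (l - i) \<longrightarrow>
        (\<integral>\<^sup>+\<omega>. indicator {x. enat (linf (k - i)) \<le> site_radius A \<phi> k x} (\<lambda>n. X n \<omega>) *
              indicator {x. enat (linf (l - k)) \<le> site_radius A \<phi> l x} (\<lambda>n. X n \<omega>) \<partial>completion M)
        \<le> (\<integral>\<^sup>+\<omega>. indicator {x. enat (linf (k - i)) \<le> site_radius A \<phi> k x} (\<lambda>n. X n \<omega>) \<partial>completion M) *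
          (\<integral>\<^sup>+\<omega>. indicator {x. ennreal (\<alpha> * real (linf (l - k))) \<le> ennreal_of_enat (site_radius A \<phi> l x)}
                 (\<lambda>n. X n \<omega>) \<partial>completion M))"

definition oscillation ::
  "'b measure \<Rightarrow> ((int ^ 'd::finite \<Rightarrow> 'b) \<Rightarrow> real) \<Rightarrow> int ^ 'd \<Rightarrow> ennreal" where
  "oscillation B f j =
     Sup {ennreal \<bar>f y - f y'\<bar> | y y'. y \<in> space (config_space B) \<and> y' \<in> space (config_space B) \<and>
                                   (\<forall>l. l \<noteq> j \<longrightarrow> y l = y' l)}"

definition dep :: "'b measure \<Rightarrow> ((int ^ 'd::finite \<Rightarrow> 'b) \<Rightarrow> real) \<Rightarrow> (int ^ 'd) set" where
  "dep B f = {j. oscillation B f j > 0}"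

definition local_function :: "'b measure \<Rightarrow> ((int ^ 'd::finite \<Rightarrow> 'b) \<Rightarrow> real) \<Rightarrow> bool" where
  "local_function B f \<longleftrightarrow>
     f \<in> borel_measurable (config_space B) \<and> finite (dep B f) \<and>
     (\<forall>y\<in>space (config_space B). \<forall>y'\<in>space (config_space B).
        (\<forall>j\<in>dep B f. y j = y' j) \<longrightarrow> f y = f y')"

definition bounded_difference :: "'b measure \<Rightarrow> ((int ^ 'd::finite \<Rightarrow> 'b) \<Rightarrow> real) \<Rightarrow> bool" where
  "bounded_difference B f \<longleftrightarrow> (\<forall>j. oscillation B f j < \<infinity>)"

definition oscillation_norm_sq :: "'b measure \<Rightarrow> ((int ^ 'd::finite \<Rightarrow> 'b) \<Rightarrow> real) \<Rightarrow> ennreal" where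
  "oscillation_norm_sq B f = (\<Sum>\<^sub>\<infinity>j. (oscillation B f j)\<^sup>2)"

end

theory Submission
  imports Defs
begin

text \<open>
  Changing the input at site \<open>i\<close> can only change the output at those sites \<open>j\<close> whose coding radius
  reaches \<open>i\<close>.  The lattice is tiled by cubes of side 4.  A site with coding radius 0 contributes a
  deterministic Lipschitz cost to its own coordinate; a site with a positive radius contributes to
  the random cost \<open>L C\<close> of each cube \<open>C\<close> that it reaches.  A function whose increments are dominated by
  such costs, evaluated at the first configuration only, satisfies
  \<open>log E exp F \<le> E F + (\<Sum>i. (s i)\<^sup>2) + (\<Sum>C. E ((L C)\<^sup>2))\<close>.  The second moments of \<open>L C\<close> are sums of
  joint tails of two radii: for two sites that are close relative to their radii, these are bounded by
  short-range factorization, otherwise by independence.  Averaging over the \<open>4 ^ d\<close> translates of the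
  tiling selects one for which the sum is of the order of the claimed bound.

  The radius itself is only universally measurable: the set where \<open>\<phi>\<close> is not constant on the fibre of
  a local configuration is a countable combination of projections of Borel sets, that is, of Souslin
  sets.  Up to a null set the
  radius is therefore replaced by a measurable one that is still a stopping radius.
\<close>

section \<open>Souslin sets and measurable projection\<close>

text \<open>The obstacle is that the reach of a site is random, so there are no uniform Lipschitz
  constants. The way out is the stopping property: whether the radius at \<open>x\<close> is at most
  \<open>q\<close> is visible inside the ball of radius \<open>q\<close>. Hence the effect of
  passing from \<open>x\<close> to \<open>y\<close> is bounded by radii of \<open>x\<close> alone,
  and the exponential inequality is built for such one-sided costs. The side 4 is chosen for the
  constant. Making two events live on disjoint balls halves both thresholds; a radius
  \<open>r\<close> then reaches \<open>(4 r + 2) ^ d = 2 ^ d (2 r + 1) ^ d\<close> cubes among all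
  translates, and the average over \<open>4 ^ d\<close> translates cancels the two factors
  \<open>2 ^ d\<close>. Without halving, a radius \<open>r\<close> of at least 1 reaches
  \<open>(2 r + 4) ^ d\<close> cubes, at most half of \<open>4 ^ d (2 r + 1) ^ d\<close>, so that
  the two factorization terms together cost only \<open>(1 / \<alpha>) ^ d\<close>. The latter
  estimate fails at \<open>r = 0\<close>, which is why radius 0 is charged to its own coordinate.
  The contributions 1 (radius 0), 1 (independence) and \<open>(1 / \<alpha>) ^ d\<close>
  (factorization) add up to the factor 3.\<close>

definition finitely_determined :: "((nat \<Rightarrow> nat) \<Rightarrow> 'b) \<Rightarrow> bool" where
  "finitely_determined g \<longleftrightarrow> (\<forall>z. \<exists>N. \<forall>z'. (\<forall>j<N. z j = z' j) \<longrightarrow> g z = g z')"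

text \<open>Dependent choice produces longer and longer prefixes, and their diagonal is a single
  branch. The last hypothesis lets the diagonal inherit \<open>P k\<close>: that property looks at
  the first \<open>k\<close> coordinates only.\<close>

lemma prefix_choice:
  assumes 0: "\<exists>z. P 0 z"
    and step: "\<And>k z. P k z \<Longrightarrow> \<exists>z'. P (Suc k) z' \<and> (\<forall>i<k. z' i = z i)"
    and cong: "\<And>k z z'. P k z \<Longrightarrow> (\<forall>i<k. z' i = z i) \<Longrightarrow> P k z'"
  shows "\<exists>z::nat \<Rightarrow> 'b. \<forall>k. P k z"
proof -
  from dependent_nat_choice[of P "\<lambda>k z z'. \<forall>i<k. z' i = z i", OF 0 step]
  obtain f where f: "\<And>k. P k (f k)" "\<And>k. \<forall>i<k. f (Suc k) i = f k i" by blast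
  have stab: "f (k + m) i = f k i" if "i < k" for k m i
    using f(2) that by (induction m) auto
  have "f (Suc i) i = f k i" if "i < k" for k i
    using stab[of i "Suc i" "k - Suc i"] that by simp
  then have "P k (\<lambda>i. f (Suc i) i)" for k
    by (intro cong[OF f(1)[of k]]) blast
  then show ?thesis by blast
qed

text \<open>Koenig's lemma, that is, compactness of the branches with bounded coordinates. The
  \<open>k\<close>-th branch is bounded only in its coordinates below \<open>k\<close>, so each
  fixed coordinate is under control for all but finitely many branches.\<close>

lemma bounded_prefix_cluster_point:
  fixes zs :: "nat \<Rightarrow> nat \<Rightarrow> nat"
  assumes "\<And>k i. i < k \<Longrightarrow> zs k i \<le> n i"
  shows "\<exists>z. \<forall>N. infinite {k. \<forall>i<N. zs k i = z i}"
proof (rule prefix_choice)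
  show "\<exists>z. infinite {k. \<forall>i<0. zs k i = z i}" by simp
  fix N and z assume inf: "infinite {k. \<forall>i<N. zs k i = (z i :: nat)}"
  \<comment> \<open>The bound on coordinate \<open>N\<close> holds only for indices above
    \<open>N\<close>; discarding finitely many of them leaves an infinite set.\<close>
  let ?I = "{k. \<forall>i<N. zs k i = z i} - {..N}"
  have "infinite ?I" using inf by simp
  moreover have "finite ((\<lambda>k. zs k N) ` ?I)"
  proof (rule finite_subset)
    show "(\<lambda>k. zs k N) ` ?I \<subseteq> {..n N}"
    proof
      fix v assume "v \<in> (\<lambda>k. zs k N) ` ?I"
      then obtain k where k: "v = zs k N" "k \<in> ?I" by (rule imageE)
      then have "N < k" by auto
      then show "v \<in> {..n N}" using assms k by simp
    qed
  qed simp
  ultimately obtain k0 where k0: "infinite {k\<in>?I. zs k N = zs k0 N}"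
    using pigeonhole_infinite[of ?I "\<lambda>k. zs k N"] by blast
  have "infinite {k. \<forall>i<Suc N. zs k i = (z(N := zs k0 N)) i}"
    by (rule infinite_super[OF _ k0]) (auto simp: less_Suc_eq)
  then show "\<exists>z'. infinite {k. \<forall>i<Suc N. zs k i = z' i} \<and> (\<forall>i<N. z' i = z i)"
    by (intro exI[of _ "z(N := zs k0 N)"]) simp
next
  fix k z z' assume "infinite {j. \<forall>i<k. zs j i = (z i::nat)}" "\<forall>i<k. z' i = z i"
  then show "infinite {j. \<forall>i<k. zs j i = z' i}" by simp
qed

text \<open>\<open>E\<close> lies between a countable union of inner sets and a measurable hull.
  Once their measures agree, finiteness makes the difference of the two a null set.\<close>

lemma (in finite_measure) inner_approximation_imp_completion:
  assumes E: "E \<subseteq> space M"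
    and inner: "\<And>c. c < outer_measure_of M E \<Longrightarrow> \<exists>D\<in>sets M. D \<subseteq> E \<and> c \<le> emeasure M D"
  shows "E \<in> sets (completion M)"
proof -
  obtain H where H: "H \<in> sets M" "E \<subseteq> H" "outer_measure_of M E = emeasure M H"
    using outer_measure_of_attain[OF E] by blast
  have "\<exists>D\<in>sets M. D \<subseteq> E \<and> emeasure M D = emeasure M H"
  proof (cases "emeasure M H = 0")
    case True then show ?thesis by (intro bexI[of _ "{}"]) auto
  next
    case False
    then obtain c where c: "\<And>n::nat. c n < emeasure M H" "c \<longlonglongrightarrow> emeasure M H"
      using approx_from_below_dense_linorder[of 0 "emeasure M H"] by (auto simp: zero_less_iff_neq_zero)
    obtain D where D: "\<And>n. D n \<in> sets M" "\<And>n. D n \<subseteq> E" "\<And>n. c n \<le> emeasure M (D n)"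
    proof -
      have "\<forall>n. \<exists>D. D \<in> sets M \<and> D \<subseteq> E \<and> c n \<le> emeasure M D"
        using inner c(1) H(3) by (metis)
      from choice[OF this] show ?thesis using that by blast
    qed
    have "c n \<le> emeasure M (\<Union>n. D n)" for n
    proof -
      have "emeasure M (D n) \<le> emeasure M (\<Union>n. D n)" using D(1) by (intro emeasure_mono) auto
      with D(3)[of n] show ?thesis by (rule order_trans)
    qed
    then have "emeasure M H \<le> emeasure M (\<Union>n. D n)"
      by (intro LIMSEQ_le_const2[OF c(2)]) auto
    moreover have "emeasure M (\<Union>n. D n) \<le> emeasure M H"
      using D(2) H(1,2) by (intro emeasure_mono) blast+
    ultimately show ?thesis using D by (intro bexI[of _ "\<Union>n. D n"]) auto
  qed
  then obtain D where D: "D \<in> sets M" "D \<subseteq> E" "emeasure M D = emeasure M H" by blast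
  have "H - D \<in> null_sets M"
    using D H by (auto simp: null_sets_def emeasure_Diff)
  moreover have "E = D \<union> (E - D)" using D by blast
  ultimately show ?thesis
    using D(1) H(2) by (intro sets_completionI[of E D "E - D" "H - D"]) auto
qed

text \<open>
  Bounding the branches one coordinate at a time loses arbitrarily little outer measure, since outer
  measure is continuous from below.  What remains is, by compactness of the bounded branches, a
  countable intersection of measurable sets.
\<close>

lemma (in finite_measure) souslin_in_completion:
  assumes T: "\<And>m z. T m z \<in> sets M" and fd: "\<And>m. finitely_determined (T m)"
  shows "{u\<in>space M. \<exists>z::nat\<Rightarrow>nat. \<forall>m::nat. u \<in> T m z} \<in> sets (completion M)" (is "?E \<in> _")
proof (rule inner_approximation_imp_completion)
  show "?E \<subseteq> space M" by auto
  fix c assume c: "c < outer_measure_of M ?E"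
  \<comment> \<open>All conditions \<open>T m\<close> are still imposed here, so these sets need not
    be measurable; only their outer measure is used.\<close>
  define Eb where "Eb k n = {u\<in>space M. \<exists>z. (\<forall>i<k. z i \<le> n i) \<and> (\<forall>m. u \<in> T m z)}" for k and n :: "nat \<Rightarrow> nat"
  have "\<exists>n. \<forall>k. c < outer_measure_of M (Eb k n)"
  proof (rule prefix_choice)
    show "\<exists>n. c < outer_measure_of M (Eb 0 n)" using c by (simp add: Eb_def)
    show "c < outer_measure_of M (Eb k n')"
      if "c < outer_measure_of M (Eb k n)" "\<forall>i<k. n' i = n i" for k n n'
      using that by (simp add: Eb_def)
    fix k n assume *: "c < outer_measure_of M (Eb k n)"
    have "Eb k n = (\<Union>j. Eb (Suc k) (n(k := j)))"
      by (auto simp: Eb_def less_Suc_eq)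
    moreover have "incseq (\<lambda>j. Eb (Suc k) (n(k := j)))"
    proof (rule incseq_SucI, rule subsetI)
      fix j u assume "u \<in> Eb (Suc k) (n(k := j))"
      then obtain z where "u \<in> space M" "\<forall>i<Suc k. z i \<le> (n(k := j)) i" "\<forall>m. u \<in> T m z"
        by (auto simp: Eb_def)
      moreover from this(2) have "\<forall>i<Suc k. z i \<le> (n(k := Suc j)) i" by (force simp: less_Suc_eq)
      ultimately show "u \<in> Eb (Suc k) (n(k := Suc j))" unfolding Eb_def by blast
    qed
    moreover have "\<And>j. Eb (Suc k) (n(k := j)) \<subseteq> space M" by (auto simp: Eb_def)
    ultimately have "c < (SUP j. outer_measure_of M (Eb (Suc k) (n(k := j))))"
      using * SUP_outer_measure_of_incseq by metis
    then obtain j where "c < outer_measure_of M (Eb (Suc k) (n(k := j)))"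
      by (auto simp: less_SUP_iff)
    then show "\<exists>n'. c < outer_measure_of M (Eb (Suc k) n') \<and> (\<forall>i<k. n' i = n i)"
      by (intro exI[of _ "n(k := j)"]) simp
  qed
  then obtain n where n: "\<And>k. c < outer_measure_of M (Eb k n)" by blast
  \<comment> \<open>Only the first \<open>k\<close> conditions remain, and the witness may change
    with \<open>k\<close>. This makes the set measurable, and since it contains
    \<open>Eb k n\<close> its measure is still above \<open>c\<close>.\<close>
  define D where "D k = {u\<in>space M. \<exists>z. (\<forall>i<k. z i \<le> n i) \<and> (\<forall>m<k. u \<in> T m z)}" for k
  have D_sets: "D k \<in> sets M" for k
  proof -
    have Nex: "\<exists>N\<ge>k. \<forall>z'. (\<forall>j<N. z j = z' j) \<longrightarrow> (\<forall>m<k. T m z = T m z')" for z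
    proof -
      obtain N0 where N0: "\<And>m z'. (\<forall>j<N0 m. z j = z' j) \<Longrightarrow> T m z = T m z'"
      proof -
        have "\<forall>m. \<exists>N. \<forall>z'. (\<forall>j<N. z j = z' j) \<longrightarrow> T m z = T m z'"
          using fd unfolding finitely_determined_def by blast
        from choice[OF this] show ?thesis using that by blast
      qed
      define N where "N = Max (insert k (N0 ` {..<k}))"
      have "k \<le> N" "\<And>m. m < k \<Longrightarrow> N0 m \<le> N" by (simp_all add: N_def)
      then show ?thesis using N0 by (intro exI[of _ N]) (metis order_less_le_trans)
    qed
    \<comment> \<open>Finite prefixes padded by zeros are countably many and match every branch on
      any given number of coordinates. An uncountable union thereby becomes a countable one.\<close>
    define ext where "ext l = (\<lambda>i. if i < length l then l ! i else 0 :: nat)" for l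
    have ext: "\<exists>l. \<forall>j<N. z j = ext l j" for z :: "nat \<Rightarrow> nat" and N
      by (rule exI[of _ "map z [0..<N]"]) (simp add: ext_def)
    have D_eq: "D k = (\<Union>l\<in>{l. \<forall>i<k. ext l i \<le> n i}. {u\<in>space M. \<forall>m<k. u \<in> T m (ext l)})"
    proof (intro equalityI subsetI)
      fix u assume "u \<in> D k"
      then obtain z where z: "u \<in> space M" "\<forall>i<k. z i \<le> n i" "\<forall>m<k. u \<in> T m z"
        by (auto simp: D_def)
      obtain N where kN: "k \<le> N" and N: "\<And>z' m. (\<forall>j<N. z j = z' j) \<Longrightarrow> m < k \<Longrightarrow> T m z = T m z'"
        using Nex[of z] by blast
      obtain l where l: "\<forall>j<N. z j = ext l j" using ext by blast
      have "\<forall>i<k. ext l i \<le> n i"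
      proof (intro allI impI)
        fix i assume "i < k"
        then have "z i = ext l i" using l kN by simp
        then show "ext l i \<le> n i" using z(2) \<open>i < k\<close> by metis
      qed
      moreover have "\<forall>m<k. u \<in> T m (ext l)" using N[OF l] z(3) by metis
      ultimately show "u \<in> (\<Union>l\<in>{l. \<forall>i<k. ext l i \<le> n i}. {u\<in>space M. \<forall>m<k. u \<in> T m (ext l)})"
        using z(1) by blast
    qed (auto simp: D_def)
    have T': "{u\<in>space M. \<forall>m<k. u \<in> T m (ext l)} \<in> sets M" for l
    proof -
      have "{u\<in>space M. \<forall>m\<in>{..<k}. u \<in> T m (ext l)} \<in> sets M"
        using T sets.sets_into_space by (intro sets.sets_Collect_finite_All) (auto simp: Collect_conj_eq Int_absorb1)
      then show ?thesis by (simp only: Ball_def lessThan_iff)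
    qed
    show ?thesis unfolding D_eq
      by (rule sets.countable_UN') (auto intro: T' countableI_type)
  qed
  have "decseq D" unfolding decseq_Suc_iff D_def using less_SucI by blast
  have c_le: "c \<le> emeasure M (\<Inter>k. D k)"
  proof -
    have "Eb k n \<subseteq> D k" for k by (auto simp: Eb_def D_def)
    then have "c < emeasure M (D k)" for k
      using n[of k] outer_measure_of_mono[of "Eb k n" "D k" M] D_sets[of k]
      by (metis order_less_le_trans outer_measure_of_eq)
    then have "c \<le> (INF k. emeasure M (D k))" by (intro INF_greatest) (simp add: less_imp_le)
    also have "\<dots> = emeasure M (\<Inter>k. D k)"
      using D_sets \<open>decseq D\<close> by (intro INF_emeasure_decseq) auto
    finally show ?thesis .
  qed
  have "(\<Inter>k. D k) \<subseteq> ?E"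
  proof
    fix u assume u: "u \<in> (\<Inter>k. D k)"
    then have "\<forall>k. \<exists>z. (\<forall>i<k. z i \<le> n i) \<and> (\<forall>m<k. u \<in> T m z)" by (auto simp: D_def)
    then obtain zs where zs: "\<And>k i. i < k \<Longrightarrow> zs k i \<le> n i" "\<And>k m. m < k \<Longrightarrow> u \<in> T m (zs k)"
      by metis
    \<comment> \<open>The witnesses for the individual \<open>k\<close> have a common cluster point.
      A fixed condition reads finitely many coordinates, so it takes the same value at the cluster
      point and at some witness of index above \<open>m\<close>.\<close>
    obtain z where z: "\<And>N. infinite {k. \<forall>i<N. zs k i = z i}"
      using bounded_prefix_cluster_point[of zs n] zs(1) by blast
    have "u \<in> T m z" for m
    proof -
      obtain N where N: "\<And>z'. (\<forall>j<N. z j = z' j) \<Longrightarrow> T m z = T m z'"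
        using fd unfolding finitely_determined_def by metis
      obtain k where "k > m" "\<forall>i<N. zs k i = z i"
        using z[of N] unfolding infinite_nat_iff_unbounded by blast
      then show ?thesis using N[of "zs k"] zs(2)[of m k] by simp
    qed
    moreover have "u \<in> space M" using u by (auto simp: D_def)
    ultimately show "u \<in> ?E" by blast
  qed
  moreover have "(\<Inter>k. D k) \<in> sets M" using D_sets by auto
  ultimately show "\<exists>D\<in>sets M. D \<subseteq> ?E \<and> c \<le> emeasure M D" using c_le by blast
qed

section \<open>Maps on Baire space that are continuous into a discrete target, and the closure
  properties of Souslin sets\<close>

lemma finitely_determinedI:
  "(\<And>z. \<exists>N. \<forall>z'. (\<forall>j<N. z j = z' j) \<longrightarrow> g z = g z') \<Longrightarrow> finitely_determined g"
  by (simp add: finitely_determined_def)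

lemma finitely_determinedE:
  assumes "finitely_determined g"
  obtains N where "\<And>z'. (\<forall>j<N. z j = z' j) \<Longrightarrow> g z = g z'"
  using assms unfolding finitely_determined_def by blast

lemma finitely_determined_const: "finitely_determined (\<lambda>z. c)"
  by (simp add: finitely_determined_def)

lemma finitely_determined_reindex:
  assumes "finitely_determined g"
  shows "finitely_determined (\<lambda>z. g (\<lambda>j. z (e j)))"
proof (rule finitely_determinedI)
  fix z
  obtain N where N: "\<And>z'. (\<forall>j<N. z (e j) = z' j) \<Longrightarrow> g (\<lambda>j. z (e j)) = g z'"
    using finitely_determinedE[OF assms, of "\<lambda>j. z (e j)"] by blast
  have e: "e j < Suc (Max (insert 0 (e ` {..<N})))" if "j < N" for j
    using that by (simp add: less_Suc_eq_le)
  have "g (\<lambda>j. z (e j)) = g (\<lambda>j. z' (e j))"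
    if z': "\<forall>j<Suc (Max (insert 0 (e ` {..<N}))). z j = z' j" for z'
    by (rule N) (use z' e in blast)
  then show "\<exists>N. \<forall>z'. (\<forall>j<N. z j = z' j) \<longrightarrow> g (\<lambda>j. z (e j)) = g (\<lambda>j. z' (e j))"
    by (intro exI allI impI)
qed

lemma finitely_determined_comp2:
  assumes "finitely_determined g" "finitely_determined h"
  shows "finitely_determined (\<lambda>z. f (g z) (h z))"
proof (rule finitely_determinedI)
  fix z
  obtain N where N: "\<And>z'. (\<forall>j<N. z j = z' j) \<Longrightarrow> g z = g z'"
    using finitely_determinedE[OF assms(1)] by blast
  obtain K where K: "\<And>z'. (\<forall>j<K. z j = z' j) \<Longrightarrow> h z = h z'"
    using finitely_determinedE[OF assms(2)] by blast
  have "f (g z) (h z) = f (g z') (h z')" if "\<forall>j<max N K. z j = z' j" for z'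
    using N[of z'] K[of z'] that by simp
  then show "\<exists>N. \<forall>z'. (\<forall>j<N. z j = z' j) \<longrightarrow> f (g z) (h z) = f (g z') (h z')"
    by blast
qed

text \<open>The constant default from \<open>m\<close> on keeps the whole sequence finitely
  determined; with infinitely many genuine entries no finite prefix would do in general.\<close>

lemma finitely_determined_all_less:
  fixes m :: nat
  assumes "\<And>k. k < m \<Longrightarrow> finitely_determined (g k)"
  shows "finitely_determined (\<lambda>z. \<lambda>k. if k < m then g k z else c)"
  using assms
proof (induction m)
  case 0 show ?case by (simp add: finitely_determined_const)
next
  case (Suc m)
  have "finitely_determined (\<lambda>z. (\<lambda>k. if k < m then g k z else c)(m := g m z))"
  proof (rule finitely_determined_comp2[where f="\<lambda>a b. a(m := b)"])
    show "finitely_determined (\<lambda>z k. if k < m then g k z else c)"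
      by (rule Suc.IH) (rule Suc.prems, simp)
    show "finitely_determined (g m)" by (rule Suc.prems) simp
  qed
  also have "(\<lambda>z. (\<lambda>k. if k < m then g k z else c)(m := g m z)) = (\<lambda>z k. if k < Suc m then g k z else c)"
    by (auto simp: fun_eq_iff)
  finally show ?case .
qed

text \<open>
  \<open>R m z = (i, K)\<close> encodes the \<open>m\<close>-th condition \<open>x i \<in> K\<close> along the branch \<open>z\<close>.
\<close>

definition souslin_scheme :: "'a topology \<Rightarrow> (nat \<Rightarrow> (nat \<Rightarrow> nat) \<Rightarrow> 'i \<times> 'a set) \<Rightarrow> ('i \<Rightarrow> 'a) set \<Rightarrow> bool" where
  "souslin_scheme T R S \<longleftrightarrow>
     (\<forall>m. finitely_determined (R m)) \<and> (\<forall>m z. closedin T (snd (R m z))) \<and>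
     S = {x. (\<forall>i. x i \<in> topspace T) \<and> (\<exists>z. \<forall>m. x (fst (R m z)) \<in> snd (R m z))}"

definition souslin :: "'a topology \<Rightarrow> ('i \<Rightarrow> 'a) set \<Rightarrow> bool" where
  "souslin T S \<longleftrightarrow> (\<exists>R. souslin_scheme T R S)"

lemma souslin_schemeD:
  assumes "souslin_scheme T R S"
  shows "finitely_determined (R m)" "closedin T (snd (R m z))"
    "S = {x. (\<forall>i. x i \<in> topspace T) \<and> (\<exists>z. \<forall>m. x (fst (R m z)) \<in> snd (R m z))}"
  using assms by (simp_all add: souslin_scheme_def)

lemma souslin_closed:
  assumes "closedin T K" shows "souslin T {x. (\<forall>i. x i \<in> topspace T) \<and> x i \<in> K}"
  unfolding souslin_def souslin_scheme_def
  by (rule exI[of _ "\<lambda>m z. (i, K)"]) (use assms in \<open>auto simp: finitely_determined_const\<close>)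

text \<open>Coordinate 0 of a branch names the member of the union, and the shifted rest is a branch
  for it. Any nonempty prefix already fixes which scheme is consulted, which preserves finite
  determination.\<close>

lemma souslin_UN:
  assumes "\<And>n::nat. souslin T (S n)" shows "souslin T (\<Union>n. S n)"
proof -
  from assms have "\<forall>n. \<exists>R. souslin_scheme T R (S n)" by (simp add: souslin_def)
  from choice[OF this] obtain R where "\<And>n. souslin_scheme T (R n) (S n)" by blast
  note R = souslin_schemeD[OF this]
  define Q where "Q m z = R (z 0) m (\<lambda>j. z (Suc j))" for m z
  have "finitely_determined (Q m)" for m
  proof (rule finitely_determinedI)
    fix z :: "nat \<Rightarrow> nat"
    obtain N where N: "\<And>z'. (\<forall>j<N. z (Suc j) = z' j) \<Longrightarrow> R (z 0) m (\<lambda>j. z (Suc j)) = R (z 0) m z'"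
      using finitely_determinedE[OF R(1)[of "z 0" m], of "\<lambda>j. z (Suc j)"] by blast
    have "Q m z = Q m z'" if "\<forall>j<Suc N. z j = z' j" for z'
      using N[of "\<lambda>j. z' (Suc j)"] that[rule_format, of 0] that unfolding Q_def by simp
    then show "\<exists>N. \<forall>z'. (\<forall>j<N. z j = z' j) \<longrightarrow> Q m z = Q m z'" by blast
  qed
  moreover have "closedin T (snd (Q m z))" for m z using R(2) by (simp add: Q_def)
  moreover have "(\<Union>n. S n) = {x. (\<forall>i. x i \<in> topspace T) \<and> (\<exists>z. \<forall>m. x (fst (Q m z)) \<in> snd (Q m z))}"
    (is "_ = ?Q")
  proof (intro equalityI subsetI)
    fix x assume "x \<in> (\<Union>n. S n)"
    then obtain n z where "\<forall>i. x i \<in> topspace T" "\<forall>m. x (fst (R n m z)) \<in> snd (R n m z)"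
      using R(3) by auto
    then show "x \<in> ?Q" by (auto simp: Q_def intro!: exI[of _ "case_nat n z"])
  next
    fix x assume "x \<in> ?Q"
    then obtain z where "\<forall>i. x i \<in> topspace T" "\<forall>m. x (fst (Q m z)) \<in> snd (Q m z)" by auto
    then have "x \<in> S (z 0)" unfolding R(3) Q_def by blast
    then show "x \<in> (\<Union>n. S n)" by blast
  qed
  ultimately show ?thesis unfolding souslin_def souslin_scheme_def by (intro exI[of _ Q] conjI allI)
qed

text \<open>One branch carries a branch for every member, separated by the pairing function, and the
  same pairing lists the conditions of all members in a single sequence.\<close>

lemma souslin_INT:
  assumes "\<And>n::nat. souslin T (S n)" shows "souslin T (\<Inter>n. S n)"
proof -
  from assms have "\<forall>n. \<exists>R. souslin_scheme T R (S n)" by (simp add: souslin_def)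
  from choice[OF this] obtain R where "\<And>n. souslin_scheme T (R n) (S n)" by blast
  note R = souslin_schemeD[OF this]
  define Q where "Q m z = R (fst (prod_decode m)) (snd (prod_decode m))
    (\<lambda>j. z (prod_encode (fst (prod_decode m), j)))" for m z
  have "finitely_determined (Q m)" for m
    unfolding Q_def by (rule finitely_determined_reindex[OF R(1)])
  moreover have "closedin T (snd (Q m z))" for m z using R(2) by (simp add: Q_def)
  moreover have "(\<Inter>n. S n) = {x. (\<forall>i. x i \<in> topspace T) \<and> (\<exists>z. \<forall>m. x (fst (Q m z)) \<in> snd (Q m z))}"
    (is "_ = ?Q")
  proof (intro equalityI subsetI)
    fix x assume "x \<in> (\<Inter>n. S n)"
    then have x: "\<forall>n. x \<in> S n" by blast
    then have sp: "\<forall>i. x i \<in> topspace T" using R(3)[of 0] by blast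
    have "\<forall>n. \<exists>z. \<forall>m. x (fst (R n m z)) \<in> snd (R n m z)"
      using x unfolding R(3) by blast
    from choice[OF this] obtain z where z: "\<And>n m. x (fst (R n m (z n))) \<in> snd (R n m (z n))" by blast
    define z' where "z' p = z (fst (prod_decode p)) (snd (prod_decode p))" for p
    have "Q m z' = R (fst (prod_decode m)) (snd (prod_decode m)) (z (fst (prod_decode m)))" for m
      by (simp add: Q_def z'_def)
    then have "\<forall>m. x (fst (Q m z')) \<in> snd (Q m z')" using z by simp
    then show "x \<in> ?Q" using sp by blast
  next
    fix x assume "x \<in> ?Q"
    then obtain z where z: "\<forall>i. x i \<in> topspace T" "\<And>m. x (fst (Q m z)) \<in> snd (Q m z)" by auto
    have "x \<in> S n" for n
    proof -
      have "x (fst (R n m (\<lambda>j. z (prod_encode (n, j))))) \<in> snd (R n m (\<lambda>j. z (prod_encode (n, j))))" for m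
        using z(2)[of "prod_encode (n, m)"] by (simp add: Q_def)
      then show ?thesis unfolding R(3) using z(1) by blast
    qed
    then show "x \<in> (\<Inter>n. S n)" by blast
  qed
  ultimately show ?thesis unfolding souslin_def souslin_scheme_def by (intro exI[of _ Q] conjI allI)
qed

lemma sets_borel_of_topology:
  "sets (sigma (topspace T) {U. openin T U}) = sigma_sets (topspace T) {U. openin T U}"
  by (rule sets_measure_of, rule subsetI) (simp add: openin_subset)

lemma closedin_sets_borel_of_topology:
  assumes "closedin T K" shows "K \<in> sets (sigma (topspace T) {U. openin T U})"
proof -
  have "topspace T - K \<in> sigma_sets (topspace T) {U. openin T U}"
    using assms by (intro sigma_sets.Basic) (simp add: closedin_def)
  from sigma_sets.Compl[OF this] show ?thesis
    using closedin_subset[OF assms] by (simp add: sets_borel_of_topology double_diff)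
qed

text \<open>Souslin sets are not closed under complements, so the induction over the sigma-algebra
  carries a set together with its complement. Metrizability enters in the base case, where an open
  set must be a countable union of closed ones.\<close>

lemma souslin_sets_PiM:
  fixes S :: "('i \<Rightarrow> 'a) set"
  assumes met: "metrizable_space T" and A: "sets A = sets (sigma (topspace T) {U. openin T U})"
    and S: "S \<in> sets (PiM UNIV (\<lambda>_. A))"
  shows "souslin T S"
proof -
  define \<Omega> where "\<Omega> = {x::'i \<Rightarrow> 'a. \<forall>i. x i \<in> topspace T}"
  define bi where "bi S \<longleftrightarrow> S \<subseteq> \<Omega> \<and> souslin T S \<and> souslin T (\<Omega> - S)" for S
  have spA: "space A = topspace T"
    using sets_eq_imp_space_eq[OF A] by (simp add: space_measure_of_conv)
  have bi_empty: "bi {}"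
  proof -
    have "{x::'i \<Rightarrow> 'a. (\<forall>i. x i \<in> topspace T) \<and> x undefined \<in> topspace T} = \<Omega>"
      by (auto simp: \<Omega>_def)
    then have "souslin T \<Omega>" using souslin_closed[of T "topspace T" "undefined::'i"] by simp
    moreover have "souslin T ({}::('i \<Rightarrow> 'a) set)"
      using souslin_closed[of T "{}" "undefined::'i"] by simp
    ultimately show ?thesis by (simp add: bi_def)
  qed
  have bi_Compl: "bi (\<Omega> - S)" if "bi S" for S
    using that by (auto simp: bi_def double_diff)
  have bi_UN: "bi (\<Union>n. S n)" if "\<And>n::nat. bi (S n)" for S
  proof -
    have "\<Omega> - (\<Union>n. S n) = (\<Inter>n. \<Omega> - S n)" by auto
    moreover have "souslin T (\<Inter>n. \<Omega> - S n)"
      by (rule souslin_INT) (use that in \<open>simp add: bi_def\<close>)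
    moreover have "souslin T (\<Union>n. S n)"
      by (rule souslin_UN) (use that in \<open>simp add: bi_def\<close>)
    moreover have "(\<Union>n. S n) \<subseteq> \<Omega>" using that by (auto simp: bi_def)
    ultimately show ?thesis unfolding bi_def by simp
  qed
  have gen: "bi {x\<in>\<Omega>. x i \<in> K}" if "K \<in> sigma_sets (topspace T) {U. openin T U}" for i K
    using that
  proof (induction rule: sigma_sets.induct)
    case (Basic U)
    then have U: "openin T U" by simp
    obtain C :: "nat \<Rightarrow> 'a set" where C: "\<And>n. closedin T (C n)" "\<Union> (range C) = U"
      using open_imp_fsigma_in[OF met U] unfolding fsigma_in_ascending by metis
    have "{x\<in>\<Omega>. x i \<in> U} = (\<Union>n. {x. (\<forall>i. x i \<in> topspace T) \<and> x i \<in> C n})"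
      unfolding C(2)[symmetric] by (auto simp: \<Omega>_def)
    then have sU: "souslin T {x\<in>\<Omega>. x i \<in> U}"
      by (simp only:) (rule souslin_UN[OF souslin_closed[OF C(1)]])
    have "\<Omega> - {x\<in>\<Omega>. x i \<in> U} = {x. (\<forall>i. x i \<in> topspace T) \<and> x i \<in> topspace T - U}"
      by (auto simp: \<Omega>_def)
    then have "souslin T (\<Omega> - {x\<in>\<Omega>. x i \<in> U})"
      using souslin_closed[OF openin_closedin_eq[THEN iffD1, OF U, THEN conjunct2], of i] by simp
    then show ?case using sU by (simp add: bi_def)
  next
    case Empty then show ?case using bi_empty by simp
  next
    case (Compl a)
    have "{x\<in>\<Omega>. x i \<in> topspace T - a} = \<Omega> - {x\<in>\<Omega>. x i \<in> a}" by (auto simp: \<Omega>_def)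
    then show ?case using bi_Compl[OF Compl.IH] by simp
  next
    case (Union a)
    have "{x\<in>\<Omega>. x i \<in> \<Union> (range a)} = (\<Union>n. {x\<in>\<Omega>. x i \<in> a n})" by auto
    then show ?case using bi_UN[OF Union.IH] by simp
  qed
  have setsA: "sets A = sigma_sets (topspace T) {U. openin T U}"
    unfolding A by (rule sets_borel_of_topology)
  have sp: "(\<Pi>\<^sub>E i\<in>UNIV. space A) = \<Omega>" by (auto simp: \<Omega>_def spA PiE_def Pi_def)
  have "S \<in> sigma_sets \<Omega> {{f\<in>\<Omega>. f i \<in> K} | i K. i \<in> UNIV \<and> K \<in> sets A}"
    using S unfolding sets_PiM_single sp .
  then have "bi S"
  proof (induction rule: sigma_sets.induct)
    case (Basic a) then show ?case using gen setsA by auto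
  next
    case Empty then show ?case by (rule bi_empty)
  next
    case (Compl a) then show ?case by (intro bi_Compl)
  next
    case (Union a) then show ?case by (intro bi_UN)
  qed
  then show ?thesis by (simp add: bi_def)
qed

text \<open>The unknown values outside \<open>J\<close> are encoded in additional coordinates of the
  branch, as successive approximations from a dense sequence. Completeness turns the approximations
  back into a configuration, and closedness keeps the conditions true in the limit. Conditions at
  sites of \<open>J\<close> are tested on \<open>u\<close> and are the only dependence on
  \<open>u\<close>.\<close>

lemma (in Metric_space) souslin_projection:
  fixes S :: "('i::countable \<Rightarrow> 'a) set" and J :: "'i set"
  assumes mc: mcomplete and sep: "separable_space mtopology"
    and A: "sets A = sets (sigma (topspace mtopology) {U. openin mtopology U})"
    and P: "finite_measure P" "sets P = sets (PiM J (\<lambda>_. A))"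
    and S: "souslin mtopology S"
  shows "{u\<in>space P. \<exists>x\<in>S. \<forall>i\<in>J. x i = u i} \<in> sets (completion P)" (is "?E \<in> _")
proof -
  interpret P: finite_measure P by fact
  obtain R where "souslin_scheme mtopology R S" using S by (auto simp: souslin_def)
  note R = souslin_schemeD[OF this]
  have spA: "space A = M"
    using sets_eq_imp_space_eq[OF A] by (simp add: space_measure_of_conv)
  have closed_sets: "K \<in> sets A" if "closedin mtopology K" for K
    unfolding A by (rule closedin_sets_borel_of_topology[OF that])
  show ?thesis
  proof (cases "M = {}")
    case True
    have "x i \<in> M" if "x \<in> S" for x i using that R(3) by auto
    then have "S = {}" using True by blast
    then show ?thesis by simp
  next
    case False
    obtain C where C: "countable C" "C \<subseteq> M" "mtopology closure_of C = M"
      using sep unfolding separable_space_def by auto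
    then have "C \<noteq> {}" using False by auto
    define q where "q = from_nat_into C"
    have qM: "q n \<in> M" for n using from_nat_into[OF \<open>C \<noteq> {}\<close>] C(2) by (auto simp: q_def)
    have dense: "\<exists>n. d (q n) x < e" if x: "x \<in> M" and "e > 0" for x e
    proof -
      have "x \<in> mtopology closure_of C" using x C(3) by simp
      then obtain y where "y \<in> C" "y \<in> mball x e"
        using \<open>e > 0\<close> unfolding metric_closure_of by blast
      moreover obtain n where "q n = y" using from_nat_into_surj[OF C(1) \<open>y \<in> C\<close>] by (auto simp: q_def)
      ultimately show ?thesis by (auto simp: commute)
    qed
    \<comment> \<open>Even coordinates carry the branch of the given scheme, odd ones the indices of
      approximating points.\<close>
    define x_of where "x_of z = (\<lambda>j. z (2 * j))" for z :: "nat \<Rightarrow> nat"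
    define y_of where "y_of z = (\<lambda>j. z (2 * j + 1))" for z :: "nat \<Rightarrow> nat"
    \<comment> \<open>Requirement \<open>k\<close> concerns one site at one precision; the pairing
      runs through all combinations.\<close>
    define site where "site k = (from_nat (fst (prod_decode k)) :: 'i)" for k
    define prec where "prec k = (1/2 :: real) ^ snd (prod_decode k)" for k :: nat
    \<comment> \<open>\<open>good\<close> does not mention \<open>u\<close>: it asks that the first
      \<open>m\<close> requirements outside \<open>J\<close> be jointly satisfiable, by a
      configuration that may change with \<open>m\<close>.\<close>
    define good where "good m r y = (\<exists>w::'i \<Rightarrow> 'a. (\<forall>i. w i \<in> M) \<and>
        (\<forall>k<m. fst (r k) \<notin> J \<longrightarrow> w (fst (r k)) \<in> snd (r k)) \<and>
        (\<forall>k<m. site k \<notin> J \<longrightarrow> d (q (y k)) (w (site k)) \<le> prec k))"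
      for m and r :: "nat \<Rightarrow> 'i \<times> 'a set" and y :: "nat \<Rightarrow> nat"
    \<comment> \<open>Cutting \<open>r\<close> and \<open>y\<close> off at \<open>m\<close> changes
      nothing, since \<open>good m\<close> reads no further, and makes \<open>T m\<close> visibly
      finitely determined.\<close>
    define T where "T m z = (let r = (\<lambda>k. if k < m then R k (x_of z) else undefined);
        y = (\<lambda>k. if k < m then y_of z k else undefined) in
        {u\<in>space P. (\<forall>k\<in>{..<m}. fst (r k) \<in> J \<longrightarrow> u (fst (r k)) \<in> snd (r k)) \<and> good m r y})" for m z
    have good_cong: "good m r y = good m r' y'" if "\<forall>k<m. r k = r' k" "\<forall>k<m. y k = y' k" for m r r' y y'
      using that unfolding good_def by simp
    have T_eq: "T m z = {u\<in>space P. (\<forall>k\<in>{..<m}. fst (R k (x_of z)) \<in> J \<longrightarrow> u (fst (R k (x_of z))) \<in> snd (R k (x_of z)))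
        \<and> good m (\<lambda>k. R k (x_of z)) (y_of z)}" for m z
    proof -
      have "good m (\<lambda>k. if k < m then R k (x_of z) else undefined) (\<lambda>k. if k < m then y_of z k else undefined)
        = good m (\<lambda>k. R k (x_of z)) (y_of z)" by (rule good_cong) simp_all
      then show ?thesis by (simp add: T_def Let_def cong: conj_cong)
    qed
    have T_sets: "T m z \<in> sets P" for m z
    proof -
      have 1: "{u\<in>space P. fst (R k (x_of z)) \<in> J \<longrightarrow> u (fst (R k (x_of z))) \<in> snd (R k (x_of z))} \<in> sets P" for k
      proof (cases "fst (R k (x_of z)) \<in> J")
        case True
        have "(\<lambda>u. u (fst (R k (x_of z)))) \<in> measurable P A"
          using measurable_component_singleton[OF True, of "\<lambda>_. A"] P(2) by (simp cong: measurable_cong_sets)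
        from measurable_sets[OF this closed_sets[OF R(2)[of k "x_of z"]]]
        show ?thesis using True by (simp add: vimage_def Int_def conj_commute)
      qed simp
      \<comment> \<open>The condition is independent of \<open>u\<close>, so the set is empty or the
        whole space.\<close>
      have 2: "{u\<in>space P. good m (\<lambda>k. R k (x_of z)) (y_of z)} \<in> sets P" by simp
      have "{u\<in>space P. \<forall>k\<in>{..<m}. fst (R k (x_of z)) \<in> J \<longrightarrow> u (fst (R k (x_of z))) \<in> snd (R k (x_of z))} \<in> sets P"
        by (rule sets.sets_Collect_finite_All[OF 1]) simp_all
      from sets.sets_Collect_conj[OF 2 this] show ?thesis unfolding T_eq .
    qed
    have T_fd: "finitely_determined (T m)" for m
    proof -
      have x: "finitely_determined (\<lambda>z k. if k < m then R k (x_of z) else undefined)"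
        by (rule finitely_determined_all_less) (unfold x_of_def, rule finitely_determined_reindex[OF R(1)])
      have "finitely_determined (\<lambda>z::nat\<Rightarrow>nat. z n)" for n
        by (rule finitely_determinedI, rule exI[of _ "Suc n"]) simp
      then have y: "finitely_determined (\<lambda>z k. if k < m then y_of z k else undefined)"
        by (intro finitely_determined_all_less) (simp add: y_of_def)
      show ?thesis
        unfolding T_def Let_def
        by (rule finitely_determined_comp2[OF x y, where f="\<lambda>r y. {u\<in>space P. (\<forall>k\<in>{..<m}. fst (r k) \<in> J \<longrightarrow> u (fst (r k)) \<in> snd (r k)) \<and> good m r y}"])
    qed
    have "?E = {u\<in>space P. \<exists>z. \<forall>m. u \<in> T m z}"
    proof (intro equalityI subsetI)
      fix u assume "u \<in> ?E"
      then obtain x where x: "u \<in> space P" "x \<in> S" "\<And>i. i \<in> J \<Longrightarrow> x i = u i" by auto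
      from x(2) obtain z where z: "\<And>i. x i \<in> M" "\<And>m. x (fst (R m z)) \<in> snd (R m z)"
        using R(3) by auto
      have "\<forall>k. \<exists>n. d (q n) (x (site k)) < prec k"
        using dense[OF z(1)] by (simp add: prec_def)
      from choice[OF this] obtain y where y: "\<And>k. d (q (y k)) (x (site k)) < prec k" by blast
      define zz where "zz j = (if even j then z (j div 2) else y (j div 2))" for j
      have "x_of zz = z" "y_of zz = y" by (auto simp: zz_def x_of_def y_of_def)
      moreover have "good m (\<lambda>k. R k z) y" for m
        unfolding good_def using z y by (intro exI[of _ x]) (auto intro: less_imp_le)
      moreover have "u (fst (R k z)) \<in> snd (R k z)" if "fst (R k z) \<in> J" for k
        using z(2)[of k] x(3)[OF that] by simp
      ultimately have "\<forall>m. u \<in> T m zz" using x(1) by (simp add: T_eq)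
      then show "u \<in> {u\<in>space P. \<exists>z. \<forall>m. u \<in> T m z}" using x(1) by blast
    next
      fix u assume "u \<in> {u\<in>space P. \<exists>z. \<forall>m. u \<in> T m z}"
      then obtain z where u: "u \<in> space P" and z: "\<And>m. u \<in> T m z" by auto
      define r where "r = (\<lambda>k. R k (x_of z))"
      define y where "y = y_of z"
      have rc: "closedin mtopology (snd (r k))" for k using R(2) by (simp add: r_def)
      have uJ: "u (fst (r k)) \<in> snd (r k)" if "fst (r k) \<in> J" for k
        using z[of "Suc k"] that by (auto simp: T_eq r_def)
      have "\<forall>m. good m r y" using z by (simp add: T_eq r_def y_def)
      then have "\<forall>m. \<exists>w. (\<forall>i. w i \<in> M) \<and>
        (\<forall>k<m. fst (r k) \<notin> J \<longrightarrow> w (fst (r k)) \<in> snd (r k)) \<and>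
        (\<forall>k<m. site k \<notin> J \<longrightarrow> d (q (y k)) (w (site k)) \<le> prec k)"
        by (simp add: good_def)
      from choice[OF this] obtain w where w0: "\<forall>m. (\<forall>i. w m i \<in> M) \<and>
        (\<forall>k<m. fst (r k) \<notin> J \<longrightarrow> w m (fst (r k)) \<in> snd (r k)) \<and>
        (\<forall>k<m. site k \<notin> J \<longrightarrow> d (q (y k)) (w m (site k)) \<le> prec k)" ..
      have w: "\<And>m i. w m i \<in> M"
        "\<And>m k. k < m \<Longrightarrow> fst (r k) \<notin> J \<Longrightarrow> w m (fst (r k)) \<in> snd (r k)"
        "\<And>m k. k < m \<Longrightarrow> site k \<notin> J \<Longrightarrow> d (q (y k)) (w m (site k)) \<le> prec k"
        using w0 by simp_all
      \<comment> \<open>Every stage has its own configuration \<open>w m\<close>, but from stage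
        \<open>k + 1\<close> on all of them are within \<open>prec k\<close> of the same point
        \<open>q (y k)\<close> at that site. This forces Cauchy sequences.\<close>
      have "\<exists>l. limitin mtopology (\<lambda>m. w m i) l sequentially" if "i \<notin> J" for i
      proof -
        have "MCauchy (\<lambda>m. w m i)"
          unfolding MCauchy_def
        proof (intro conjI allI impI)
          show "range (\<lambda>m. w m i) \<subseteq> M" using w(1) by auto
          fix e :: real assume "e > 0"
          then obtain l where l: "(1/2) ^ l < e / 2" using real_arch_pow_inv[of "e/2" "1/2"] by auto
          define k where "k = prod_encode (to_nat i, l)"
          have k: "site k = i" "prec k = (1/2) ^ l" by (simp_all add: k_def site_def prec_def)
          have "d (w n i) (w n' i) < e" if "Suc k \<le> n" "Suc k \<le> n'" for n n'
          proof -
            have "d (w n i) (w n' i) \<le> d (q (y k)) (w n i) + d (q (y k)) (w n' i)"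
              using triangle[of "w n i" "q (y k)" "w n' i"] w(1) qM by (simp add: commute)
            also have "\<dots> \<le> prec k + prec k"
              using w(3)[of k n] w(3)[of k n'] that k \<open>i \<notin> J\<close> by (intro add_mono) auto
            also have "\<dots> < e" using l k by simp
            finally show ?thesis .
          qed
          then show "\<exists>N. \<forall>n n'. N \<le> n \<longrightarrow> N \<le> n' \<longrightarrow> d (w n i) (w n' i) < e" by blast
        qed
        then show ?thesis using mc by (simp add: mcomplete_def)
      qed
      then have "\<forall>i. \<exists>l. i \<notin> J \<longrightarrow> limitin mtopology (\<lambda>m. w m i) l sequentially" by blast
      from choice[OF this] obtain v where v: "\<And>i. i \<notin> J \<Longrightarrow> limitin mtopology (\<lambda>m. w m i) (v i) sequentially" by blast
      define x where "x i = (if i \<in> J then u i else v i)" for i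
      have uM: "u i \<in> M" if "i \<in> J" for i
        using u sets_eq_imp_space_eq[OF P(2)] that by (auto simp: space_PiM spA PiE_def Pi_def)
      have "x i \<in> M" for i
        using uM limitin_mspace[OF v] by (simp add: x_def)
      moreover have "x (fst (r k)) \<in> snd (r k)" for k
      proof (cases "fst (r k) \<in> J")
        case True then show ?thesis using uJ by (simp add: x_def)
      next
        case False
        have "eventually (\<lambda>m. w m (fst (r k)) \<in> snd (r k)) sequentially"
          using eventually_gt_at_top[of k] by eventually_elim (rule w(2)[OF _ False])
        from limitin_closedin[OF v[OF False] rc this] show ?thesis using False by (simp add: x_def)
      qed
      ultimately have "x \<in> S" unfolding R(3) r_def by auto
      moreover have "\<forall>i\<in>J. x i = u i" by (simp add: x_def)
      ultimately show "u \<in> ?E" using u by blast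
    qed
    then show ?thesis using P.souslin_in_completion[of T, OF T_sets T_fd] by simp
  qed
qed

section \<open>Standard Borel spaces and nonconstant fibres\<close>

lemma standard_borelE:
  assumes "standard_borel A"
  obtains M d where "Metric_space M d" "Metric_space.mcomplete M d"
    "separable_space (Metric_space.mtopology M d)" "space A = M"
    "sets A = sets (sigma (topspace (Metric_space.mtopology M d)) {U. openin (Metric_space.mtopology M d) U})"
proof -
  obtain T where T: "completely_metrizable_space T" "separable_space T"
    "sets A = sets (sigma (topspace T) {U. openin T U})"
    using assms unfolding standard_borel_def by blast
  obtain M d where M: "Metric_space M d" "Metric_space.mcomplete M d" "T = Metric_space.mtopology M d"
    using T(1) unfolding completely_metrizable_space_def by blast
  have "space A = M"
    using sets_eq_imp_space_eq[OF T(3)] M by (simp add: space_measure_of_conv Metric_space.topspace_mtopology)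
  with M T that show ?thesis by blast
qed

lemma standard_borel_projection:
  fixes S :: "('i::countable \<Rightarrow> 'a) set"
  assumes "standard_borel A" "S \<in> sets (PiM UNIV (\<lambda>_. A))"
    and "finite_measure P" "sets P = sets (PiM J (\<lambda>_. A))"
  shows "{u\<in>space P. \<exists>x\<in>S. \<forall>i\<in>J. x i = u i} \<in> sets (completion P)"
proof -
  from standard_borelE[OF assms(1)] obtain M d where M: "Metric_space M d" "Metric_space.mcomplete M d"
    "separable_space (Metric_space.mtopology M d)"
    "sets A = sets (sigma (topspace (Metric_space.mtopology M d)) {U. openin (Metric_space.mtopology M d) U})"
    by metis
  then interpret Metric_space M d by simp
  have "souslin mtopology S"
    by (rule souslin_sets_PiM[OF metrizable_space_mtopology M(4) assms(2)])
  from souslin_projection[OF M(2,3,4) assms(3,4) this] show ?thesis .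
qed

text \<open>Balls with reciprocal radii around a countable dense set. Through them, the inequality
  of two outputs becomes a countable disjunction of measurable statements.\<close>

lemma standard_borel_separating:
  assumes "standard_borel B"
  obtains U :: "nat \<Rightarrow> 'b set" where "\<And>n. U n \<in> sets B"
    "\<And>b b'. b \<in> space B \<Longrightarrow> b' \<in> space B \<Longrightarrow> b \<noteq> b' \<Longrightarrow> \<exists>n. b \<in> U n \<and> b' \<notin> U n"
proof -
  from standard_borelE[OF assms] obtain M d where M: "Metric_space M d"
    "separable_space (Metric_space.mtopology M d)" "space B = M"
    "sets B = sets (sigma (topspace (Metric_space.mtopology M d)) {U. openin (Metric_space.mtopology M d) U})"
    by metis
  interpret Metric_space M d by fact
  obtain C where C: "countable C" "C \<subseteq> M" "mtopology closure_of C = M"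
    using M(2) unfolding separable_space_def by auto
  define U where "U n = (case prod_decode n of (i, k) \<Rightarrow> mball (from_nat_into C i) (1 / Suc k))" for n
  show thesis
  proof (rule that[of U])
    fix n
    have "openin mtopology (U n)" by (simp add: U_def split: prod.split)
    then show "U n \<in> sets B" unfolding M(4) sets_borel_of_topology by (intro sigma_sets.Basic) simp
  next
    fix b b' assume b: "b \<in> space B" "b' \<in> space B" "b \<noteq> b'"
    then have bM: "b \<in> M" "b' \<in> M" using M(3) by auto
    then have "d b b' > 0" using b(3) by simp
    then obtain k where k: "1 / Suc k < d b b' / 2" 
      by (metis nat_approx_posE half_gt_zero)
    have "b \<in> mtopology closure_of C" using C(3) bM by simp
    then obtain y where y: "y \<in> C" "y \<in> mball b (1 / Suc k)"
    proof -
      have "(0::real) < 1 / Suc k" by simp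
      with \<open>b \<in> mtopology closure_of C\<close> show ?thesis using that unfolding metric_closure_of by blast
    qed
    obtain i where i: "from_nat_into C i = y" using from_nat_into_surj[OF C(1) y(1)] by auto
    have "b \<in> mball y (1 / Suc k)" using y(2) by (auto simp: commute)
    moreover have "b' \<notin> mball y (1 / Suc k)"
    proof
      assume "b' \<in> mball y (1 / Suc k)"
      then have "d y b' < 1 / Suc k" "d b y < 1 / Suc k" "y \<in> M" using y(2) by auto
      then show False using triangle[of b y b'] bM k by simp
    qed
    ultimately have "b \<in> U (prod_encode (i, k)) \<and> b' \<notin> U (prod_encode (i, k))"
      by (simp add: U_def i)
    then show "\<exists>n. b \<in> U n \<and> b' \<notin> U n" by blast
  qed
qed

text \<open>The two witnesses are coupled only by \<open>g x \<noteq> g x'\<close>. A separating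
  sequence decouples them: for some \<open>n\<close>, \<open>u\<close> lies in the projection of the
  preimage of \<open>U n\<close> and in that of the preimage of its complement, and each projection
  is measurable on its own.\<close>

lemma nonconstant_fibre_in_completion:
  fixes g :: "('i::countable \<Rightarrow> 'a) \<Rightarrow> 'b"
  assumes A: "standard_borel A" and B: "standard_borel B"
    and g: "g \<in> measurable (PiM UNIV (\<lambda>_. A)) B"
    and P: "finite_measure P" "sets P = sets (PiM J (\<lambda>_. A))"
  shows "{u\<in>space P. \<exists>x\<in>space (PiM UNIV (\<lambda>_. A)). \<exists>x'\<in>space (PiM UNIV (\<lambda>_. A)).
    (\<forall>i\<in>J. x i = u i) \<and> (\<forall>i\<in>J. x' i = u i) \<and> g x \<noteq> g x'} \<in> sets (completion P)" (is "?E \<in> _")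
proof -
  let ?O = "PiM UNIV (\<lambda>_::'i. A)"
  obtain U :: "nat \<Rightarrow> 'b set" where U: "\<And>n. U n \<in> sets B"
    "\<And>b b'. b \<in> space B \<Longrightarrow> b' \<in> space B \<Longrightarrow> b \<noteq> b' \<Longrightarrow> \<exists>n. b \<in> U n \<and> b' \<notin> U n"
    using standard_borel_separating[OF B] by metis
  define S where "S n = g -` U n \<inter> space ?O" for n
  define S' where "S' n = g -` (space B - U n) \<inter> space ?O" for n
  have S: "S n \<in> sets ?O" and S': "S' n \<in> sets ?O" for n
    using measurable_sets[OF g] U(1) by (auto simp: S_def S'_def)
  define p where "p S = {u\<in>space P. \<exists>x\<in>S. \<forall>i\<in>J. x i = u i}" for S
  have gB: "g x \<in> space B" if "x \<in> space ?O" for x using measurable_space[OF g that] .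
  have "?E = (\<Union>n. p (S n) \<inter> p (S' n))"
  proof (intro equalityI subsetI)
    fix u assume "u \<in> ?E"
    then obtain x x' where x: "u \<in> space P" "x \<in> space ?O" "x' \<in> space ?O"
      "\<forall>i\<in>J. x i = u i" "\<forall>i\<in>J. x' i = u i" "g x \<noteq> g x'" by blast
    obtain n where "g x \<in> U n" "g x' \<notin> U n" using U(2)[OF gB[OF x(2)] gB[OF x(3)] x(6)] by blast
    then have "x \<in> S n" "x' \<in> S' n" using x gB by (auto simp: S_def S'_def)
    then have "u \<in> p (S n) \<inter> p (S' n)" using x unfolding p_def by blast
    then show "u \<in> (\<Union>n. p (S n) \<inter> p (S' n))" by blast
  next
    fix u assume "u \<in> (\<Union>n. p (S n) \<inter> p (S' n))"
    then obtain n where "u \<in> p (S n)" "u \<in> p (S' n)" by blast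
    then obtain x x' where x: "u \<in> space P" "x \<in> S n" "\<forall>i\<in>J. x i = u i" "x' \<in> S' n" "\<forall>i\<in>J. x' i = u i"
      unfolding p_def by blast
    then have "g x \<noteq> g x'" "x \<in> space ?O" "x' \<in> space ?O" by (auto simp: S_def S'_def)
    with x show "u \<in> ?E" by blast
  qed
  moreover have "p (S n) \<in> sets (completion P)" "p (S' n) \<in> sets (completion P)" for n
    unfolding p_def using standard_borel_projection[OF A S P] standard_borel_projection[OF A S' P] by blast+
  ultimately show ?thesis by auto
qed

section \<open>An exponential moment bound with random block costs\<close>

text \<open>This is the reciprocal of the quadratic Taylor bound for \<open>exp w\<close>; the two
  quadratics multiply to \<open>1 + w^4 / 4\<close>. It holds for arbitrarily large
  \<open>w\<close>, which matters because the random costs are to enter through their second moments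
  only.\<close>

lemma exp_minus_le_quadratic:
  fixes w :: real assumes "0 \<le> w" shows "exp (- w) \<le> 1 - w + w\<^sup>2 / 2"
proof -
  have *: "(1 + w + w\<^sup>2 / 2) * (1 - w + w\<^sup>2 / 2) = 1 + w^4 / 4"
    by (simp add: power2_eq_square power4_eq_xxxx field_simps)
  have pos: "0 < 1 + w + w\<^sup>2 / 2" using assms by (intro add_pos_nonneg) auto
  have "exp (- w) \<le> 1 / (1 + w + w\<^sup>2 / 2)"
    using exp_lower_Taylor_quadratic[OF assms] pos by (simp add: exp_minus field_simps)
  also have "\<dots> \<le> 1 - w + w\<^sup>2 / 2"
    using pos * by (simp add: pos_divide_le_eq mult.commute)
  finally show ?thesis .
qed

section \<open>Exponential moments under finitely supported product distributions\<close>

lemma pmf_expectation_mono: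
  fixes f g :: "'a \<Rightarrow> real"
  assumes "finite (set_pmf p)" "\<And>x. x \<in> set_pmf p \<Longrightarrow> f x \<le> g x"
  shows "measure_pmf.expectation p f \<le> measure_pmf.expectation p g"
  using assms by (intro integral_mono_AE integrable_measure_pmf_finite) (auto simp: AE_measure_pmf_iff)

lemma pmf_expectation_pos:
  fixes f :: "'a \<Rightarrow> real"
  assumes "finite (set_pmf p)" "\<And>x. x \<in> set_pmf p \<Longrightarrow> 0 < f x"
  shows "0 < measure_pmf.expectation p f"
proof -
  define c where "c = Min (f ` set_pmf p)"
  have "0 < c" using assms set_pmf_not_empty[of p] by (auto simp: c_def)
  also have "c = measure_pmf.expectation p (\<lambda>_. c)" by simp
  also have "\<dots> \<le> measure_pmf.expectation p f"
    by (rule pmf_expectation_mono) (use assms in \<open>auto simp: c_def\<close>)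
  finally show ?thesis .
qed

lemma pmf_expectation_pair:
  fixes f :: "'a \<times> 'b \<Rightarrow> real"
  assumes p: "finite (set_pmf p)" and q: "finite (set_pmf q)"
  shows "measure_pmf.expectation (pair_pmf p q) f =
    measure_pmf.expectation p (\<lambda>x. measure_pmf.expectation q (\<lambda>y. f (x, y)))"
proof -
  have "measure_pmf.expectation (pair_pmf p q) f = (\<Sum>(x, y)\<in>set_pmf p \<times> set_pmf q. f (x, y) * (pmf p x * pmf q y))"
    using p q by (subst integral_measure_pmf_real[of "set_pmf p \<times> set_pmf q"]) (auto simp: pmf_pair split_def intro!: sum.cong)
  also have "\<dots> = (\<Sum>x\<in>set_pmf p. (\<Sum>y\<in>set_pmf q. f (x, y) * pmf q y) * pmf p x)"
    by (simp add: sum.cartesian_product[symmetric] sum_distrib_right mult_ac sum_distrib_left)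
  also have "\<dots> = measure_pmf.expectation p (\<lambda>x. measure_pmf.expectation q (\<lambda>y. f (x, y)))"
    using p q by (simp add: integral_measure_pmf_real[of "set_pmf p"] integral_measure_pmf_real[of "set_pmf q"])
  finally show ?thesis .
qed

lemma finite_set_Pi_pmf:
  assumes "finite A" "\<And>x. x \<in> A \<Longrightarrow> finite (set_pmf (p x))"
  shows "finite (set_pmf (Pi_pmf A d p))"
  using assms by (simp add: set_Pi_pmf finite_PiE_dflt)

lemma Pi_pmf_expectation_insert:
  fixes g :: "('i \<Rightarrow> 'a) \<Rightarrow> real"
  assumes "finite A" "i \<notin> A" "\<And>x. x \<in> insert i A \<Longrightarrow> finite (set_pmf (p x))"
  shows "measure_pmf.expectation (Pi_pmf (insert i A) d p) g =
    measure_pmf.expectation (p i) (\<lambda>y. measure_pmf.expectation (Pi_pmf A d p) (\<lambda>f. g (f(i := y))))"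
  using assms by (subst Pi_pmf_insert) (auto simp: pmf_expectation_pair finite_set_Pi_pmf case_prod_beta)

lemma Pi_pmf_expectation_union:
  fixes g :: "('i \<Rightarrow> 'a) \<Rightarrow> real"
  assumes "finite A" "finite B" "A \<inter> B = {}" "\<And>x. x \<in> A \<union> B \<Longrightarrow> finite (set_pmf (p x))"
  shows "measure_pmf.expectation (Pi_pmf (A \<union> B) d p) g =
    measure_pmf.expectation (Pi_pmf A d p) (\<lambda>t. measure_pmf.expectation (Pi_pmf B d p)
      (\<lambda>w. g (\<lambda>x. if x \<in> A then t x else w x)))"
  using assms by (subst Pi_pmf_union) (auto simp: pmf_expectation_pair finite_set_Pi_pmf case_prod_beta cong: if_cong)

lemma pmf_expectation_exp_minus_le:
  fixes W :: "'a \<Rightarrow> real"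
  assumes p: "finite (set_pmf p)" and W: "\<And>x. x \<in> set_pmf p \<Longrightarrow> 0 \<le> W x"
  shows "measure_pmf.expectation p (\<lambda>x. exp (- W x)) \<le>
    exp (- measure_pmf.expectation p W + measure_pmf.expectation p (\<lambda>x. (W x)\<^sup>2) / 2)"
proof -
  note i = integrable_measure_pmf_finite[OF p]
  have "measure_pmf.expectation p (\<lambda>x. exp (- W x)) \<le> measure_pmf.expectation p (\<lambda>x. 1 - W x + (W x)\<^sup>2 / 2)"
    using exp_minus_le_quadratic W by (intro pmf_expectation_mono p) blast
  also have "\<dots> = 1 + (- measure_pmf.expectation p W + measure_pmf.expectation p (\<lambda>x. (W x)\<^sup>2) / 2)"
    by (simp add: i)
  also have "\<dots> \<le> exp (- measure_pmf.expectation p W + measure_pmf.expectation p (\<lambda>x. (W x)\<^sup>2) / 2)"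
    by (rule exp_ge_add_one_self)
  finally show ?thesis .
qed

text \<open>Measured from the maximum, the deviation \<open>m - M x\<close> is nonnegative and at
  most \<open>s\<close>, so the one-sided quadratic bound applies with a second moment of at most
  \<open>s\<^sup>2\<close>.\<close>

lemma pmf_expectation_exp_lipschitz:
  fixes M :: "'a \<Rightarrow> real"
  assumes p: "finite (set_pmf p)" and M: "\<And>x y. x \<in> set_pmf p \<Longrightarrow> y \<in> set_pmf p \<Longrightarrow> M x \<le> M y + s"
  shows "measure_pmf.expectation p (\<lambda>x. exp (M x)) \<le> exp (measure_pmf.expectation p M + s\<^sup>2 / 2)"
proof -
  note i = integrable_measure_pmf_finite[OF p]
  define m where "m = Max (M ` set_pmf p)"
  have m: "M x \<le> m" if "x \<in> set_pmf p" for x using that p by (simp add: m_def)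
  have "m \<in> M ` set_pmf p" unfolding m_def using p set_pmf_not_empty[of p] by (intro Max_in) auto
  then have m': "m - M x \<le> s" if "x \<in> set_pmf p" for x using M that by force
  have "measure_pmf.expectation p (\<lambda>x. exp (M x)) = exp m * measure_pmf.expectation p (\<lambda>x. exp (- (m - M x)))"
    by (simp add: i flip: exp_add integral_mult_right_zero)
  also have "\<dots> \<le> exp m * exp (- measure_pmf.expectation p (\<lambda>x. m - M x) + measure_pmf.expectation p (\<lambda>x. (m - M x)\<^sup>2) / 2)"
    using m by (intro mult_left_mono pmf_expectation_exp_minus_le p) (auto simp: algebra_simps)
  also have "\<dots> = exp (measure_pmf.expectation p M + measure_pmf.expectation p (\<lambda>x. (m - M x)\<^sup>2) / 2)"
    by (simp add: i exp_add[symmetric])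
  also have "\<dots> \<le> exp (measure_pmf.expectation p M + s\<^sup>2 / 2)"
  proof -
    have "measure_pmf.expectation p (\<lambda>x. (m - M x)\<^sup>2) \<le> measure_pmf.expectation p (\<lambda>x. s\<^sup>2)"
      using m m' by (intro pmf_expectation_mono p power_mono) auto
    then show ?thesis by simp
  qed
  finally show ?thesis .
qed

lemma PiE_dflt_fun_upd:
  assumes "f \<in> PiE_dflt A d B" "y \<in> B i"
  shows "f(i := y) \<in> PiE_dflt (insert i A) d B"
  using assms by (auto simp: PiE_dflt_def)

text \<open>Integrating out the other coordinates on the logarithmic scale preserves Lipschitz
  bounds: \<open>N\<close> again varies by at most \<open>s i\<close>, because
  \<open>exp (s i)\<close> factors out of the expectation. The one-coordinate bound then applies to
  \<open>N\<close>.\<close>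

lemma Pi_pmf_expectation_exp_lipschitz:
  fixes M :: "('i \<Rightarrow> 'a) \<Rightarrow> real" and s :: "'i \<Rightarrow> real"
  assumes "finite D" and s: "\<And>i. 0 \<le> s i" and "\<And>i. i \<in> D \<Longrightarrow> finite (set_pmf (p i))"
    and "\<And>x y. x \<in> PiE_dflt D d (set_pmf \<circ> p) \<Longrightarrow> y \<in> PiE_dflt D d (set_pmf \<circ> p) \<Longrightarrow>
      M y \<le> M x + (\<Sum>i\<in>D. s i * of_bool (x i \<noteq> y i))"
  shows "measure_pmf.expectation (Pi_pmf D d p) (\<lambda>x. exp (M x))
    \<le> exp (measure_pmf.expectation (Pi_pmf D d p) M + (\<Sum>i\<in>D. (s i)\<^sup>2) / 2)"
  using assms(1,3,4)
proof (induction D arbitrary: M rule: finite_induct)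
  case empty
  then show ?case by simp
next
  case (insert i D)
  let ?E = "measure_pmf.expectation (Pi_pmf D d p)"
  have p: "finite (set_pmf (p i))" "\<And>j. j \<in> D \<Longrightarrow> finite (set_pmf (p j))" using insert.prems(1) by auto
  note fin = finite_set_Pi_pmf[OF insert.hyps(1) p(2), where d=d]
  have pos: "0 < ?E (\<lambda>f. exp (M (f(i := y))))" for y
    by (rule pmf_expectation_pos[OF fin]) auto
  define N where "N y = ln (?E (\<lambda>f. exp (M (f(i := y)))))" for y
  have expN: "exp (N y) = ?E (\<lambda>f. exp (M (f(i := y))))" for y using pos by (simp add: N_def)
  have IH: "exp (N y) \<le> exp (?E (\<lambda>f. M (f(i := y))) + (\<Sum>i\<in>D. (s i)\<^sup>2) / 2)" if "y \<in> set_pmf (p i)" for y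
    unfolding expN
  proof (rule insert.IH[OF p(2)], assumption)
    fix x x' assume x: "x \<in> PiE_dflt D d (set_pmf \<circ> p)" "x' \<in> PiE_dflt D d (set_pmf \<circ> p)"
    have "M (x'(i := y)) \<le> M (x(i := y)) + (\<Sum>j\<in>insert i D. s j * of_bool ((x(i := y)) j \<noteq> (x'(i := y)) j))"
      by (rule insert.prems(2); rule PiE_dflt_fun_upd) (use x that in \<open>auto simp: comp_def\<close>)
    also have "(\<Sum>j\<in>insert i D. s j * of_bool ((x(i := y)) j \<noteq> (x'(i := y)) j)) = (\<Sum>j\<in>D. s j * of_bool (x j \<noteq> x' j))"
      using insert.hyps by (subst sum.insert) (auto intro!: sum.cong)
    finally show "M (x'(i := y)) \<le> M (x(i := y)) + (\<Sum>j\<in>D. s j * of_bool (x j \<noteq> x' j))" .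
  qed
  have lip: "N y \<le> N y' + s i" if "y \<in> set_pmf (p i)" "y' \<in> set_pmf (p i)" for y y'
  proof (cases "y = y'")
    case True
    then show ?thesis using s[of i] by simp
  next
    case False
    have "?E (\<lambda>f. exp (M (f(i := y)))) \<le> ?E (\<lambda>f. exp (s i) * exp (M (f(i := y'))))"
    proof (rule pmf_expectation_mono[OF fin])
      fix f assume "f \<in> set_pmf (Pi_pmf D d p)"
      then have f: "f \<in> PiE_dflt D d (set_pmf \<circ> p)" by (simp only: set_Pi_pmf[OF insert.hyps(1)])
      have "M (f(i := y)) \<le> M (f(i := y')) + (\<Sum>j\<in>insert i D. s j * of_bool ((f(i := y')) j \<noteq> (f(i := y)) j))"
        by (rule insert.prems(2); rule PiE_dflt_fun_upd) (use f that in \<open>auto simp: comp_def\<close>)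
      also have "(\<Sum>j\<in>insert i D. s j * of_bool ((f(i := y')) j \<noteq> (f(i := y)) j)) = s i"
        using insert.hyps False by (subst sum.insert) (auto intro!: sum.neutral)
      finally have "M (f(i := y)) \<le> s i + M (f(i := y'))" by (simp only: add.commute)
      then show "exp (M (f(i := y))) \<le> exp (s i) * exp (M (f(i := y')))"
        by (simp only: mult_exp_exp exp_le_cancel_iff)
    qed
    also have "\<dots> = exp (s i) * ?E (\<lambda>f. exp (M (f(i := y'))))" by (rule integral_mult_right_zero)
    finally have "exp (N y) \<le> exp (s i + N y')" by (simp only: expN exp_add)
    then show ?thesis by (simp add: add.commute)
  qed
  have "measure_pmf.expectation (Pi_pmf (insert i D) d p) (\<lambda>x. exp (M x)) = measure_pmf.expectation (p i) (\<lambda>y. exp (N y))"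
    unfolding expN by (rule Pi_pmf_expectation_insert) (use insert in auto)
  also have "\<dots> \<le> exp (measure_pmf.expectation (p i) N + (s i)\<^sup>2 / 2)"
    by (rule pmf_expectation_exp_lipschitz[OF p(1) lip])
  also have "\<dots> \<le> exp (measure_pmf.expectation (p i) (\<lambda>y. ?E (\<lambda>f. M (f(i := y))) + (\<Sum>i\<in>D. (s i)\<^sup>2) / 2) + (s i)\<^sup>2 / 2)"
    using IH by (simp add: pmf_expectation_mono p(1))
  also have "\<dots> = exp (measure_pmf.expectation (Pi_pmf (insert i D) d p) M + (\<Sum>i\<in>insert i D. (s i)\<^sup>2) / 2)"
    using insert.hyps p by (subst Pi_pmf_expectation_insert)
      (auto simp: integrable_measure_pmf_finite add_divide_distrib)
  finally show ?case .
qed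

lemma pmf_expectation_square_le:
  fixes u :: "'a \<Rightarrow> real"
  assumes p: "finite (set_pmf p)"
  shows "(measure_pmf.expectation p u)\<^sup>2 \<le> measure_pmf.expectation p (\<lambda>x. (u x)\<^sup>2)"
proof -
  note i = integrable_measure_pmf_finite[OF p]
  define c where "c = measure_pmf.expectation p u"
  have "0 \<le> measure_pmf.expectation p (\<lambda>x. (u x - c)\<^sup>2)" by simp
  also have "\<dots> = measure_pmf.expectation p (\<lambda>x. (u x)\<^sup>2) - 2 * c * c + c\<^sup>2"
    by (simp add: power2_diff i c_def)
  finally show ?thesis by (simp add: c_def power2_eq_square)
qed

text \<open>
  \<open>f\<close> is dominated by the \<open>s\<close>-Lipschitz function \<open>M y = (MIN x. g x + l x + \<rho> x y)\<close> and by \<open>g\<close>, hence by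
  \<open>M - W\<close> with \<open>0 \<le> W \<le> l\<close>; the factors \<open>exp M\<close> and \<open>exp (- W)\<close> are separated by Cauchy-Schwarz, in the
  form of the arithmetic-geometric mean inequality for the normalised factors.
\<close>

lemma Pi_pmf_expectation_exp_one_block:
  fixes f g l :: "('i \<Rightarrow> 'a) \<Rightarrow> real" and s :: "'i \<Rightarrow> real"
  assumes D: "finite D" and s: "\<And>i. 0 \<le> s i" and p: "\<And>i. i \<in> D \<Longrightarrow> finite (set_pmf (p i))"
    and l: "\<And>x. 0 \<le> l x"
    and f: "\<And>x y. x \<in> PiE_dflt D d (set_pmf \<circ> p) \<Longrightarrow> y \<in> PiE_dflt D d (set_pmf \<circ> p) \<Longrightarrow>
      f y \<le> g x + l x * of_bool (x \<noteq> y) + (\<Sum>i\<in>D. s i * of_bool (x i \<noteq> y i))"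
  shows "measure_pmf.expectation (Pi_pmf D d p) (\<lambda>x. exp (f x)) \<le>
    exp (measure_pmf.expectation (Pi_pmf D d p) g + (\<Sum>i\<in>D. (s i)\<^sup>2) +
      measure_pmf.expectation (Pi_pmf D d p) (\<lambda>x. (l x)\<^sup>2))"
proof -
  let ?P = "Pi_pmf D d p"
  let ?E = "measure_pmf.expectation ?P"
  define X where "X = set_pmf ?P"
  have X: "X = PiE_dflt D d (set_pmf \<circ> p)" by (simp add: X_def set_Pi_pmf D)
  have fin: "finite X" "finite (set_pmf ?P)" unfolding X_def by (intro finite_set_Pi_pmf D p; assumption)+
  have ne: "X \<noteq> {}" by (simp add: X_def set_pmf_not_empty)
  note i = integrable_measure_pmf_finite[OF fin(2)]
  define \<rho> where "\<rho> x y = (\<Sum>i\<in>D. s i * of_bool (x i \<noteq> y i))" for x y :: "'i \<Rightarrow> 'a"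
  have \<rho>0: "\<rho> x x = 0" for x by (simp add: \<rho>_def)
  have \<rho>_tri: "\<rho> x z \<le> \<rho> x y + \<rho> y z" for x y z
    unfolding \<rho>_def sum.distrib[symmetric] by (rule sum_mono) (use s in auto)
  define M where "M y = Min ((\<lambda>x. g x + l x + \<rho> x y) ` X)" for y
  have M_le: "M y \<le> g x + l x + \<rho> x y" if "x \<in> X" for x y
    unfolding M_def using fin(1) that by (intro Min_le) auto
  have M_attain: "\<exists>x\<in>X. M y = g x + l x + \<rho> x y" for y
  proof -
    have "M y \<in> (\<lambda>x. g x + l x + \<rho> x y) ` X" unfolding M_def using fin(1) ne by (intro Min_in) auto
    then show ?thesis by auto
  qed
  have M_lip: "M z \<le> M y + \<rho> y z" for y z
  proof -
    obtain x where x: "x \<in> X" "M y = g x + l x + \<rho> x y" using M_attain by blast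
    show ?thesis using M_le[OF x(1), of z] x(2) \<rho>_tri[of x z y] by simp
  qed
  have f_le_M: "f y \<le> M y" if "y \<in> X" for y
  proof -
    obtain x where x: "x \<in> X" "M y = g x + l x + \<rho> x y" using M_attain by blast
    have "l x * of_bool (x \<noteq> y) \<le> l x" using l by simp
    then show ?thesis using f[of x y] x that by (simp add: X \<rho>_def)
  qed
  \<comment> \<open>Taking both configurations equal removes the two indicator terms.\<close>
  have f_le_g: "f y \<le> g y" if "y \<in> X" for y using f[of y y] that by (simp add: X)
  define W where "W x = max 0 (M x - g x)" for x
  have W: "0 \<le> W x" for x by (simp add: W_def)
  have W_le: "W x \<le> l x" if "x \<in> X" for x using M_le[OF that, of x] l by (simp add: W_def \<rho>0)
  \<comment> \<open>The factors are squared before being bounded: doubling the exponent turns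
    \<open>(s i)\<^sup>2 / 2\<close> into \<open>2 * (s i)\<^sup>2\<close>, and the square root
    leaves coefficient 1. The same happens to the second moment of \<open>W\<close>.\<close>
  define a where "a = ?E M + (\<Sum>i\<in>D. (s i)\<^sup>2)"
  define b where "b = - ?E W + ?E (\<lambda>x. (W x)\<^sup>2)"
  have "?E (\<lambda>x. exp (2 * M x)) \<le> exp (?E (\<lambda>x. 2 * M x) + (\<Sum>i\<in>D. (2 * s i)\<^sup>2) / 2)"
  proof (rule Pi_pmf_expectation_exp_lipschitz[OF D _ p])
    fix x y
    show "2 * M y \<le> 2 * M x + (\<Sum>i\<in>D. 2 * s i * of_bool (x i \<noteq> y i))"
      using M_lip[of y x] by (simp add: \<rho>_def mult.assoc flip: sum_distrib_left)
  qed (use s in auto)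
  also have "\<dots> = exp (2 * a)"
    by (simp add: a_def power_mult_distrib sum_distrib_left[symmetric])
  finally have a: "?E (\<lambda>x. exp (2 * M x)) \<le> exp (2 * a)" .
  have "?E (\<lambda>x. exp (- (2 * W x))) \<le> exp (- ?E (\<lambda>x. 2 * W x) + ?E (\<lambda>x. (2 * W x)\<^sup>2) / 2)"
    by (rule pmf_expectation_exp_minus_le[OF fin(2)]) (simp add: W)
  also have "\<dots> = exp (2 * b)" by (simp add: b_def power_mult_distrib)
  finally have b: "?E (\<lambda>x. exp (- (2 * W x))) \<le> exp (2 * b)" .
  have "?E (\<lambda>x. exp (f x)) \<le> ?E (\<lambda>x. exp (a + b) * ((exp (2 * M x) / exp (2 * a) + exp (- (2 * W x)) / exp (2 * b)) / 2))"
  proof (rule pmf_expectation_mono[OF fin(2)])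
    fix x assume "x \<in> set_pmf ?P"
    then have x: "x \<in> X" by (simp add: X_def)
    have "f x \<le> M x - W x" using f_le_M[OF x] f_le_g[OF x] by (simp add: W_def)
    then have "exp (f x) \<le> exp (a + b) * (exp (M x - a) * exp (- W x - b))"
      by (simp add: exp_add[symmetric])
    also have "exp (M x - a) * exp (- W x - b) \<le> ((exp (M x - a))\<^sup>2 + (exp (- W x - b))\<^sup>2) / 2"
      using sum_squares_bound[of "exp (M x - a)" "exp (- W x - b)"] by simp
    also have "\<dots> = (exp (2 * M x) / exp (2 * a) + exp (- (2 * W x)) / exp (2 * b)) / 2"
    proof -
      have "(exp (u - v))\<^sup>2 = exp (2 * u) / exp (2 * v)" for u v :: real
        by (simp add: exp_diff power_divide exp_double)
      from this[of "M x" a] this[of "- W x" b] show ?thesis by simp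
    qed
    finally show "exp (f x) \<le> exp (a + b) * ((exp (2 * M x) / exp (2 * a) + exp (- (2 * W x)) / exp (2 * b)) / 2)"
      by simp
  qed
  also have "\<dots> = exp (a + b) * ((?E (\<lambda>x. exp (2 * M x)) / exp (2 * a) + ?E (\<lambda>x. exp (- (2 * W x))) / exp (2 * b)) / 2)"
    by (simp add: i)
  also have "\<dots> \<le> exp (a + b) * ((1 + 1) / 2)"
    using a b by (intro mult_left_mono divide_right_mono add_mono) auto
  also have "\<dots> \<le> exp (?E g + (\<Sum>i\<in>D. (s i)\<^sup>2) + ?E (\<lambda>x. (l x)\<^sup>2))"
  proof -
    \<comment> \<open>The means recombine: the negative mean of \<open>W\<close> is exactly what
      pays for passing from \<open>M\<close>, which includes the cost \<open>l\<close>, back to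
      \<open>g\<close>.\<close>
    have "?E (\<lambda>x. M x - W x) \<le> ?E g"
      by (rule pmf_expectation_mono[OF fin(2)]) (simp add: W_def)
    moreover have "?E (\<lambda>x. (W x)\<^sup>2) \<le> ?E (\<lambda>x. (l x)\<^sup>2)"
      by (rule pmf_expectation_mono[OF fin(2)]) (use W W_le in \<open>auto intro!: power_mono simp: X_def\<close>)
    ultimately show ?thesis by (simp add: a_def b_def i)
  qed
  finally show ?thesis .
qed

text \<open>\<open>F\<close> and \<open>G\<close> are kept apart because the induction hypothesis
  compares \<open>F\<close> on the fibre over one value \<open>t\<close> of the block
  \<open>D\<close> with \<open>G\<close> on the fibre over another value \<open>r\<close>; the price
  of changing that block is absorbed into \<open>G\<close>. All costs are read at the first
  configuration, so they stay with \<open>r\<close>.\<close>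

lemma Pi_pmf_expectation_exp_blocks:
  fixes F G :: "('i \<Rightarrow> 'a) \<Rightarrow> real" and L :: "'i set \<Rightarrow> ('i \<Rightarrow> 'a) \<Rightarrow> real" and s :: "'i \<Rightarrow> real"
  assumes "finite \<C>" "\<And>C. C \<in> \<C> \<Longrightarrow> finite C" "disjoint \<C>"
    and s: "\<And>i. 0 \<le> s i" and "\<And>i. i \<in> \<Union>\<C> \<Longrightarrow> finite (set_pmf (p i))"
    and "\<And>C x. 0 \<le> L C x"
    and "\<And>x y. x \<in> PiE_dflt (\<Union>\<C>) d (set_pmf \<circ> p) \<Longrightarrow> y \<in> PiE_dflt (\<Union>\<C>) d (set_pmf \<circ> p) \<Longrightarrow>
      F y \<le> G x + (\<Sum>C\<in>\<C>. L C x * of_bool (\<exists>i\<in>C. x i \<noteq> y i)) + (\<Sum>i\<in>\<Union>\<C>. s i * of_bool (x i \<noteq> y i))"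
  shows "measure_pmf.expectation (Pi_pmf (\<Union>\<C>) d p) (\<lambda>x. exp (F x)) \<le>
    exp (measure_pmf.expectation (Pi_pmf (\<Union>\<C>) d p) G + (\<Sum>i\<in>\<Union>\<C>. (s i)\<^sup>2) +
      (\<Sum>C\<in>\<C>. measure_pmf.expectation (Pi_pmf (\<Union>\<C>) d p) (\<lambda>x. (L C x)\<^sup>2)))"
  using assms(1,2,3,5,6,7)
proof (induction \<C> arbitrary: F G L rule: finite_induct)
  case empty
  show ?case using empty.prems(5)[of "\<lambda>_. d" "\<lambda>_. d"] by (simp add: PiE_dflt_def)
next
  case (insert D \<C>)
  define V where "V = \<Union>\<C>"
  have D: "finite D" and V: "finite V" and DV: "D \<inter> V = {}"
    using insert.prems(1,2) insert.hyps by (auto simp: V_def disjoint_def)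
  have pD: "\<And>i. i \<in> D \<Longrightarrow> finite (set_pmf (p i))" and pV: "\<And>i. i \<in> V \<Longrightarrow> finite (set_pmf (p i))"
    using insert.prems(3) by (auto simp: V_def)
  let ?D = "measure_pmf.expectation (Pi_pmf D d p)"
  let ?V = "measure_pmf.expectation (Pi_pmf V d p)"
  note finD = finite_set_Pi_pmf[OF D pD, where d=d] and finV = finite_set_Pi_pmf[OF V pV, where d=d]
  note iD = integrable_measure_pmf_finite[OF finD] and iV = integrable_measure_pmf_finite[OF finV]
  define m where "m t w = (\<lambda>x. if x \<in> D then t x else w x)" for t w :: "'i \<Rightarrow> 'a"
  have union: "measure_pmf.expectation (Pi_pmf (\<Union>(insert D \<C>)) d p) g = ?D (\<lambda>t. ?V (\<lambda>w. g (m t w)))"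
    for g :: "('i \<Rightarrow> 'a) \<Rightarrow> real"
    using Pi_pmf_expectation_union[OF D V DV, of p d g] pD pV by (auto simp: m_def V_def)
  have m_in: "m t w \<in> PiE_dflt (\<Union>(insert D \<C>)) d (set_pmf \<circ> p)"
    if "t \<in> PiE_dflt D d (set_pmf \<circ> p)" "w \<in> PiE_dflt V d (set_pmf \<circ> p)" for t w
    using that by (auto simp: PiE_dflt_def m_def V_def)
  define f where "f t = ln (?V (\<lambda>w. exp (F (m t w))))" for t
  have "0 < ?V (\<lambda>w. exp (F (m t w)))" for t by (rule pmf_expectation_pos[OF finV]) auto
  then have expf: "exp (f t) = ?V (\<lambda>w. exp (F (m t w)))" for t by (simp add: f_def)
  define g where "g r = ?V (\<lambda>w. G (m r w)) + (\<Sum>i\<in>V. (s i)\<^sup>2) + (\<Sum>C\<in>\<C>. ?V (\<lambda>w. (L C (m r w))\<^sup>2))" for r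
  define l where "l r = ?V (\<lambda>w. L D (m r w))" for r
  have f_le: "f t \<le> g r + l r * of_bool (r \<noteq> t) + (\<Sum>i\<in>D. s i * of_bool (r i \<noteq> t i))"
    if r: "r \<in> PiE_dflt D d (set_pmf \<circ> p)" and t: "t \<in> PiE_dflt D d (set_pmf \<circ> p)" for r t
  proof -
    let ?c = "\<Sum>i\<in>D. s i * of_bool (r i \<noteq> t i)"
    have "?V (\<lambda>w. exp (F (m t w))) \<le> exp (?V (\<lambda>w. G (m r w) + L D (m r w) * of_bool (r \<noteq> t) + ?c)
        + (\<Sum>i\<in>V. (s i)\<^sup>2) + (\<Sum>C\<in>\<C>. ?V (\<lambda>w. (L C (m r w))\<^sup>2)))"
      unfolding V_def
    proof (rule insert.IH)
      fix x y assume x: "x \<in> PiE_dflt (\<Union>\<C>) d (set_pmf \<circ> p)" and y: "y \<in> PiE_dflt (\<Union>\<C>) d (set_pmf \<circ> p)"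
      have "F (m t y) \<le> G (m r x) + (\<Sum>C\<in>insert D \<C>. L C (m r x) * of_bool (\<exists>i\<in>C. m r x i \<noteq> m t y i))
          + (\<Sum>i\<in>\<Union>(insert D \<C>). s i * of_bool (m r x i \<noteq> m t y i))"
        using x y r t by (intro insert.prems(5) m_in) (auto simp: V_def)
      also have "(\<Sum>C\<in>insert D \<C>. L C (m r x) * of_bool (\<exists>i\<in>C. m r x i \<noteq> m t y i))
          = L D (m r x) * of_bool (\<exists>i\<in>D. r i \<noteq> t i) + (\<Sum>C\<in>\<C>. L C (m r x) * of_bool (\<exists>i\<in>C. x i \<noteq> y i))"
      proof -
        have "(\<exists>i\<in>C. m r x i \<noteq> m t y i) \<longleftrightarrow> (\<exists>i\<in>C. x i \<noteq> y i)" if "C \<in> \<C>" for C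
        proof -
          have "m r x i = x i" "m t y i = y i" if "i \<in> C" for i
            using that \<open>C \<in> \<C>\<close> DV by (auto simp: m_def V_def)
          then show ?thesis by (simp cong: bex_cong)
        qed
        then have "(\<Sum>C\<in>\<C>. L C (m r x) * of_bool (\<exists>i\<in>C. m r x i \<noteq> m t y i))
            = (\<Sum>C\<in>\<C>. L C (m r x) * of_bool (\<exists>i\<in>C. x i \<noteq> y i))"
          by (intro sum.cong) simp_all
        moreover have "(\<exists>i\<in>D. m r x i \<noteq> m t y i) \<longleftrightarrow> (\<exists>i\<in>D. r i \<noteq> t i)"
          by (simp add: m_def)
        ultimately show ?thesis using insert.hyps by simp
      qed
      also have "L D (m r x) * of_bool (\<exists>i\<in>D. r i \<noteq> t i) \<le> L D (m r x) * of_bool (r \<noteq> t)"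
        using insert.prems(4) by (auto simp: fun_eq_iff)
      also have "(\<Sum>i\<in>\<Union>(insert D \<C>). s i * of_bool (m r x i \<noteq> m t y i))
          = ?c + (\<Sum>i\<in>\<Union>\<C>. s i * of_bool (x i \<noteq> y i))"
      proof -
        have "(\<Sum>i\<in>D \<union> V. s i * of_bool (m r x i \<noteq> m t y i)) =
          (\<Sum>i\<in>D. s i * of_bool (m r x i \<noteq> m t y i)) + (\<Sum>i\<in>V. s i * of_bool (m r x i \<noteq> m t y i))"
          by (rule sum.union_disjoint[OF D V DV])
        also have "(\<Sum>i\<in>D. s i * of_bool (m r x i \<noteq> m t y i)) = ?c"
          by (rule sum.cong) (auto simp: m_def)
        also have "(\<Sum>i\<in>V. s i * of_bool (m r x i \<noteq> m t y i)) = (\<Sum>i\<in>V. s i * of_bool (x i \<noteq> y i))"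
          by (rule sum.cong) (use DV in \<open>auto simp: m_def\<close>)
        finally show ?thesis by (simp add: V_def)
      qed
      finally show "F (m t y) \<le> G (m r x) + L D (m r x) * of_bool (r \<noteq> t) + ?c +
          (\<Sum>C\<in>\<C>. L C (m r x) * of_bool (\<exists>i\<in>C. x i \<noteq> y i)) + (\<Sum>i\<in>\<Union>\<C>. s i * of_bool (x i \<noteq> y i))"
        by simp
    qed (use insert.prems in \<open>auto simp: disjoint_def\<close>)
    then have "exp (f t) \<le> exp (g r + l r * of_bool (r \<noteq> t) + ?c)"
      by (simp add: expf g_def l_def iV algebra_simps)
    then show ?thesis by simp
  qed
  have "measure_pmf.expectation (Pi_pmf (\<Union>(insert D \<C>)) d p) (\<lambda>x. exp (F x)) = ?D (\<lambda>t. exp (f t))"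
    by (simp only: union expf)
  also have "\<dots> \<le> exp (?D g + (\<Sum>i\<in>D. (s i)\<^sup>2) + ?D (\<lambda>r. (l r)\<^sup>2))"
    by (rule Pi_pmf_expectation_exp_one_block[OF D s pD _ f_le])
      (use insert.prems(4) in \<open>auto simp: l_def\<close>)
  \<comment> \<open>The one-block bound sees only the conditional mean of \<open>L D\<close>;
    Jensen's inequality moves the square inside.\<close>
  also have "\<dots> \<le> exp (?D g + (\<Sum>i\<in>D. (s i)\<^sup>2) + ?D (\<lambda>r. ?V (\<lambda>w. (L D (m r w))\<^sup>2)))"
    unfolding l_def using pmf_expectation_square_le[OF finV] by (simp add: pmf_expectation_mono finD)
  also have "\<dots> = exp (measure_pmf.expectation (Pi_pmf (\<Union>(insert D \<C>)) d p) G + (\<Sum>i\<in>\<Union>(insert D \<C>). (s i)\<^sup>2) +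
      (\<Sum>C\<in>insert D \<C>. measure_pmf.expectation (Pi_pmf (\<Union>(insert D \<C>)) d p) (\<lambda>x. (L C x)\<^sup>2)))"
  proof -
    have "(\<Sum>i\<in>\<Union>(insert D \<C>). (s i)\<^sup>2) = (\<Sum>i\<in>D. (s i)\<^sup>2) + (\<Sum>i\<in>V. (s i)\<^sup>2)"
      using sum.union_disjoint[OF D V DV] by (simp add: V_def)
    moreover have "?D g = ?D (\<lambda>t. ?V (\<lambda>w. G (m t w))) + (\<Sum>i\<in>V. (s i)\<^sup>2) + (\<Sum>C\<in>\<C>. ?D (\<lambda>t. ?V (\<lambda>w. (L C (m t w))\<^sup>2)))"
      unfolding g_def by (simp add: iD)
    ultimately show ?thesis using insert.hyps by (simp only: union sum.insert) (simp add: algebra_simps)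
  qed
  finally show ?case .
qed

section \<open>From finite distributions to general product measures\<close>

lemma pmf_of_countable_distr:
  fixes c :: "'a \<Rightarrow> 'z::countable"
  assumes "prob_space N" "c \<in> measurable N (count_space UNIV)"
  obtains q where "measure_pmf q = distr N (count_space UNIV) c"
proof -
  interpret prob_space N by fact
  interpret D: prob_space "distr N (count_space UNIV) c" by (rule prob_space_distr) fact
  let ?D = "distr N (count_space UNIV) c"
  have "(\<Union>x\<in>{x. measure ?D {x} = 0}. {x}) \<in> null_sets ?D"
    by (rule null_sets_UN') (auto simp: null_sets_def D.emeasure_eq_measure countableI_type)
  then have "AE x in ?D. measure ?D {x} \<noteq> 0"
    by (rule AE_I') auto
  then have "?D \<in> {M. prob_space M \<and> sets M = UNIV \<and> (AE x in M. measure M {x} \<noteq> 0)}"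
    using D.prob_space_axioms by simp
  from that[of "Abs_pmf ?D", OF Abs_pmf_inverse[OF this]] show thesis .
qed

text \<open>Both functions are bounded, so rounding their values to a grid splits the space into
  finitely many cells, and one representative per cell carries its mass. Representatives are points
  of the space, so inequalities assumed pointwise remain true on the support.\<close>

lemma (in prob_space) finite_pmf_approximation:
  fixes \<phi> \<psi> :: "'a \<Rightarrow> real"
  assumes \<phi>: "\<phi> \<in> borel_measurable M" "\<And>x. x \<in> space M \<Longrightarrow> \<bar>\<phi> x\<bar> \<le> B"
    and \<psi>: "\<psi> \<in> borel_measurable M" "\<And>x. x \<in> space M \<Longrightarrow> \<bar>\<psi> x\<bar> \<le> B"
    and e: "0 < e"
  obtains p where "finite (set_pmf p)" "set_pmf p \<subseteq> space M"
    "\<bar>measure_pmf.expectation p \<phi> - expectation \<phi>\<bar> < e"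
    "\<bar>measure_pmf.expectation p \<psi> - expectation \<psi>\<bar> < e"
proof -
  obtain k :: nat where k: "1 / real (Suc k) < e" using nat_approx_posE[OF e] by metis
  define c where "c x = (\<lfloor>real (Suc k) * \<phi> x\<rfloor>, \<lfloor>real (Suc k) * \<psi> x\<rfloor>)" for x
  have c_meas: "c \<in> measurable M (count_space UNIV)"
  proof -
    have "c \<in> measurable M (count_space UNIV \<Otimes>\<^sub>M count_space UNIV)"
      unfolding c_def using \<phi>(1) \<psi>(1) by measurable
    then show ?thesis by (simp add: pair_measure_countable)
  qed
  obtain q where q: "measure_pmf q = distr M (count_space UNIV) c"
    using pmf_of_countable_distr[OF prob_space_axioms c_meas] .
  have B: "0 \<le> B" using \<phi>(2) not_empty by fastforce
  have setq: "set_pmf q \<subseteq> c ` space M"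
  proof
    fix z assume "z \<in> set_pmf q"
    then have "measure (measure_pmf q) {z} \<noteq> 0" by (simp add: set_pmf.rep_eq)
    then have "measure M (c -` {z} \<inter> space M) \<noteq> 0" unfolding q using c_meas by (simp add: measure_distr)
    then have "c -` {z} \<inter> space M \<noteq> {}" by (metis measure_empty)
    then obtain x where "x \<in> space M" "c x = z" by blast
    then show "z \<in> c ` space M" by blast
  qed
  have bnd: "\<lfloor>real (Suc k) * r\<rfloor> \<in> {- \<lceil>real (Suc k) * B\<rceil> .. \<lceil>real (Suc k) * B\<rceil>}" if "\<bar>r\<bar> \<le> B" for r
  proof -
    have fl: "\<lfloor>v\<rfloor> \<in> {- \<lceil>b\<rceil> .. \<lceil>b\<rceil>}" if "- b \<le> v" "v \<le> b" for b v :: real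
      using that by simp linarith
    have "real (Suc k) * r \<le> real (Suc k) * B" "real (Suc k) * (- B) \<le> real (Suc k) * r"
      using that by (intro mult_left_mono; simp)+
    then show ?thesis by (intro fl) simp_all
  qed
  have "c ` space M \<subseteq> {- \<lceil>real (Suc k) * B\<rceil> .. \<lceil>real (Suc k) * B\<rceil>} \<times> {- \<lceil>real (Suc k) * B\<rceil> .. \<lceil>real (Suc k) * B\<rceil>}"
    using bnd \<phi>(2) \<psi>(2) unfolding c_def by blast
  then have "finite (c ` space M)" by (rule finite_subset) simp
  then have finq: "finite (set_pmf q)" using setq finite_subset by blast
  define rep where "rep z = (SOME x. x \<in> space M \<and> c x = z)" for z
  have rep: "rep z \<in> space M \<and> c (rep z) = z" if "z \<in> c ` space M" for z
  proof -
    from that obtain x where "x \<in> space M \<and> c x = z" by blast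
    then show ?thesis unfolding rep_def by (rule someI)
  qed
  have close: "\<bar>r - r'\<bar> \<le> 1 / Suc k" if "\<lfloor>real (Suc k) * r\<rfloor> = \<lfloor>real (Suc k) * r'\<rfloor>" for r r'
  proof -
    have "\<bar>real (Suc k) * r - real (Suc k) * r'\<bar> \<le> 1" using that by linarith
    then have "real (Suc k) * \<bar>r - r'\<bar> \<le> 1" by (simp add: abs_mult flip: right_diff_distrib)
    then show ?thesis by (simp add: field_simps)
  qed
  have approx: "\<bar>measure_pmf.expectation (map_pmf rep q) h - expectation h\<bar> < e"
    if h: "h \<in> borel_measurable M" "\<And>x. x \<in> space M \<Longrightarrow> \<bar>h x\<bar> \<le> B"
      and hc: "\<And>x y. c x = c y \<Longrightarrow> \<bar>h x - h y\<bar> \<le> 1 / Suc k" for h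
  proof -
    have "measure_pmf.expectation (map_pmf rep q) h = (\<integral>z. h (rep z) \<partial>distr M (count_space UNIV) c)"
      by (simp add: q)
    also have "\<dots> = expectation (\<lambda>x. h (rep (c x)))" using c_meas by (simp add: integral_distr)
    finally have 1: "measure_pmf.expectation (map_pmf rep q) h = expectation (\<lambda>x. h (rep (c x)))" .
    have hm: "(\<lambda>x. h (rep (c x))) \<in> borel_measurable M"
      using measurable_compose[OF c_meas, of "\<lambda>z. h (rep z)"] by simp
    have i1: "integrable M (\<lambda>x. h (rep (c x)))"
      by (rule integrable_const_bound[of _ B]) (use hm rep h(2) in auto)
    have i2: "integrable M h" by (rule integrable_const_bound[of _ B]) (use h in auto)
    have "\<bar>expectation (\<lambda>x. h (rep (c x))) - expectation h\<bar> = \<bar>expectation (\<lambda>x. h (rep (c x)) - h x)\<bar>"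
      using i1 i2 by simp
    also have "\<dots> \<le> expectation (\<lambda>x. \<bar>h (rep (c x)) - h x\<bar>)" by (rule integral_abs_bound)
    also have "\<dots> \<le> expectation (\<lambda>x. 1 / Suc k)"
      using i1 i2 by (intro integral_mono hc) (auto simp: rep)
    also have "\<dots> < e" using k by (simp add: prob_space)
    finally show ?thesis unfolding 1 .
  qed
  show thesis
  proof (rule that[of "map_pmf rep q"])
    show "finite (set_pmf (map_pmf rep q))" using finq by simp
    show "set_pmf (map_pmf rep q) \<subseteq> space M" using setq rep by auto
    show "\<bar>measure_pmf.expectation (map_pmf rep q) \<phi> - expectation \<phi>\<bar> < e"
      by (rule approx[OF \<phi>]) (auto simp: c_def simp del: of_nat_Suc intro!: close)
    show "\<bar>measure_pmf.expectation (map_pmf rep q) \<psi> - expectation \<psi>\<bar> < e"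
      by (rule approx[OF \<psi>]) (auto simp: c_def simp del: of_nat_Suc intro!: close)
  qed
qed

text \<open>Coordinates are discretised one at a time, and only two given integrals have to be
  preserved. The new coordinate is discretised against functions already averaged over the discrete
  law of the others, so the two errors of \<open>e / 2\<close> simply add.\<close>

lemma Pi_pmf_approximation:
  fixes \<nu> :: "'a measure" and \<phi> \<psi> :: "('i \<Rightarrow> 'a) \<Rightarrow> real"
  assumes \<nu>: "prob_space \<nu>" and "finite I"
    and "\<phi> \<in> borel_measurable (PiM I (\<lambda>_. \<nu>))" "\<And>x. x \<in> space (PiM I (\<lambda>_. \<nu>)) \<Longrightarrow> \<bar>\<phi> x\<bar> \<le> B"
    and "\<psi> \<in> borel_measurable (PiM I (\<lambda>_. \<nu>))" "\<And>x. x \<in> space (PiM I (\<lambda>_. \<nu>)) \<Longrightarrow> \<bar>\<psi> x\<bar> \<le> B"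
    and e: "0 < e"
  shows "\<exists>p. (\<forall>i\<in>I. finite (set_pmf (p i)) \<and> set_pmf (p i) \<subseteq> space \<nu>) \<and>
    \<bar>measure_pmf.expectation (Pi_pmf I undefined p) \<phi> - (\<integral>x. \<phi> x \<partial>PiM I (\<lambda>_. \<nu>))\<bar> < e \<and>
    \<bar>measure_pmf.expectation (Pi_pmf I undefined p) \<psi> - (\<integral>x. \<psi> x \<partial>PiM I (\<lambda>_. \<nu>))\<bar> < e"
  using assms(2-7)
proof (induction I arbitrary: \<phi> \<psi> e rule: finite_induct)
  case empty
  have "(\<integral>x. h x \<partial>PiM {} (\<lambda>_. \<nu>)) = h (\<lambda>_. undefined)" for h :: "('i \<Rightarrow> 'a) \<Rightarrow> real"
    by (simp add: PiM_empty lebesgue_integral_count_space_finite)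
  then show ?case using empty.prems by simp
next
  case (insert i I)
  interpret \<nu>: prob_space \<nu> by fact
  interpret product_sigma_finite "\<lambda>_::'i. \<nu>"
    by (simp add: product_sigma_finite_def \<nu>.sigma_finite_measure_axioms)
  interpret PI: prob_space "PiM I (\<lambda>_. \<nu>)" by (rule prob_space_PiM) (rule \<nu>)
  interpret PIi: prob_space "PiM (insert i I) (\<lambda>_. \<nu>)" by (rule prob_space_PiM) (rule \<nu>)
  let ?P = "PiM I (\<lambda>_. \<nu>)" and ?Pi = "PiM (insert i I) (\<lambda>_. \<nu>)"
  have upd: "f(i := y) \<in> space ?Pi" if "f \<in> space ?P" "y \<in> space \<nu>" for f y
    using that by (auto simp: space_PiM PiE_def extensional_def)
  have pair: "(\<lambda>(f, y). h (f(i := y))) \<in> borel_measurable (?P \<Otimes>\<^sub>M \<nu>)"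
    if "h \<in> borel_measurable ?Pi" for h :: "('i \<Rightarrow> 'a) \<Rightarrow> real"
    using measurable_compose[OF measurable_add_dim that] by (simp add: split_def)
  define \<Phi> where "\<Phi> h f = (\<integral>y. h (f(i := y)) \<partial>\<nu>)" for h :: "('i \<Rightarrow> 'a) \<Rightarrow> real" and f
  have \<Phi>_meas: "\<Phi> h \<in> borel_measurable ?P" if "h \<in> borel_measurable ?Pi" for h
    unfolding \<Phi>_def using \<nu>.borel_measurable_lebesgue_integral[OF pair[OF that]] by simp
  have sect: "(\<lambda>y. h (f(i := y))) \<in> borel_measurable \<nu>" if "h \<in> borel_measurable ?Pi" "f \<in> space ?P"
    for h :: "('i \<Rightarrow> 'a) \<Rightarrow> real" and f
    using measurable_compose[OF measurable_Pair1'[OF that(2)] pair[OF that(1)]] by simp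
  have \<Phi>_bound: "\<bar>\<Phi> h f\<bar> \<le> B" if h: "h \<in> borel_measurable ?Pi" "\<And>x. x \<in> space ?Pi \<Longrightarrow> \<bar>h x\<bar> \<le> B" and f: "f \<in> space ?P" for h f
  proof -
    have "\<bar>\<Phi> h f\<bar> \<le> (\<integral>y. \<bar>h (f(i := y))\<bar> \<partial>\<nu>)" unfolding \<Phi>_def by (rule integral_abs_bound)
    also have "\<dots> \<le> (\<integral>y. B \<partial>\<nu>)"
      by (rule integral_mono \<nu>.integrable_const_bound[of _ B])+
        (use sect[OF h(1) f] h(2) upd[OF f] in auto)
    finally show ?thesis by (simp add: \<nu>.prob_space)
  qed
  have \<Phi>_int: "(\<integral>f. \<Phi> h f \<partial>?P) = (\<integral>x. h x \<partial>?Pi)"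
    if h: "h \<in> borel_measurable ?Pi" "\<And>x. x \<in> space ?Pi \<Longrightarrow> \<bar>h x\<bar> \<le> B" for h
    unfolding \<Phi>_def using insert.hyps h
    by (intro product_integral_insert[symmetric] PIi.integrable_const_bound[of _ B]) auto
  have b1: "\<bar>\<Phi> \<phi> f\<bar> \<le> B" if "f \<in> space ?P" for f
    by (rule \<Phi>_bound[OF insert.prems(1) _ that]) (rule insert.prems(2))
  have b2: "\<bar>\<Phi> \<psi> f\<bar> \<le> B" if "f \<in> space ?P" for f
    by (rule \<Phi>_bound[OF insert.prems(3) _ that]) (rule insert.prems(4))
  have int1: "(\<integral>f. \<Phi> \<phi> f \<partial>?P) = (\<integral>x. \<phi> x \<partial>?Pi)"
    by (rule \<Phi>_int[OF insert.prems(1)]) (rule insert.prems(2))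
  have int2: "(\<integral>f. \<Phi> \<psi> f \<partial>?P) = (\<integral>x. \<psi> x \<partial>?Pi)"
    by (rule \<Phi>_int[OF insert.prems(3)]) (rule insert.prems(4))
  have e2: "0 < e / 2" using insert.prems(5) by simp
  obtain p where pI: "\<forall>j\<in>I. finite (set_pmf (p j)) \<and> set_pmf (p j) \<subseteq> space \<nu>" and p_approx:
    "\<bar>measure_pmf.expectation (Pi_pmf I undefined p) (\<Phi> \<phi>) - (\<integral>x. \<phi> x \<partial>?Pi)\<bar> < e / 2"
    "\<bar>measure_pmf.expectation (Pi_pmf I undefined p) (\<Phi> \<psi>) - (\<integral>x. \<psi> x \<partial>?Pi)\<bar> < e / 2"
  proof -
    have "\<exists>p. (\<forall>j\<in>I. finite (set_pmf (p j)) \<and> set_pmf (p j) \<subseteq> space \<nu>) \<and>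
      \<bar>measure_pmf.expectation (Pi_pmf I undefined p) (\<Phi> \<phi>) - (\<integral>x. \<phi> x \<partial>?Pi)\<bar> < e / 2 \<and>
      \<bar>measure_pmf.expectation (Pi_pmf I undefined p) (\<Phi> \<psi>) - (\<integral>x. \<psi> x \<partial>?Pi)\<bar> < e / 2"
      unfolding int1[symmetric] int2[symmetric]
      by (rule insert.IH[OF \<Phi>_meas[OF insert.prems(1)] _ \<Phi>_meas[OF insert.prems(3)] _ e2]) (rule b1 b2, assumption)+
    then show thesis using that by blast
  qed
  have p: "\<And>j. j \<in> I \<Longrightarrow> finite (set_pmf (p j))" "\<And>j. j \<in> I \<Longrightarrow> set_pmf (p j) \<subseteq> space \<nu>"
    using pI by auto
  let ?E = "measure_pmf.expectation (Pi_pmf I undefined p)"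
  have fin: "finite (set_pmf (Pi_pmf I undefined p))" by (rule finite_set_Pi_pmf[OF insert.hyps(1) p(1)])
  have sub: "f \<in> space ?P" if "f \<in> set_pmf (Pi_pmf I undefined p)" for f
    using that p(2) insert.hyps(1) by (auto simp: set_Pi_pmf PiE_dflt_def space_PiM PiE_def extensional_def)
  define \<Psi> where "\<Psi> h y = ?E (\<lambda>f. h (f(i := y)))" for h :: "('i \<Rightarrow> 'a) \<Rightarrow> real" and y
  have \<Psi>_sum: "\<Psi> h y = (\<Sum>f\<in>set_pmf (Pi_pmf I undefined p). h (f(i := y)) * pmf (Pi_pmf I undefined p) f)" for h y
    unfolding \<Psi>_def by (rule integral_measure_pmf_real[OF fin])
  have \<Psi>_meas: "\<Psi> h \<in> borel_measurable \<nu>" if "h \<in> borel_measurable ?Pi" for h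
    unfolding \<Psi>_sum using sect[OF that sub] by (intro borel_measurable_sum borel_measurable_times) auto
  have \<Psi>_bound: "\<bar>\<Psi> h y\<bar> \<le> B" if h: "\<And>x. x \<in> space ?Pi \<Longrightarrow> \<bar>h x\<bar> \<le> B" and y: "y \<in> space \<nu>" for h y
  proof -
    have "\<bar>\<Psi> h y\<bar> \<le> ?E (\<lambda>f. \<bar>h (f(i := y))\<bar>)" unfolding \<Psi>_def by (rule integral_abs_bound)
    also have "\<dots> \<le> ?E (\<lambda>_. B)" by (rule pmf_expectation_mono[OF fin]) (use h upd sub y in auto)
    finally show ?thesis by simp
  qed
  have \<Psi>_int: "(\<integral>y. \<Psi> h y \<partial>\<nu>) = ?E (\<Phi> h)"
    if h: "h \<in> borel_measurable ?Pi" "\<And>x. x \<in> space ?Pi \<Longrightarrow> \<bar>h x\<bar> \<le> B" for h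
  proof -
    have int: "integrable \<nu> (\<lambda>y. h (f(i := y)))" if "f \<in> set_pmf (Pi_pmf I undefined p)" for f
      using sect[OF h(1) sub[OF that]] h(2) upd[OF sub[OF that]]
      by (intro \<nu>.integrable_const_bound[of _ B]) auto
    have "(\<integral>y. \<Psi> h y \<partial>\<nu>) = (\<Sum>f\<in>set_pmf (Pi_pmf I undefined p). \<Phi> h f * pmf (Pi_pmf I undefined p) f)"
      unfolding \<Psi>_sum using int by (simp add: \<Phi>_def)
    also have "\<dots> = ?E (\<Phi> h)" by (rule integral_measure_pmf_real[OF fin, symmetric])
    finally show ?thesis .
  qed
  obtain r where r: "finite (set_pmf r)" "set_pmf r \<subseteq> space \<nu>"
    "\<bar>measure_pmf.expectation r (\<Psi> \<phi>) - ?E (\<Phi> \<phi>)\<bar> < e / 2"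
    "\<bar>measure_pmf.expectation r (\<Psi> \<psi>) - ?E (\<Phi> \<psi>)\<bar> < e / 2"
  proof -
    have c1: "\<bar>\<Psi> \<phi> y\<bar> \<le> B" if "y \<in> space \<nu>" for y
      by (rule \<Psi>_bound[OF _ that]) (rule insert.prems(2))
    have c2: "\<bar>\<Psi> \<psi> y\<bar> \<le> B" if "y \<in> space \<nu>" for y
      by (rule \<Psi>_bound[OF _ that]) (rule insert.prems(4))
    have i1: "(\<integral>y. \<Psi> \<phi> y \<partial>\<nu>) = ?E (\<Phi> \<phi>)" by (rule \<Psi>_int[OF insert.prems(1)]) (rule insert.prems(2))
    have i2: "(\<integral>y. \<Psi> \<psi> y \<partial>\<nu>) = ?E (\<Phi> \<psi>)" by (rule \<Psi>_int[OF insert.prems(3)]) (rule insert.prems(4))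
    show thesis
      using \<nu>.finite_pmf_approximation[OF \<Psi>_meas[OF insert.prems(1)] c1 \<Psi>_meas[OF insert.prems(3)] c2 e2]
      unfolding i1 i2 using that by blast
  qed
  define p' where "p' = p(i := r)"
  have pm: "Pi_pmf I undefined p' = Pi_pmf I undefined p"
    using insert.hyps by (intro Pi_pmf_cong) (auto simp: p'_def)
  have E: "measure_pmf.expectation (Pi_pmf (insert i I) undefined p') h = measure_pmf.expectation r (\<Psi> h)" for h
    using insert.hyps p(1) r(1) by (subst Pi_pmf_expectation_insert) (auto simp: pm[unfolded p'_def] \<Psi>_def[abs_def] p'_def)
  have "\<forall>j\<in>insert i I. finite (set_pmf (p' j)) \<and> set_pmf (p' j) \<subseteq> space \<nu>"
    using p r by (auto simp: p'_def)
  moreover have tri: "\<bar>z - y\<bar> < e" if "\<bar>x - y\<bar> < e / 2" "\<bar>z - x\<bar> < e / 2" for x y z :: real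
    using that by linarith
  ultimately show ?case
    using tri[OF p_approx(1) r(3)] tri[OF p_approx(2) r(4)] unfolding E[symmetric] by blast
qed

text \<open>Under finite support the minimum that defines the dominating function is attained and
  raises no question of measurability; this is the reason for the detour through finite
  distributions. The cost inequality is pointwise and survives the restriction to a finite
  support.\<close>

proposition expectation_exp_blocks:
  fixes \<nu> :: "'a measure" and F :: "('i \<Rightarrow> 'a) \<Rightarrow> real" and L :: "'i set \<Rightarrow> ('i \<Rightarrow> 'a) \<Rightarrow> real" and s :: "'i \<Rightarrow> real"
  assumes \<nu>: "prob_space \<nu>" and \<C>: "finite \<C>" "\<And>C. C \<in> \<C> \<Longrightarrow> finite C" "disjoint \<C>"
    and s: "\<And>i. 0 \<le> s i"
    and F: "F \<in> borel_measurable (PiM (\<Union>\<C>) (\<lambda>_. \<nu>))" "\<And>x. x \<in> space (PiM (\<Union>\<C>) (\<lambda>_. \<nu>)) \<Longrightarrow> \<bar>F x\<bar> \<le> B"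
    and L: "\<And>C. L C \<in> borel_measurable (PiM (\<Union>\<C>) (\<lambda>_. \<nu>))" "\<And>C x. 0 \<le> L C x" "\<And>C x. L C x \<le> B"
    and cost: "\<And>x y. x \<in> space (PiM (\<Union>\<C>) (\<lambda>_. \<nu>)) \<Longrightarrow> y \<in> space (PiM (\<Union>\<C>) (\<lambda>_. \<nu>)) \<Longrightarrow>
      F y \<le> F x + (\<Sum>C\<in>\<C>. L C x * of_bool (\<exists>i\<in>C. x i \<noteq> y i)) + (\<Sum>i\<in>\<Union>\<C>. s i * of_bool (x i \<noteq> y i))"
  shows "(\<integral>x. exp (F x) \<partial>PiM (\<Union>\<C>) (\<lambda>_. \<nu>)) \<le>
    exp ((\<integral>x. F x \<partial>PiM (\<Union>\<C>) (\<lambda>_. \<nu>)) + (\<Sum>i\<in>\<Union>\<C>. (s i)\<^sup>2) + (\<Sum>C\<in>\<C>. \<integral>x. (L C x)\<^sup>2 \<partial>PiM (\<Union>\<C>) (\<lambda>_. \<nu>)))"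
proof -
  let ?P = "PiM (\<Union>\<C>) (\<lambda>_. \<nu>)"
  interpret P: prob_space ?P by (rule prob_space_PiM) (rule \<nu>)
  \<comment> \<open>All random terms of the right-hand side are collected in \<open>H\<close>, so
    that only the integrals of \<open>exp (F x)\<close> and \<open>H x\<close> have to be
    approximated.\<close>
  define H where "H x = F x + (\<Sum>C\<in>\<C>. (L C x)\<^sup>2)" for x
  define B' where "B' = exp B + (B + real (card \<C>) * B\<^sup>2)"
  have B: "0 \<le> B" using L(2,3) order_trans by blast
  have B'0: "exp B \<le> B'" "B + real (card \<C>) * B\<^sup>2 \<le> B'" using B by (simp_all add: B'_def)
  have L2: "(L C x)\<^sup>2 \<le> B\<^sup>2" for C x using L by (intro power_mono) auto
  have Fb: "- B \<le> F x" "F x \<le> B" if "x \<in> space ?P" for x using F(2)[OF that] by auto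
  have Hb: "\<bar>H x\<bar> \<le> B'" if "x \<in> space ?P" for x
  proof -
    have "(\<Sum>C\<in>\<C>. (L C x)\<^sup>2) \<le> real (card \<C>) * B\<^sup>2" using sum_bounded_above[of \<C> "\<lambda>C. (L C x)\<^sup>2" "B\<^sup>2"] L2 by simp
    moreover have "0 \<le> (\<Sum>C\<in>\<C>. (L C x)\<^sup>2)" by (intro sum_nonneg) simp
    ultimately show ?thesis using F(2)[OF that] B'0 by (simp add: H_def)
  qed
  have eFb: "\<bar>exp (F x)\<bar> \<le> B'" if "x \<in> space ?P" for x
    using Fb(2)[OF that] B'0(1) by (simp add: order_trans[OF _ B'0(1)])
  have meas: "(\<lambda>x. exp (F x)) \<in> borel_measurable ?P" "H \<in> borel_measurable ?P"
    unfolding H_def using F(1) L(1) by measurable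
  have fin: "finite (\<Union>\<C>)" using \<C> by auto
  let ?S = "\<Sum>i\<in>\<Union>\<C>. (s i)\<^sup>2"
  have main: "(\<integral>x. exp (F x) \<partial>?P) \<le> exp ((\<integral>x. H x \<partial>?P) + e + ?S) + e" if e: "0 < e" for e
  proof -
    obtain p where p: "\<And>i. i \<in> \<Union>\<C> \<Longrightarrow> finite (set_pmf (p i))" "\<And>i. i \<in> \<Union>\<C> \<Longrightarrow> set_pmf (p i) \<subseteq> space \<nu>"
      "\<bar>measure_pmf.expectation (Pi_pmf (\<Union>\<C>) undefined p) (\<lambda>x. exp (F x)) - (\<integral>x. exp (F x) \<partial>?P)\<bar> < e"
      "\<bar>measure_pmf.expectation (Pi_pmf (\<Union>\<C>) undefined p) H - (\<integral>x. H x \<partial>?P)\<bar> < e"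
      using Pi_pmf_approximation[OF \<nu> fin meas(1) eFb meas(2) Hb e] by blast
    let ?E = "measure_pmf.expectation (Pi_pmf (\<Union>\<C>) undefined p)"
    have finE: "finite (set_pmf (Pi_pmf (\<Union>\<C>) undefined p))" by (rule finite_set_Pi_pmf[OF fin p(1)])
    note i = integrable_measure_pmf_finite[OF finE]
    have sub: "x \<in> space ?P" if "x \<in> PiE_dflt (\<Union>\<C>) undefined (set_pmf \<circ> p)" for x
      using that p(2) by (fastforce simp: PiE_dflt_def space_PiM PiE_def extensional_def)
    have "?E (\<lambda>x. exp (F x)) \<le> exp (?E F + ?S + (\<Sum>C\<in>\<C>. ?E (\<lambda>x. (L C x)\<^sup>2)))"
      by (rule Pi_pmf_expectation_exp_blocks[OF \<C> s p(1) L(2)]) (auto intro!: cost sub)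
    also have "\<dots> = exp (?E H + ?S)" unfolding H_def by (simp add: i)
    also have "\<dots> \<le> exp ((\<integral>x. H x \<partial>?P) + e + ?S)" using p(4) by simp
    finally show ?thesis using p(3) by simp
  qed
  have "((\<lambda>e. exp ((\<integral>x. H x \<partial>?P) + e + ?S) + e) \<longlongrightarrow> exp ((\<integral>x. H x \<partial>?P) + 0 + ?S) + 0) (at_right 0)"
    by (intro tendsto_intros)
  then have "(\<integral>x. exp (F x) \<partial>?P) \<le> exp ((\<integral>x. H x \<partial>?P) + 0 + ?S) + 0"
    by (rule tendsto_lowerbound) (auto intro!: eventually_at_rightI[of 0 1] main)
  also have "(\<integral>x. H x \<partial>?P) = (\<integral>x. F x \<partial>?P) + (\<Sum>C\<in>\<C>. \<integral>x. (L C x)\<^sup>2 \<partial>?P)"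
  proof -
    have "integrable ?P F" by (rule P.integrable_const_bound[of _ B]) (use F in auto)
    moreover have "integrable ?P (\<lambda>x. (L C x)\<^sup>2)" for C
      by (rule P.integrable_const_bound[of _ "B\<^sup>2"]) (use L(1) L2 in auto)
    ultimately show ?thesis unfolding H_def by simp
  qed
  finally show ?thesis by (simp add: algebra_simps)
qed

section \<open>Tilings of the lattice by cubes\<close>

lemma linf_le_iff: "linf v \<le> r \<longleftrightarrow> (\<forall>c. \<bar>v $ c\<bar> \<le> int r)"
  unfolding linf_def by (auto simp: nat_le_iff)

lemma linf_ge_component: "nat \<bar>v $ c\<bar> \<le> linf v"
  unfolding linf_def by simp

lemma linf_attained: "\<exists>c. linf v = nat \<bar>v $ c\<bar>"
proof -
  have "linf v \<in> range (\<lambda>i. nat \<bar>v $ i\<bar>)" unfolding linf_def by (rule Max_in) auto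
  then show ?thesis by auto
qed

lemma linf_minus_commute: "linf (k - l) = linf (l - k)"
  unfolding linf_def by (simp add: abs_minus_commute)

lemma linf_zero: "linf 0 = 0"
  using linf_le_iff[of 0 0] by simp

lemma linf_triangle: "linf (x - z) \<le> linf (x - y) + linf (y - z)"
  unfolding linf_le_iff
proof
  fix c
  have "\<bar>(x - y) $ c\<bar> \<le> int (linf (x - y))" "\<bar>(y - z) $ c\<bar> \<le> int (linf (y - z))"
    using linf_le_iff by blast+
  then show "\<bar>(x - z) $ c\<bar> \<le> int (linf (x - y) + linf (y - z))" by simp
qed

lemma box_card:
  "finite {v :: int ^ 'd::finite. \<forall>c. v $ c \<in> {lo..hi}}"
  "card {v :: int ^ 'd::finite. \<forall>c. v $ c \<in> {lo..hi}} = nat (hi - lo + 1) ^ CARD('d)"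
proof -
  have eq: "{v :: int ^ 'd. \<forall>c. v $ c \<in> {lo..hi}} = vec_lambda ` (UNIV \<rightarrow>\<^sub>E {lo..hi})"
  proof (intro equalityI subsetI)
    fix v :: "int ^ 'd" assume "v \<in> {v. \<forall>c. v $ c \<in> {lo..hi}}"
    then have "v = vec_lambda (vec_nth v)" "vec_nth v \<in> UNIV \<rightarrow>\<^sub>E {lo..hi}" by auto
    then show "v \<in> vec_lambda ` (UNIV \<rightarrow>\<^sub>E {lo..hi})" by blast
  qed (auto simp: PiE_iff)
  have inj: "inj_on (vec_lambda :: ('d \<Rightarrow> int) \<Rightarrow> _) S" for S
    by (rule inj_onI) (simp add: vec_lambda_inject)
  show "finite {v :: int ^ 'd. \<forall>c. v $ c \<in> {lo..hi}}"
    unfolding eq by (intro finite_imageI finite_PiE) auto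
  show "card {v :: int ^ 'd. \<forall>c. v $ c \<in> {lo..hi}} = nat (hi - lo + 1) ^ CARD('d)"
    unfolding eq by (subst card_image[OF inj]) (simp add: card_PiE)
qed

lemma ball_inf_box: "ball_inf 0 r = {v. \<forall>c. v $ c \<in> {- int r..int r}}"
proof -
  have "\<bar>x\<bar> \<le> y \<longleftrightarrow> x \<in> {- y..y}" for x y :: int by auto
  then show ?thesis by (simp only: ball_inf_def linf_le_iff diff_0_right)
qed

lemma finite_ball_inf: "finite (ball_inf j r)"
proof -
  have "ball_inf j r = (\<lambda>v. v + j) ` ball_inf 0 r"
    by (auto simp: ball_inf_def image_iff intro!: exI[of _ "_ - j"])
  then show ?thesis unfolding ball_inf_box using finite_imageI[OF box_card(1)] by (simp only:)
qed

definition block :: "int ^ 'd::finite \<Rightarrow> (int ^ 'd) set" where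
  "block b = {i. \<forall>c. b $ c \<le> i $ c \<and> i $ c \<le> b $ c + 3}"

text \<open>For \<open>q \<ge> 1\<close>, the ball of radius \<open>q\<close> around \<open>j\<close> meets \<^term>\<open>block b\<close> iff \<open>block_dist (b - j) \<le> q\<close>.\<close>

definition block_dist :: "int ^ 'd::finite \<Rightarrow> nat" where
  "block_dist z = Max (insert 1 (range (\<lambda>c. nat (max (z $ c) (- z $ c - 3)))))"

lemma block_dist_le_iff:
  "block_dist z \<le> q \<longleftrightarrow> 1 \<le> q \<and> (\<forall>c. z $ c \<in> {- int q - 3..int q})"
proof -
  have "z $ c \<in> {- int q - 3..int q} \<longleftrightarrow> z $ c \<le> int q \<and> - z $ c - 3 \<le> int q" for c by auto
  then show ?thesis unfolding block_dist_def by (simp add: nat_le_iff)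
qed

lemma block_dist_pos: "1 \<le> block_dist z"
  using block_dist_le_iff[of z "block_dist z"] by simp

lemma block_dist_le:
  assumes "i \<in> block b" "linf (i - j) \<le> q" "1 \<le> q"
  shows "block_dist (b - j) \<le> q"
proof -
  have "(b - j) $ c \<in> {- int q - 3..int q}" for c
  proof -
    have "b $ c \<le> i $ c" "i $ c \<le> b $ c + 3" "\<bar>(i - j) $ c\<bar> \<le> int q"
      using assms by (auto simp: block_def linf_le_iff)
    then show ?thesis by auto
  qed
  then show ?thesis using assms(3) by (simp add: block_dist_le_iff)
qed

lemma finite_block: "finite (block b)"
proof (rule finite_subset)
  show "block b \<subseteq> (\<lambda>v. v + b) ` {v. \<forall>c. v $ c \<in> {0..3}}"
  proof
    fix i assume "i \<in> block b"
    then have "i - b \<in> {v. \<forall>c. v $ c \<in> {0..3}}"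
      by (simp add: block_def diff_le_eq add.commute)
    then show "i \<in> (\<lambda>v. v + b) ` {v. \<forall>c. v $ c \<in> {0..3}}" by (rule rev_image_eqI) simp
  qed
qed (intro finite_imageI box_card(1))

definition tile_base :: "int ^ 'd::finite \<Rightarrow> int ^ 'd \<Rightarrow> int ^ 'd" where
  "tile_base o' i = (\<chi> c. i $ c - (i $ c - o' $ c) mod 4)"

lemma in_block_tile_base: "i \<in> block (tile_base o' i)"
proof -
  have "tile_base o' i $ c \<le> i $ c \<and> i $ c \<le> tile_base o' i $ c + 3" for c
  proof -
    define m where "m = (i $ c - o' $ c) mod 4"
    have m: "0 \<le> m" "m < 4" by (simp_all add: m_def)
    have "tile_base o' i $ c = i $ c - m" by (simp only: tile_base_def vec_lambda_beta m_def)
    then show ?thesis using m by simp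
  qed
  then show ?thesis by (simp add: block_def)
qed

lemma tile_base_mod: "(tile_base o' i $ c - o' $ c) mod 4 = 0"
proof -
  have "(i $ c - (i $ c - o' $ c) mod 4 - o' $ c) mod 4 = ((i $ c - o' $ c) - (i $ c - o' $ c) mod 4) mod 4"
    by (simp add: algebra_simps)
  also have "\<dots> = 0" by (simp add: minus_mod_eq_mult_div)
  finally show ?thesis by (simp add: tile_base_def)
qed

lemma block_disjoint:
  assumes "\<And>c. (b $ c - o' $ c) mod 4 = 0" "\<And>c. (b' $ c - o' $ c) mod 4 = 0" "b \<noteq> b'"
  shows "block b \<inter> block b' = {}"
proof (rule ccontr)
  assume "block b \<inter> block b' \<noteq> {}"
  then obtain i where i: "i \<in> block b" "i \<in> block b'" by blast
  have "b $ c = b' $ c" for c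
  proof -
    have "b $ c \<le> i $ c" "i $ c \<le> b $ c + 3" "b' $ c \<le> i $ c" "i $ c \<le> b' $ c + 3"
      using i by (auto simp: block_def)
    then have "- 3 \<le> b $ c - b' $ c" "b $ c - b' $ c \<le> 3" by linarith+
    moreover have "4 dvd b $ c - o' $ c" "4 dvd b' $ c - o' $ c"
      using assms(1,2)[of c] by (simp_all only: dvd_eq_mod_eq_0)
    then have "4 dvd (b $ c - o' $ c) - (b' $ c - o' $ c)" by (rule dvd_diff)
    then have "4 dvd b $ c - b' $ c" by (simp add: algebra_simps)
    then obtain m where m: "b $ c - b' $ c = 4 * m" by (rule dvdE)
    ultimately have "- 3 \<le> 4 * m" "4 * m \<le> 3" by simp_all
    then have "m = 0" by presburger
    then show ?thesis using m by simp
  qed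
  then show False using assms(3) by (simp add: vec_eq_iff)
qed

definition offsets :: "(int ^ 'd::finite) set" where
  "offsets = {v. \<forall>c. v $ c \<in> {0..3}}"

lemma offsets: "finite (offsets :: (int ^ 'd::finite) set)" "card (offsets :: (int ^ 'd) set) = 4 ^ CARD('d)"
  unfolding offsets_def box_card(2) by (rule box_card(1)) simp

text \<open>A lower corner belongs to at most one of the \<open>4 ^ d\<close> translated tilings, so
  summing over the translates never counts a corner twice.\<close>

lemma offset_unique:
  assumes "o1 \<in> offsets" "o2 \<in> offsets" "\<And>c. (b $ c - o1 $ c) mod 4 = 0" "\<And>c. (b $ c - o2 $ c) mod 4 = 0"
  shows "o1 = o2"
proof -
  have "o1 $ c = o2 $ c" for c
  proof -
    have "0 \<le> o1 $ c" "o1 $ c \<le> 3" "0 \<le> o2 $ c" "o2 $ c \<le> 3" using assms(1,2) by (auto simp: offsets_def)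
    then have "- 3 \<le> o2 $ c - o1 $ c" "o2 $ c - o1 $ c \<le> 3" by linarith+
    moreover have "4 dvd b $ c - o1 $ c" "4 dvd b $ c - o2 $ c"
      using assms(3,4)[of c] by (simp_all only: dvd_eq_mod_eq_0)
    then have "4 dvd (b $ c - o1 $ c) - (b $ c - o2 $ c)" by (rule dvd_diff)
    then have "4 dvd o2 $ c - o1 $ c" by (simp add: algebra_simps)
    then obtain m where m: "o2 $ c - o1 $ c = 4 * m" by (rule dvdE)
    ultimately have "- 3 \<le> 4 * m" "4 * m \<le> 3" by simp_all
    then have "m = 0" by presburger
    then show ?thesis using m by simp
  qed
  then show ?thesis by (simp add: vec_eq_iff)
qed

text \<open>Moving from \<open>k\<close> straight away from \<open>l\<close>, along a coordinate
  that realises their distance, makes the distances add up. With such an \<open>i\<close>, the first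
  threshold in the factorization property can take any value.\<close>

lemma far_site:
  fixes k l :: "int ^ 'd::finite"
  obtains i where "linf (k - i) = p" "linf (l - i) = p + linf (l - k)"
proof -
  obtain c where c: "linf (l - k) = nat \<bar>(l - k) $ c\<bar>" using linf_attained by blast
  define s :: int where "s = (if 0 \<le> (l - k) $ c then 1 else - 1)"
  define i where "i = (\<chi> e. if e = c then k $ c - s * int p else k $ e)"
  have 1: "linf (k - i) = p"
  proof (rule antisym)
    show "linf (k - i) \<le> p" unfolding linf_le_iff by (auto simp: i_def s_def)
    show "p \<le> linf (k - i)" using linf_ge_component[of "k - i" c] by (auto simp: i_def s_def split: if_splits)
  qed
  have "linf (l - i) = p + linf (l - k)"
  proof (rule antisym)
    show "linf (l - i) \<le> p + linf (l - k)" using linf_triangle[of l i k] 1 by simp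
    show "p + linf (l - k) \<le> linf (l - i)"
      using linf_ge_component[of "l - i" c] c by (auto simp: i_def s_def split: if_splits)
  qed
  with 1 show thesis by (rule that)
qed

lemma disjoint_balls:
  assumes "p + q < linf (l - k)"
  shows "ball_inf k p \<inter> ball_inf l q = {}"
proof (rule ccontr)
  assume "ball_inf k p \<inter> ball_inf l q \<noteq> {}"
  then obtain i where "linf (i - k) \<le> p" "linf (i - l) \<le> q" by (auto simp: ball_inf_def)
  then have "linf (l - k) \<le> q + p"
    using linf_triangle[of l k i] linf_minus_commute[of l i] by simp
  then show False using assms by simp
qed

section \<open>Joint tails of the coding radii\<close>

definition determined_on :: "'i set \<Rightarrow> ('i \<Rightarrow> 'a) set \<Rightarrow> ('i \<Rightarrow> 'a) set \<Rightarrow> bool" where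
  "determined_on J \<Omega> E \<longleftrightarrow> (\<forall>x\<in>\<Omega>. \<forall>y\<in>\<Omega>. (\<forall>i\<in>J. x i = y i) \<longrightarrow> x \<in> E \<longrightarrow> y \<in> E)"

lemma indep_vars_PiM_coordinates:
  assumes \<nu>: "prob_space \<nu>"
  shows "prob_space.indep_vars (PiM UNIV (\<lambda>_::'i. \<nu>)) (\<lambda>_. \<nu>) (\<lambda>i x. x i) UNIV"
proof -
  interpret \<nu>: prob_space \<nu> by fact
  interpret product_prob_space "\<lambda>_::'i. \<nu>" UNIV by unfold_locales
  have "distr (PiM UNIV (\<lambda>_. \<nu>)) (PiM UNIV (\<lambda>_. \<nu>)) (\<lambda>x. \<lambda>i\<in>UNIV. x i) = PiM UNIV (\<lambda>i::'i. \<nu>)"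
    by (simp add: restrict_def distr_id)
  also have "\<dots> = PiM UNIV (\<lambda>i. distr (PiM UNIV (\<lambda>_. \<nu>)) \<nu> (\<lambda>x. x i))"
    using PiM_component by (intro PiM_cong) auto
  finally show ?thesis
    by (subst P.indep_vars_iff_distr_eq_PiM) auto
qed

lemma emeasure_PiM_Int_determined:
  fixes \<nu> :: "'a measure" and J K :: "'i set"
  assumes \<nu>: "prob_space \<nu>" and JK: "J \<inter> K = {}"
    and E: "E \<in> sets (PiM UNIV (\<lambda>_. \<nu>))" "determined_on J (space (PiM UNIV (\<lambda>_. \<nu>))) E"
    and F: "F \<in> sets (PiM UNIV (\<lambda>_. \<nu>))" "determined_on K (space (PiM UNIV (\<lambda>_. \<nu>))) F"
  shows "emeasure (PiM UNIV (\<lambda>_. \<nu>)) (E \<inter> F) = emeasure (PiM UNIV (\<lambda>_. \<nu>)) E * emeasure (PiM UNIV (\<lambda>_. \<nu>)) F"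
proof -
  let ?\<mu> = "PiM UNIV (\<lambda>_::'i. \<nu>)"
  interpret \<nu>: prob_space \<nu> by fact
  interpret \<mu>: prob_space ?\<mu> by (rule prob_space_PiM) (rule \<nu>)
  obtain x0 where x0: "x0 \<in> space ?\<mu>" using \<mu>.not_empty by blast
  \<comment> \<open>Filling up with a fixed configuration turns an event determined on
    \<open>L\<close> into a preimage under restriction to \<open>L\<close>, the form in which
    independence of disjoint families of coordinates applies.\<close>
  define ext where "ext L u = (\<lambda>i. if i \<in> L then u i else x0 i)" for L :: "'i set" and u
  have ext_meas: "ext L \<in> measurable (PiM L (\<lambda>_. \<nu>)) ?\<mu>" for L
  proof (rule measurable_PiM_single')
    fix i :: 'i
    have "x0 i \<in> space \<nu>" using x0 by (auto simp: space_PiM)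
    then show "(\<lambda>u. ext L u i) \<in> measurable (PiM L (\<lambda>_. \<nu>)) \<nu>"
      by (cases "i \<in> L") (simp_all add: ext_def)
  next
    show "ext L \<in> space (PiM L (\<lambda>_. \<nu>)) \<rightarrow> (\<Pi>\<^sub>E i\<in>UNIV. space \<nu>)"
    proof
      fix u assume "u \<in> space (PiM L (\<lambda>_. \<nu>))"
      then have "ext L u i \<in> space \<nu>" for i
        using x0 by (auto simp: ext_def space_PiM PiE_iff)
      then show "ext L u \<in> (\<Pi>\<^sub>E i\<in>UNIV. space \<nu>)" by auto
    qed
  qed
  define S where "S L E = ext L -` E \<inter> space (PiM L (\<lambda>_. \<nu>))" for L E
  have S_sets: "S L E \<in> sets (PiM L (\<lambda>_. \<nu>))" if "E \<in> sets ?\<mu>" for L E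
    unfolding S_def using measurable_sets[OF ext_meas that] .
  have S_iff: "(\<lambda>x. restrict (\<lambda>i. x i) L) -` S L E \<inter> space ?\<mu> = E"
    if E: "E \<in> sets ?\<mu>" and det: "determined_on L (space ?\<mu>) E" for L E
  proof -
    have "restrict x L \<in> S L E \<longleftrightarrow> x \<in> E" if x: "x \<in> space ?\<mu>" for x
    proof -
      have r: "restrict x L \<in> space (PiM L (\<lambda>_. \<nu>))" using x by (auto simp: space_PiM)
      then have e: "ext L (restrict x L) \<in> space ?\<mu>" using measurable_space[OF ext_meas] by blast
      have "ext L (restrict x L) \<in> E \<longleftrightarrow> x \<in> E"
      proof -
        have "ext L (restrict x L) i = x i" if "i \<in> L" for i using that by (simp add: ext_def)
        then have "\<forall>i\<in>L. ext L (restrict x L) i = x i" "\<forall>i\<in>L. x i = ext L (restrict x L) i" by auto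
        then show ?thesis using det x e unfolding determined_on_def by blast
      qed
      then show ?thesis using r by (simp add: S_def)
    qed
    then show ?thesis using sets.sets_into_space[OF E] by auto
  qed
  have "\<mu>.indep_var (PiM J (\<lambda>_. \<nu>)) (\<lambda>x. restrict (\<lambda>i. x i) J) (PiM K (\<lambda>_. \<nu>)) (\<lambda>x. restrict (\<lambda>i. x i) K)"
    by (rule \<mu>.indep_var_restrict[OF indep_vars_PiM_coordinates[OF \<nu>] JK]) auto
  from \<mu>.indep_varD[OF this S_sets[OF E(1)] S_sets[OF F(1)]]
  have "\<mu>.prob ((\<lambda>x. (restrict (\<lambda>i. x i) J, restrict (\<lambda>i. x i) K)) -` (S J E \<times> S K F) \<inter> space ?\<mu>) = \<mu>.prob E * \<mu>.prob F"
    unfolding S_iff[OF E] S_iff[OF F] .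
  also have "(\<lambda>x. (restrict (\<lambda>i. x i) J, restrict (\<lambda>i. x i) K)) -` (S J E \<times> S K F) \<inter> space ?\<mu> = E \<inter> F"
    using S_iff[OF E] S_iff[OF F] by blast
  finally show ?thesis by (simp add: \<mu>.emeasure_eq_measure ennreal_mult)
qed

lemma enat_le_mono: "a \<le> b \<Longrightarrow> enat b \<le> r \<Longrightarrow> enat a \<le> r"
  by (rule order_trans[of _ "enat b"]) simp_all

text \<open>These are the properties of the radius on which the estimates rest, so a measurable
  function that equals it almost surely can take its place. \<open>rad_local\<close> is the stopping
  property. In \<open>rad_factorization\<close> the threshold \<open>p\<close> is free, whereas the
  other one is tied to the distance.\<close>

locale radius_field =
  fixes \<nu> :: "'a measure" and rad :: "int ^ 'd::finite \<Rightarrow> (int ^ 'd \<Rightarrow> 'a) \<Rightarrow> enat" and \<alpha> :: real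
  assumes prob_\<nu>: "prob_space \<nu>"
    and rad_measurable[measurable]: "\<And>k. rad k \<in> measurable (PiM UNIV (\<lambda>_. \<nu>)) (count_space UNIV)"
    and rad_local: "\<And>k q x y. x \<in> space (PiM UNIV (\<lambda>_. \<nu>)) \<Longrightarrow> y \<in> space (PiM UNIV (\<lambda>_. \<nu>)) \<Longrightarrow>
      (\<And>i. i \<in> ball_inf k q \<Longrightarrow> x i = y i) \<Longrightarrow> rad k x \<le> enat q \<Longrightarrow> rad k y \<le> enat q"
    and rad_shift: "\<And>k p. emeasure (PiM UNIV (\<lambda>_. \<nu>)) {x\<in>space (PiM UNIV (\<lambda>_. \<nu>)). enat p \<le> rad k x} =
      emeasure (PiM UNIV (\<lambda>_. \<nu>)) {x\<in>space (PiM UNIV (\<lambda>_. \<nu>)). enat p \<le> rad 0 x}"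
    and rad_finite: "\<And>k. AE x in PiM UNIV (\<lambda>_. \<nu>). rad k x < \<infinity>"
    and \<alpha>: "0 < \<alpha>" "\<alpha> \<le> 1"
    and rad_factorization: "\<And>k l p. emeasure (PiM UNIV (\<lambda>_. \<nu>))
        {x\<in>space (PiM UNIV (\<lambda>_. \<nu>)). enat p \<le> rad k x \<and> enat (linf (l - k)) \<le> rad l x} \<le>
      emeasure (PiM UNIV (\<lambda>_. \<nu>)) {x\<in>space (PiM UNIV (\<lambda>_. \<nu>)). enat p \<le> rad 0 x} *
      emeasure (PiM UNIV (\<lambda>_. \<nu>)) {x\<in>space (PiM UNIV (\<lambda>_. \<nu>)).
        ennreal (\<alpha> * real (linf (l - k))) \<le> ennreal_of_enat (rad 0 x)}"
begin

abbreviation "law \<equiv> PiM UNIV (\<lambda>_::int ^ 'd. \<nu>)"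

sublocale law: prob_space law
  by (rule prob_space_PiM) (rule prob_\<nu>)

definition "tail p = emeasure law {x\<in>space law. enat p \<le> rad 0 x}"
definition "scaled_tail n = emeasure law {x\<in>space law. ennreal (\<alpha> * real n) \<le> ennreal_of_enat (rad 0 x)}"
definition "coding_volume = (\<integral>\<^sup>+x. (2 * ennreal_of_enat (rad 0 x) + 1) ^ CARD('d) \<partial>law)"

lemma ge_sets[measurable]: "{x\<in>space law. enat p \<le> rad k x} \<in> sets law"
  by measurable

lemma scaled_ge_sets: "{x\<in>space law. ennreal c \<le> ennreal_of_enat (rad 0 x)} \<in> sets law"
  using measurable_sets[OF rad_measurable[of 0], of "{r. ennreal c \<le> ennreal_of_enat r}"]
  by (simp add: vimage_def Int_def conj_commute)

lemma emeasure_ge: "emeasure law {x\<in>space law. enat p \<le> rad k x} = tail p"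
  using rad_shift by (simp add: tail_def)

text \<open>The complementary event says that the radius is at most \<open>p - 1\<close>, which the
  ball of radius \<open>p - 1\<close> decides. The gain of one over \<open>p\<close> is what makes
  the halved events below fit into disjoint balls.\<close>

lemma determined_ge:
  assumes "1 \<le> p"
  shows "determined_on (ball_inf k (p - 1)) (space law) {x\<in>space law. enat p \<le> rad k x}"
  unfolding determined_on_def
proof (intro ballI impI)
  fix x y assume x: "x \<in> space law" "y \<in> space law" "\<forall>i\<in>ball_inf k (p - 1). x i = y i"
    and "x \<in> {x\<in>space law. enat p \<le> rad k x}"
  then have "enat p \<le> rad k x" by simp
  have "enat p \<le> rad k y"
  proof (rule ccontr)
    assume "\<not> enat p \<le> rad k y"
    then have "rad k y < enat p" by simp
    then obtain m where "rad k y = enat m" "m < p" by (cases "rad k y") auto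
    then have "rad k y \<le> enat (p - 1)" by simp
    then have "rad k x \<le> enat (p - 1)" using rad_local[OF x(2,1), of k "p - 1"] x(3) by simp
    then show False using \<open>enat p \<le> rad k x\<close> assms by (cases "rad k x") auto
  qed
  then show "y \<in> {x\<in>space law. enat p \<le> rad k x}" using x by simp
qed

lemma joint_tail_disjoint:
  assumes "1 \<le> p" "1 \<le> m" "p + m \<le> linf (l - k) + 1"
  shows "emeasure law {x\<in>space law. enat p \<le> rad k x \<and> enat m \<le> rad l x} = tail p * tail m"
proof -
  have "(p - 1) + (m - 1) < linf (l - k)" using assms by simp
  then have "ball_inf k (p - 1) \<inter> ball_inf l (m - 1) = {}" by (rule disjoint_balls)
  from emeasure_PiM_Int_determined[OF prob_\<nu> this ge_sets determined_ge[OF assms(1)] ge_sets determined_ge[OF assms(2)]]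
  have "emeasure law ({x\<in>space law. enat p \<le> rad k x} \<inter> {x\<in>space law. enat m \<le> rad l x}) = tail p * tail m"
    by (simp add: emeasure_ge)
  moreover have "{x\<in>space law. enat p \<le> rad k x} \<inter> {x\<in>space law. enat m \<le> rad l x} =
    {x\<in>space law. enat p \<le> rad k x \<and> enat m \<le> rad l x}" by blast
  ultimately show ?thesis by simp
qed

text \<open>Factorization speaks about the threshold \<open>linf (l - k)\<close>, so a larger
  \<open>m\<close> is first lowered to it.\<close>

lemma joint_tail_near:
  assumes "linf (l - k) \<le> m"
  shows "emeasure law {x\<in>space law. enat p \<le> rad k x \<and> enat m \<le> rad l x} \<le> tail p * scaled_tail (linf (l - k))"
proof -
  have "emeasure law {x\<in>space law. enat p \<le> rad k x \<and> enat m \<le> rad l x} \<le>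
    emeasure law {x\<in>space law. enat p \<le> rad k x \<and> enat (linf (l - k)) \<le> rad l x}"
    using assms by (intro emeasure_mono) (auto intro: order_trans[of _ "enat m"])
  then show ?thesis
    using rad_factorization[of p k l] by (simp add: tail_def scaled_tail_def)
qed

text \<open>If \<open>k\<close> and \<open>l\<close> are closer than one of the two radii, short-range factorization applies;
  otherwise both events are shrunk until they depend on disjoint balls.\<close>

lemma joint_tail_le:
  fixes k l :: "int ^ 'd"
  assumes p: "1 \<le> p" and m: "1 \<le> m"
  shows "emeasure law {x\<in>space law. enat p \<le> rad k x \<and> enat m \<le> rad l x} \<le>
    tail p * scaled_tail (linf (l - k)) + tail m * scaled_tail (linf (l - k)) +
    tail (p div 2 + 1) * tail (m div 2 + 1)"
proof (cases "linf (l - k) \<le> m")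
  case True
  from joint_tail_near[OF this, of p] show ?thesis by (simp add: add_increasing2)
next
  case False
  show ?thesis
  proof (cases "linf (l - k) \<le> p")
    case True
    have "{x\<in>space law. enat p \<le> rad k x \<and> enat m \<le> rad l x} = {x\<in>space law. enat m \<le> rad l x \<and> enat p \<le> rad k x}"
      by blast
    moreover have "emeasure law {x\<in>space law. enat m \<le> rad l x \<and> enat p \<le> rad k x} \<le> tail m * scaled_tail (linf (l - k))"
      using joint_tail_near[of k l p m] True by (simp add: linf_minus_commute)
    ultimately show ?thesis by (simp add: add_increasing add_increasing2)
  next
    case False
    \<comment> \<open>Both thresholds are smaller than the distance, so the halved events are
      decided in balls of radius \<open>p div 2\<close> and \<open>m div 2\<close>, and these radii
      add up to less than the distance.\<close>
    have le: "p div 2 + 1 \<le> p" "m div 2 + 1 \<le> m" using p m by auto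
    have "emeasure law {x\<in>space law. enat p \<le> rad k x \<and> enat m \<le> rad l x} \<le>
      emeasure law {x\<in>space law. enat (p div 2 + 1) \<le> rad k x \<and> enat (m div 2 + 1) \<le> rad l x}"
    proof (rule emeasure_mono)
      show "{x\<in>space law. enat p \<le> rad k x \<and> enat m \<le> rad l x} \<subseteq>
        {x\<in>space law. enat (p div 2 + 1) \<le> rad k x \<and> enat (m div 2 + 1) \<le> rad l x}"
        using enat_le_mono[OF le(1)] enat_le_mono[OF le(2)] by blast
    qed measurable
    also have "\<dots> = tail (p div 2 + 1) * tail (m div 2 + 1)"
      using False \<open>\<not> linf (l - k) \<le> m\<close> by (intro joint_tail_disjoint) auto
    finally show ?thesis by (simp add: add_increasing)
  qed
qed

section \<open>Expected numbers of cubes and sites within reach\<close>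

lemma nn_integral_count_emeasure_le:
  fixes Q :: "int ^ 'd \<Rightarrow> (int ^ 'd \<Rightarrow> 'a) \<Rightarrow> bool"
  assumes Q: "\<And>z. {x\<in>space law. Q z x} \<in> sets law" and c: "0 \<le> c"
    and card: "\<And>x r. x \<in> space law \<Longrightarrow> rad 0 x = enat r \<Longrightarrow>
      finite {z. Q z x} \<and> real (card {z. Q z x}) \<le> c * (2 * real r + 1) ^ CARD('d)"
  shows "(\<integral>\<^sup>+z. emeasure law {x\<in>space law. Q z x} \<partial>count_space UNIV) \<le> ennreal c * coding_volume"
proof -
  have "(\<integral>\<^sup>+z. emeasure law {x\<in>space law. Q z x} \<partial>count_space UNIV) =
    (\<integral>\<^sup>+z. \<integral>\<^sup>+x. indicator {x\<in>space law. Q z x} x \<partial>law \<partial>count_space UNIV)"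
    using Q by simp
  \<comment> \<open>By Tonelli's theorem a sum of probabilities over the lattice is an expected
    number of sites, which is then counted for each value of the radius.\<close>
  also have "\<dots> = (\<integral>\<^sup>+x. \<integral>\<^sup>+z. indicator {x\<in>space law. Q z x} x \<partial>count_space UNIV \<partial>law)"
    by (rule nn_integral_count_space_nn_integral[symmetric]) (use Q in auto)
  also have "\<dots> \<le> (\<integral>\<^sup>+x. ennreal c * (2 * ennreal_of_enat (rad 0 x) + 1) ^ CARD('d) \<partial>law)"
  proof (rule nn_integral_mono_AE)
    show "AE x in law. (\<integral>\<^sup>+z. indicator {x\<in>space law. Q z x} x \<partial>count_space UNIV) \<le>
        ennreal c * (2 * ennreal_of_enat (rad 0 x) + 1) ^ CARD('d)"
      using rad_finite[of 0] AE_space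
    proof eventually_elim
      case (elim x)
      then obtain r where r: "rad 0 x = enat r" by (cases "rad 0 x") auto
      have "(\<integral>\<^sup>+z. indicator {x\<in>space law. Q z x} x \<partial>count_space UNIV) =
        (\<integral>\<^sup>+z. indicator {z. Q z x} z \<partial>count_space UNIV)"
        using elim(2) by (intro nn_integral_cong) (auto simp: indicator_def)
      also have "\<dots> = ennreal (real (card {z. Q z x}))"
        using card[OF elim(2) r] by (simp add: emeasure_count_space_finite ennreal_of_nat_eq_real_of_nat)
      also have "\<dots> \<le> ennreal (c * (2 * real r + 1) ^ CARD('d))"
        using card[OF elim(2) r] by (intro ennreal_leI) simp
      also have "\<dots> = ennreal c * (2 * ennreal_of_enat (rad 0 x) + 1) ^ CARD('d)"
      proof -
        have v: "2 * ennreal_of_enat (rad 0 x) + 1 = ennreal (2 * real r + 1)"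
          by (simp add: r ennreal_plus ennreal_mult ennreal_of_nat_eq_real_of_nat)
        have "ennreal (2 * real r + 1) ^ CARD('d) = ennreal ((2 * real r + 1) ^ CARD('d))"
          by (rule ennreal_power) simp
        then show ?thesis unfolding v using ennreal_mult[OF c] by simp
      qed
      finally show ?case .
    qed
  qed
  also have "\<dots> = ennreal c * coding_volume"
    unfolding coding_volume_def
    by (intro nn_integral_cmult measurable_compose[OF rad_measurable[of 0]]) simp
  finally show ?thesis .
qed

text \<open>The factor 1/2 pays for the two factorization terms. Radius 0 contributes nothing
  because \<open>block_dist\<close> is at least 1; for larger \<open>r\<close> the box has side
  \<open>2 * r + 4\<close>, at most half of \<open>4 * (2 * r + 1)\<close>, and one of the resulting
  \<open>d\<close> factors 1/2 is kept.\<close>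

lemma tail_block_dist_sum:
  "(\<integral>\<^sup>+z. tail (block_dist (z :: int ^ 'd)) \<partial>count_space UNIV) \<le> ennreal (4 ^ CARD('d) / 2) * coding_volume"
  unfolding tail_def
proof (rule nn_integral_count_emeasure_le[where Q="\<lambda>z x. enat (block_dist z) \<le> rad 0 x", OF ge_sets])
  fix x :: "int ^ 'd \<Rightarrow> 'a" and r assume r: "rad 0 x = enat r"
  have eq: "{z. enat (block_dist z) \<le> rad 0 x} = (if r = 0 then {} else {z::int ^ 'd. \<forall>c. z $ c \<in> {- int r - 3..int r}})"
    by (auto simp: r block_dist_le_iff)
  show "finite {z :: int ^ 'd. enat (block_dist z) \<le> rad 0 x} \<and>
    real (card {z :: int ^ 'd. enat (block_dist z) \<le> rad 0 x}) \<le> 4 ^ CARD('d) / 2 * (2 * real r + 1) ^ CARD('d)"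
  proof (cases "r = 0")
    case True then show ?thesis unfolding eq by simp
  next
    case False
    have "2 * real (2 * r + 4) ^ CARD('d) \<le> 2 ^ CARD('d) * real (2 * r + 4) ^ CARD('d)"
      using power_increasing[of 1 "CARD('d)" "2::real"] by (intro mult_right_mono) (auto simp: Suc_le_eq)
    also have "\<dots> = (2 * real (2 * r + 4)) ^ CARD('d)" by (rule power_mult_distrib[symmetric])
    also have "\<dots> \<le> (4 * (2 * real r + 1)) ^ CARD('d)" using False by (intro power_mono) auto
    also have "\<dots> = 4 ^ CARD('d) * (2 * real r + 1) ^ CARD('d)" by (rule power_mult_distrib)
    finally have "real (2 * r + 4) ^ CARD('d) \<le> 4 ^ CARD('d) / 2 * (2 * real r + 1) ^ CARD('d)" by simp
    moreover have "nat (int r - (- int r - 3) + 1) = 2 * r + 4" by simp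
    ultimately show ?thesis unfolding eq using False box_card(1)[where 'd='d]
      by (simp only: if_False box_card(2) of_nat_power)
  qed
qed simp

text \<open>Halving the threshold extends the reach to \<open>2 * r - 1\<close>; together with the 3
  added by the cubes, the box has side exactly \<open>2 * (2 * r + 1)\<close>. This sum enters
  squared, and the resulting \<open>4 ^ d\<close> is what averaging over the tilings
  removes.\<close>

lemma tail_half_block_dist_sum:
  "(\<integral>\<^sup>+z. tail (block_dist (z :: int ^ 'd) div 2 + 1) \<partial>count_space UNIV) \<le> ennreal (2 ^ CARD('d)) * coding_volume"
  unfolding tail_def
proof (rule nn_integral_count_emeasure_le[where Q="\<lambda>z x. enat (block_dist z div 2 + 1) \<le> rad 0 x", OF ge_sets])
  fix x :: "int ^ 'd \<Rightarrow> 'a" and r assume r: "rad 0 x = enat r"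
  have "n div 2 + 1 \<le> r \<longleftrightarrow> n \<le> 2 * r - 1" if "r \<noteq> 0" for n using that by linarith
  then have eq: "{z. enat (block_dist z div 2 + 1) \<le> rad 0 x} =
      (if r = 0 then {} else {z::int ^ 'd. \<forall>c. z $ c \<in> {- int (2 * r - 1) - 3..int (2 * r - 1)}})"
    by (auto simp: r block_dist_le_iff simp del: of_nat_diff)
  show "finite {z :: int ^ 'd. enat (block_dist z div 2 + 1) \<le> rad 0 x} \<and>
    real (card {z :: int ^ 'd. enat (block_dist z div 2 + 1) \<le> rad 0 x}) \<le> 2 ^ CARD('d) * (2 * real r + 1) ^ CARD('d)"
  proof (cases "r = 0")
    case True then show ?thesis unfolding eq by simp
  next
    case False
    have "nat (int (2 * r - 1) - (- int (2 * r - 1) - 3) + 1) = 2 * (2 * r + 1)" using False by simp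
    moreover have "real (2 * (2 * r + 1)) ^ CARD('d) = 2 ^ CARD('d) * (2 * real r + 1) ^ CARD('d)"
      by (simp only: power_mult_distrib[symmetric]) (simp add: add.commute)
    ultimately show ?thesis unfolding eq using False box_card(1)[where 'd='d]
      by (simp only: if_False box_card(2) of_nat_power) simp
  qed
qed simp

lemma scaled_tail_sum:
  "(\<integral>\<^sup>+z. scaled_tail (linf (z :: int ^ 'd)) \<partial>count_space UNIV) \<le> ennreal ((1 / \<alpha>) ^ CARD('d)) * coding_volume"
  unfolding scaled_tail_def
proof (rule nn_integral_count_emeasure_le[where Q="\<lambda>z x. ennreal (\<alpha> * real (linf z)) \<le> ennreal_of_enat (rad 0 x)", OF scaled_ge_sets])
  fix x :: "int ^ 'd \<Rightarrow> 'a" and r assume r: "rad 0 x = enat r"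
  define m where "m = nat \<lfloor>real r / \<alpha>\<rfloor>"
  have m_le: "real m \<le> real r / \<alpha>" using \<alpha> by (simp add: m_def)
  have "ennreal (\<alpha> * real n) \<le> ennreal_of_enat (rad 0 x) \<longleftrightarrow> n \<le> m" for n
  proof -
    have "ennreal (\<alpha> * real n) \<le> ennreal_of_enat (rad 0 x) \<longleftrightarrow> \<alpha> * real n \<le> real r"
      by (simp add: r ennreal_of_nat_eq_real_of_nat)
    also have "\<dots> \<longleftrightarrow> real n \<le> real r / \<alpha>" using \<alpha> by (simp add: field_simps)
    also have "\<dots> \<longleftrightarrow> n \<le> m" using \<alpha> by (simp add: m_def le_nat_floor nat_le_iff le_floor_iff le_nat_iff)
    finally show ?thesis .
  qed
  then have eq: "{z. ennreal (\<alpha> * real (linf z)) \<le> ennreal_of_enat (rad 0 x)} = {z::int ^ 'd. \<forall>c. z $ c \<in> {- int m..int m}}"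
    using ball_inf_box[of m, where 'a='d] by (auto simp: ball_inf_def)
  \<comment> \<open>The summand 1 is divided by \<open>\<alpha>\<close> as well, which uses
    \<open>\<alpha> \<le> 1\<close>.\<close>
  have "2 * real m + 1 \<le> (2 * real r + 1) / \<alpha>"
  proof -
    have "2 * real m + 1 \<le> 2 * (real r / \<alpha>) + 1 / \<alpha>" using m_le \<alpha> by (intro add_mono) auto
    then show ?thesis by (simp add: add_divide_distrib)
  qed
  then have "(2 * real m + 1) ^ CARD('d) \<le> ((1 / \<alpha>) * (2 * real r + 1)) ^ CARD('d)"
    by (intro power_mono) auto
  moreover have "real (nat (int m - - int m + 1)) = 2 * real m + 1" by simp
  ultimately show "finite {z :: int ^ 'd. ennreal (\<alpha> * real (linf z)) \<le> ennreal_of_enat (rad 0 x)} \<and>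
    real (card {z :: int ^ 'd. ennreal (\<alpha> * real (linf z)) \<le> ennreal_of_enat (rad 0 x)}) \<le> (1 / \<alpha>) ^ CARD('d) * (2 * real r + 1) ^ CARD('d)"
    unfolding eq using box_card(1)[where 'd='d]
    by (simp only: box_card(2) of_nat_power power_mult_distrib)
qed (use \<alpha> in simp)

end

section \<open>Summation of the joint tails over cubes and pairs of sites\<close>

lemma sum_le_nn_integral_count_space:
  fixes g :: "'z \<Rightarrow> ennreal"
  assumes "finite S" "inj_on \<tau> S"
  shows "(\<Sum>b\<in>S. g (\<tau> b)) \<le> (\<integral>\<^sup>+z. g z \<partial>count_space UNIV)"
proof -
  have "(\<Sum>b\<in>S. g (\<tau> b)) = (\<Sum>z\<in>\<tau> ` S. g z)" using assms(2) by (simp add: sum.reindex)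
  also have "\<dots> = (\<integral>\<^sup>+z. g z \<partial>count_space (\<tau> ` S))"
    using assms(1) by (simp add: nn_integral_count_space_finite)
  also have "\<dots> = (\<integral>\<^sup>+z. g z * indicator (\<tau> ` S) z \<partial>count_space UNIV)"
    by (simp add: nn_integral_count_space_indicator)
  also have "\<dots> \<le> (\<integral>\<^sup>+z. g z \<partial>count_space UNIV)"
    by (intro nn_integral_mono) (simp add: indicator_def)
  finally show ?thesis .
qed

context radius_field begin

text \<open>Each term decouples in a suitable order of summation: in the first two, the cube
  relative to one site and then \<open>l\<close> relative to \<open>k\<close>; in the third,
  \<open>l\<close> relative to the cube and then the cube relative to \<open>k\<close>. The
  constants combine as \<open>2 * (4 ^ d / 2) * (1 / \<alpha>) ^ d + 2 ^ d * 2 ^ d\<close>.\<close>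

lemma joint_tail_sum_le:
  fixes J S :: "(int ^ 'd) set" and k :: "int ^ 'd"
  assumes J: "finite J" and S: "finite S"
  shows "(\<Sum>l\<in>J. \<Sum>b\<in>S. tail (block_dist (b - k)) * scaled_tail (linf (l - k))
      + tail (block_dist (b - l)) * scaled_tail (linf (l - k))
      + tail (block_dist (b - k) div 2 + 1) * tail (block_dist (b - l) div 2 + 1))
    \<le> ennreal (4 ^ CARD('d) * ((1 / \<alpha>) ^ CARD('d) + 1)) * coding_volume\<^sup>2"
proof -
  define Y where "Y = (\<integral>\<^sup>+z. tail (block_dist (z :: int ^ 'd)) \<partial>count_space UNIV)"
  define Z where "Z = (\<integral>\<^sup>+z. scaled_tail (linf (z :: int ^ 'd)) \<partial>count_space UNIV)"
  define X where "X = (\<integral>\<^sup>+z. tail (block_dist (z :: int ^ 'd) div 2 + 1) \<partial>count_space UNIV)"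
  have inj: "inj_on (\<lambda>b. b - k) V" "inj_on (\<lambda>l. b - l) V" for k b :: "int ^ 'd" and V
    by (auto simp: inj_on_def)
  have sY: "(\<Sum>b\<in>S. tail (block_dist (b - k))) \<le> Y" for k
    unfolding Y_def by (rule sum_le_nn_integral_count_space[OF S inj(1)])
  have sZ: "(\<Sum>l\<in>J. scaled_tail (linf (l - k))) \<le> Z"
    unfolding Z_def by (rule sum_le_nn_integral_count_space[OF J inj(1)])
  have sX: "(\<Sum>b\<in>S. tail (block_dist (b - k) div 2 + 1)) \<le> X"
    unfolding X_def by (rule sum_le_nn_integral_count_space[OF S inj(1)])
  have sX': "(\<Sum>l\<in>J. tail (block_dist (b - l) div 2 + 1)) \<le> X" for b
    unfolding X_def by (rule sum_le_nn_integral_count_space[OF J inj(2)])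
  have 1: "(\<Sum>l\<in>J. \<Sum>b\<in>S. tail (block_dist (b - k)) * scaled_tail (linf (l - k))) \<le> Y * Z"
  proof -
    have "(\<Sum>l\<in>J. \<Sum>b\<in>S. tail (block_dist (b - k)) * scaled_tail (linf (l - k))) =
      (\<Sum>b\<in>S. tail (block_dist (b - k))) * (\<Sum>l\<in>J. scaled_tail (linf (l - k)))"
      by (simp add: sum_distrib_left sum_distrib_right)
    also have "\<dots> \<le> Y * Z" by (intro mult_mono sY sZ) simp_all
    finally show ?thesis .
  qed
  have 2: "(\<Sum>l\<in>J. \<Sum>b\<in>S. tail (block_dist (b - l)) * scaled_tail (linf (l - k))) \<le> Y * Z"
  proof -
    have "(\<Sum>l\<in>J. \<Sum>b\<in>S. tail (block_dist (b - l)) * scaled_tail (linf (l - k))) =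
      (\<Sum>l\<in>J. (\<Sum>b\<in>S. tail (block_dist (b - l))) * scaled_tail (linf (l - k)))"
      by (simp add: sum_distrib_right)
    also have "\<dots> \<le> (\<Sum>l\<in>J. Y * scaled_tail (linf (l - k)))"
      by (intro sum_mono mult_right_mono sY) simp
    also have "\<dots> \<le> Y * Z" by (simp add: sum_distrib_left[symmetric] mult_left_mono sZ)
    finally show ?thesis .
  qed
  have 3: "(\<Sum>l\<in>J. \<Sum>b\<in>S. tail (block_dist (b - k) div 2 + 1) * tail (block_dist (b - l) div 2 + 1)) \<le> X * X"
  proof -
    have "(\<Sum>l\<in>J. \<Sum>b\<in>S. tail (block_dist (b - k) div 2 + 1) * tail (block_dist (b - l) div 2 + 1)) =
      (\<Sum>b\<in>S. tail (block_dist (b - k) div 2 + 1) * (\<Sum>l\<in>J. tail (block_dist (b - l) div 2 + 1)))"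
      by (subst sum.swap) (simp add: sum_distrib_left)
    also have "\<dots> \<le> (\<Sum>b\<in>S. tail (block_dist (b - k) div 2 + 1) * X)"
      by (intro sum_mono mult_left_mono sX') simp
    also have "\<dots> \<le> X * X"
      unfolding sum_distrib_right[symmetric] by (intro mult_right_mono sX) simp
    finally show ?thesis .
  qed
  have "(\<Sum>l\<in>J. \<Sum>b\<in>S. tail (block_dist (b - k)) * scaled_tail (linf (l - k))
      + tail (block_dist (b - l)) * scaled_tail (linf (l - k))
      + tail (block_dist (b - k) div 2 + 1) * tail (block_dist (b - l) div 2 + 1)) \<le> Y * Z + Y * Z + X * X"
    unfolding sum.distrib by (intro add_mono 1 2 3)
  also have "\<dots> \<le> (ennreal (4 ^ CARD('d) / 2) * coding_volume) * (ennreal ((1 / \<alpha>) ^ CARD('d)) * coding_volume)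
      + (ennreal (4 ^ CARD('d) / 2) * coding_volume) * (ennreal ((1 / \<alpha>) ^ CARD('d)) * coding_volume)
      + (ennreal (2 ^ CARD('d)) * coding_volume) * (ennreal (2 ^ CARD('d)) * coding_volume)"
    unfolding X_def Y_def Z_def
    by (intro add_mono mult_mono tail_block_dist_sum scaled_tail_sum tail_half_block_dist_sum) simp_all
  also have "\<dots> = (ennreal (4 ^ CARD('d) / 2) * ennreal ((1 / \<alpha>) ^ CARD('d))
      + ennreal (4 ^ CARD('d) / 2) * ennreal ((1 / \<alpha>) ^ CARD('d)) + ennreal (2 ^ CARD('d)) * ennreal (2 ^ CARD('d))) * coding_volume\<^sup>2"
    by (simp only: power2_eq_square distrib_left distrib_right mult_ac)
  also have "\<dots> = ennreal (4 ^ CARD('d) * ((1 / \<alpha>) ^ CARD('d) + 1)) * coding_volume\<^sup>2"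
  proof -
    have "(2::real) ^ CARD('d) * 2 ^ CARD('d) = 4 ^ CARD('d)" by (simp add: power_mult_distrib[symmetric])
    then show ?thesis using \<alpha>
      by (simp add: ennreal_mult[symmetric] ennreal_plus[symmetric] algebra_simps del: ennreal_plus)
  qed
  finally show ?thesis .
qed

text \<open>A Schur test: the bound for the joint tails is symmetric in \<open>k\<close> and
  \<open>l\<close>, so the arithmetic-geometric mean inequality reduces the double sum to row sums,
  which are bounded uniformly in \<open>k\<close>.\<close>

lemma weighted_joint_tail_sum_le:
  fixes J S :: "(int ^ 'd) set" and \<delta> :: "int ^ 'd \<Rightarrow> real"
  assumes J: "finite J" and S: "finite S" and \<delta>: "\<And>k. 0 \<le> \<delta> k"
  shows "(\<Sum>b\<in>S. \<Sum>k\<in>J. \<Sum>l\<in>J. ennreal (\<delta> k * \<delta> l) * emeasure law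
      {x\<in>space law. enat (block_dist (b - k)) \<le> rad k x \<and> enat (block_dist (b - l)) \<le> rad l x})
    \<le> ennreal (\<Sum>k\<in>J. (\<delta> k)\<^sup>2) * (ennreal (4 ^ CARD('d) * ((1 / \<alpha>) ^ CARD('d) + 1)) * coding_volume\<^sup>2)"
proof -
  define T where "T k l b = tail (block_dist (b - k)) * scaled_tail (linf (l - k))
      + tail (block_dist (b - l)) * scaled_tail (linf (l - k))
      + tail (block_dist (b - k) div 2 + 1) * tail (block_dist (b - l) div 2 + 1)" for k l b :: "int ^ 'd"
  have T_sym: "T k l b = T l k b" for k l b
    unfolding T_def by (simp only: linf_minus_commute[of k l] add.commute mult.commute)
  define w where "w k = ennreal ((\<delta> k)\<^sup>2 / 2)" for k
  have w2: "w k + w k = ennreal ((\<delta> k)\<^sup>2)" for k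
    by (simp add: w_def ennreal_plus[symmetric] del: ennreal_plus)
  have "(\<Sum>b\<in>S. \<Sum>k\<in>J. \<Sum>l\<in>J. ennreal (\<delta> k * \<delta> l) * emeasure law
      {x\<in>space law. enat (block_dist (b - k)) \<le> rad k x \<and> enat (block_dist (b - l)) \<le> rad l x})
    \<le> (\<Sum>b\<in>S. \<Sum>k\<in>J. \<Sum>l\<in>J. (w k + w l) * T k l b)"
  proof (intro sum_mono mult_mono)
    fix b k l :: "int ^ 'd"
    have "\<delta> k * \<delta> l \<le> (\<delta> k)\<^sup>2 / 2 + (\<delta> l)\<^sup>2 / 2" using sum_squares_bound[of "\<delta> k" "\<delta> l"] by simp
    then show "ennreal (\<delta> k * \<delta> l) \<le> w k + w l"
      unfolding w_def by (simp add: ennreal_plus[symmetric] ennreal_leI del: ennreal_plus)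
    show "emeasure law {x\<in>space law. enat (block_dist (b - k)) \<le> rad k x \<and> enat (block_dist (b - l)) \<le> rad l x} \<le> T k l b"
      unfolding T_def by (rule joint_tail_le[OF block_dist_pos block_dist_pos])
  qed simp_all
  also have "\<dots> = (\<Sum>b\<in>S. \<Sum>k\<in>J. \<Sum>l\<in>J. w k * T k l b) + (\<Sum>b\<in>S. \<Sum>k\<in>J. \<Sum>l\<in>J. w l * T k l b)"
    by (simp add: distrib_right sum.distrib)
  also have "(\<Sum>b\<in>S. \<Sum>k\<in>J. \<Sum>l\<in>J. w l * T k l b) = (\<Sum>b\<in>S. \<Sum>k\<in>J. \<Sum>l\<in>J. w k * T k l b)"
  proof (rule sum.cong[OF refl])
    fix b
    have "(\<Sum>k\<in>J. \<Sum>l\<in>J. w l * T k l b) = (\<Sum>l\<in>J. \<Sum>k\<in>J. w l * T k l b)" by (rule sum.swap)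
    also have "\<dots> = (\<Sum>l\<in>J. \<Sum>k\<in>J. w l * T l k b)" by (intro sum.cong refl arg_cong2[where f=times] T_sym)
    finally show "(\<Sum>k\<in>J. \<Sum>l\<in>J. w l * T k l b) = (\<Sum>k\<in>J. \<Sum>l\<in>J. w k * T k l b)" .
  qed
  also have "(\<Sum>b\<in>S. \<Sum>k\<in>J. \<Sum>l\<in>J. w k * T k l b) + (\<Sum>b\<in>S. \<Sum>k\<in>J. \<Sum>l\<in>J. w k * T k l b)
      = (\<Sum>b\<in>S. \<Sum>k\<in>J. \<Sum>l\<in>J. ennreal ((\<delta> k)\<^sup>2) * T k l b)"
    unfolding sum.distrib[symmetric] distrib_right[symmetric] w2 ..
  also have "\<dots> = (\<Sum>k\<in>J. ennreal ((\<delta> k)\<^sup>2) * (\<Sum>l\<in>J. \<Sum>b\<in>S. T k l b))"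
  proof -
    have "(\<Sum>b\<in>S. \<Sum>k\<in>J. \<Sum>l\<in>J. ennreal ((\<delta> k)\<^sup>2) * T k l b) = (\<Sum>k\<in>J. \<Sum>b\<in>S. \<Sum>l\<in>J. ennreal ((\<delta> k)\<^sup>2) * T k l b)"
      by (rule sum.swap)
    also have "\<dots> = (\<Sum>k\<in>J. \<Sum>l\<in>J. \<Sum>b\<in>S. ennreal ((\<delta> k)\<^sup>2) * T k l b)"
      by (intro sum.cong refl sum.swap)
    finally show ?thesis by (simp only: sum_distrib_left)
  qed
  also have "\<dots> \<le> (\<Sum>k\<in>J. ennreal ((\<delta> k)\<^sup>2) * (ennreal (4 ^ CARD('d) * ((1 / \<alpha>) ^ CARD('d) + 1)) * coding_volume\<^sup>2))"
    unfolding T_def by (intro sum_mono mult_left_mono joint_tail_sum_le J S) simp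
  also have "\<dots> = ennreal (\<Sum>k\<in>J. (\<delta> k)\<^sup>2) * (ennreal (4 ^ CARD('d) * ((1 / \<alpha>) ^ CARD('d) + 1)) * coding_volume\<^sup>2)"
    by (simp add: sum_distrib_right[symmetric] sum_ennreal)
  finally show ?thesis .
qed

end

section \<open>Concentration for local functions of the coded field\<close>

text \<open>Telescoping: the coordinates in \<open>J\<close> are replaced one at a time, and a
  coordinate that does not change costs nothing.\<close>

lemma local_lipschitz:
  fixes f :: "('i \<Rightarrow> 'b) \<Rightarrow> real"
  assumes J: "finite J"
    and loc: "\<And>y y'. y \<in> space (PiM UNIV (\<lambda>_. B)) \<Longrightarrow> y' \<in> space (PiM UNIV (\<lambda>_. B)) \<Longrightarrow> (\<And>j. j \<in> J \<Longrightarrow> y j = y' j) \<Longrightarrow> f y = f y'"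
    and osc: "\<And>y y' k. y \<in> space (PiM UNIV (\<lambda>_. B)) \<Longrightarrow> y' \<in> space (PiM UNIV (\<lambda>_. B)) \<Longrightarrow>
      (\<And>l. l \<noteq> k \<Longrightarrow> y l = y' l) \<Longrightarrow> \<bar>f y - f y'\<bar> \<le> \<delta> k"
    and y: "y \<in> space (PiM UNIV (\<lambda>_. B))" "y' \<in> space (PiM UNIV (\<lambda>_. B))"
  shows "\<bar>f y - f y'\<bar> \<le> (\<Sum>j\<in>J. \<delta> j * of_bool (y j \<noteq> y' j))"
proof -
  define m where "m K = (\<lambda>j. if j \<in> K then y' j else y j)" for K
  have m: "m K \<in> space (PiM UNIV (\<lambda>_. B))" for K
    using y by (auto simp: m_def space_PiM PiE_iff)
  have "\<bar>f y - f (m K)\<bar> \<le> (\<Sum>j\<in>K. \<delta> j * of_bool (y j \<noteq> y' j))" if "finite K" for K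
    using that
  proof (induction K rule: finite_induct)
    case empty
    then show ?case by (simp add: m_def)
  next
    case (insert k K)
    have "\<bar>f (m K) - f (m (insert k K))\<bar> \<le> \<delta> k * of_bool (y k \<noteq> y' k)"
    proof (cases "y k = y' k")
      case True
      then have "m K = m (insert k K)" by (auto simp: m_def)
      then show ?thesis using True by simp
    next
      case False
      then show ?thesis using osc[OF m m, of k K "insert k K"] by (simp add: m_def)
    qed
    then show ?case unfolding sum.insert[OF insert.hyps] using insert.IH by linarith
  qed
  from this[OF J] have "\<bar>f y - f (m J)\<bar> \<le> (\<Sum>j\<in>J. \<delta> j * of_bool (y j \<noteq> y' j))" .
  moreover have "f (m J) = f y'" by (rule loc[OF m y(2)]) (simp add: m_def)
  ultimately show ?thesis by simp
qed

locale coded_field = radius_field \<nu> rad \<alpha>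
  for \<nu> :: "'a measure" and rad :: "int ^ 'd::finite \<Rightarrow> (int ^ 'd \<Rightarrow> 'a) \<Rightarrow> enat" and \<alpha> +
  fixes B :: "'b measure" and \<phi> :: "(int ^ 'd \<Rightarrow> 'a) \<Rightarrow> int ^ 'd \<Rightarrow> 'b" and f :: "(int ^ 'd \<Rightarrow> 'b) \<Rightarrow> real"
    and J :: "(int ^ 'd) set" and \<delta> :: "int ^ 'd \<Rightarrow> real"
  assumes \<phi>_measurable[measurable]: "\<phi> \<in> measurable (PiM UNIV (\<lambda>_. \<nu>)) (PiM UNIV (\<lambda>_. B))"
    and \<phi>_local: "\<And>k q x y. x \<in> space (PiM UNIV (\<lambda>_. \<nu>)) \<Longrightarrow> y \<in> space (PiM UNIV (\<lambda>_. \<nu>)) \<Longrightarrow>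
      (\<And>i. i \<in> ball_inf k q \<Longrightarrow> x i = y i) \<Longrightarrow> rad k x \<le> enat q \<Longrightarrow> \<phi> x k = \<phi> y k"
    and f_measurable[measurable]: "f \<in> borel_measurable (PiM UNIV (\<lambda>_. B))"
    and finite_J: "finite J"
    and f_local: "\<And>y y'. y \<in> space (PiM UNIV (\<lambda>_. B)) \<Longrightarrow> y' \<in> space (PiM UNIV (\<lambda>_. B)) \<Longrightarrow>
      (\<And>j. j \<in> J \<Longrightarrow> y j = y' j) \<Longrightarrow> f y = f y'"
    and f_osc: "\<And>y y' k. y \<in> space (PiM UNIV (\<lambda>_. B)) \<Longrightarrow> y' \<in> space (PiM UNIV (\<lambda>_. B)) \<Longrightarrow>
      (\<And>l. l \<noteq> k \<Longrightarrow> y l = y' l) \<Longrightarrow> \<bar>f y - f y'\<bar> \<le> \<delta> k"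
    and \<delta>: "\<And>k. 0 \<le> \<delta> k"
begin

definition "origin = (SOME x. x \<in> space law)"

lemma origin: "origin \<in> space law"
proof -
  obtain x where "x \<in> space law" using law.not_empty by blast
  then show ?thesis unfolding origin_def by (rule someI[of "\<lambda>x. x \<in> space law"])
qed

text \<open>The truncation makes \<open>F N\<close> depend on finitely many coordinates.\<close>

definition "truncated N x = (\<lambda>j. if j \<in> J \<and> rad j x \<le> enat N then \<phi> x j else \<phi> origin j)"
definition "F N x = f (truncated N x)"

lemma \<phi>_space: "x \<in> space law \<Longrightarrow> \<phi> x \<in> space (PiM UNIV (\<lambda>_. B))"
  using measurable_space[OF \<phi>_measurable] .

lemma truncated_measurable[measurable]: "truncated N \<in> measurable law (PiM UNIV (\<lambda>_. B))"
proof (rule measurable_PiM_single')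
  fix j
  have c: "(\<lambda>x. \<phi> x j) \<in> measurable law B"
    using measurable_compose[OF \<phi>_measurable measurable_component_singleton[of j UNIV "\<lambda>_. B"]] by simp
  have "\<phi> origin j \<in> space B" using \<phi>_space[OF origin] by (auto simp: space_PiM PiE_iff)
  moreover have "{x\<in>space law. j \<in> J \<and> rad j x \<le> enat N} \<in> sets law" by measurable
  ultimately show "(\<lambda>x. truncated N x j) \<in> measurable law B"
    unfolding truncated_def using c by (intro measurable_If) auto
next
  show "truncated N \<in> space law \<rightarrow> (\<Pi>\<^sub>E i\<in>UNIV. space B)"
    using \<phi>_space \<phi>_space[OF origin] by (auto simp: truncated_def space_PiM PiE_iff)
qed

lemma truncated_space: "x \<in> space law \<Longrightarrow> truncated N x \<in> space (PiM UNIV (\<lambda>_. B))"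
  using measurable_space[OF truncated_measurable] .

lemma F_measurable[measurable]: "F N \<in> borel_measurable law"
  unfolding F_def by measurable

text \<open>Only the radius at \<open>x\<close> is consulted. If it is at most \<open>N\<close>,
  then \<open>y\<close> inherits the bound and the output. If it exceeds \<open>N\<close>, the
  configurations agree on the ball of radius \<open>N\<close>, where a small radius at
  \<open>y\<close> would force a small one at \<open>x\<close>; both sites then take the default
  value.\<close>

lemma truncated_cong:
  assumes x: "x \<in> space law" "y \<in> space law"
    and eq: "\<And>i. linf (i - j) \<le> N \<Longrightarrow> enat (linf (i - j)) \<le> rad j x \<Longrightarrow> x i = y i"
  shows "truncated N x j = truncated N y j"
proof (cases "rad j x \<le> enat N")
  case True
  then obtain q where q: "rad j x = enat q" "q \<le> N" by (cases "rad j x") auto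
  have agree: "x i = y i" if "i \<in> ball_inf j q" for i
    using that q by (intro eq) (auto simp: ball_inf_def)
  have le: "rad j x \<le> enat q" using q(1) by (rule eq_refl)
  have "rad j y \<le> enat q" by (rule rad_local[OF x agree le])
  also have "enat q \<le> enat N" using q(2) by simp
  finally have "rad j y \<le> enat N" .
  moreover have "\<phi> x j = \<phi> y j" by (rule \<phi>_local[OF x agree le])
  ultimately show ?thesis using True by (simp add: truncated_def)
next
  case False
  have agree: "y i = x i" if "i \<in> ball_inf j N" for i
  proof -
    have "enat (linf (i - j)) \<le> enat N" using that by (simp add: ball_inf_def)
    also have "\<dots> \<le> rad j x" using False by simp
    finally show ?thesis using that eq[of i] by (simp add: ball_inf_def)
  qed
  have "\<not> rad j y \<le> enat N"
    using rad_local[OF x(2,1) agree] False by blast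
  with False show ?thesis by (simp add: truncated_def)
qed

text \<open>The cost depends on \<open>y\<close> only through the set of changed sites, while all
  radii are read at \<open>x\<close>. This is the one-sided domination that the exponential
  inequality expects.\<close>

lemma F_cost:
  assumes x: "x \<in> space law" "y \<in> space law"
  shows "\<bar>F N y - F N x\<bar> \<le> (\<Sum>j\<in>J. \<delta> j * of_bool (\<exists>i. linf (i - j) \<le> N \<and> enat (linf (i - j)) \<le> rad j x \<and> x i \<noteq> y i))"
proof -
  have "\<bar>F N y - F N x\<bar> \<le> (\<Sum>j\<in>J. \<delta> j * of_bool (truncated N y j \<noteq> truncated N x j))"
    unfolding F_def by (rule local_lipschitz[OF finite_J f_local f_osc truncated_space truncated_space]) (use x in auto)
  also have "\<dots> \<le> (\<Sum>j\<in>J. \<delta> j * of_bool (\<exists>i. linf (i - j) \<le> N \<and> enat (linf (i - j)) \<le> rad j x \<and> x i \<noteq> y i))"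
  proof (intro sum_mono mult_left_mono \<delta>)
    fix j
    have "truncated N x j = truncated N y j"
      if "\<not> (\<exists>i. linf (i - j) \<le> N \<and> enat (linf (i - j)) \<le> rad j x \<and> x i \<noteq> y i)"
      by (rule truncated_cong[OF x]) (use that in blast)
    then have "truncated N y j \<noteq> truncated N x j \<longrightarrow> (\<exists>i. linf (i - j) \<le> N \<and> enat (linf (i - j)) \<le> rad j x \<and> x i \<noteq> y i)"
      by metis
    then show "of_bool (truncated N y j \<noteq> truncated N x j) \<le>
      (of_bool (\<exists>i. linf (i - j) \<le> N \<and> enat (linf (i - j)) \<le> rad j x \<and> x i \<noteq> y i) :: real)"
      by (cases "truncated N y j \<noteq> truncated N x j") (simp_all only: of_bool_eq simp_thms order_refl zero_less_one_class.zero_le_one split: if_split, simp_all)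
  qed
  finally show ?thesis .
qed

lemma f_bounded:
  assumes "y \<in> space (PiM UNIV (\<lambda>_. B))"
  shows "\<bar>f y\<bar> \<le> \<bar>f (\<phi> origin)\<bar> + (\<Sum>j\<in>J. \<delta> j)"
proof -
  have "\<bar>f y - f (\<phi> origin)\<bar> \<le> (\<Sum>j\<in>J. \<delta> j * of_bool (y j \<noteq> \<phi> origin j))"
    by (rule local_lipschitz[OF finite_J f_local f_osc assms \<phi>_space[OF origin]])
  also have "\<dots> \<le> (\<Sum>j\<in>J. \<delta> j)" by (intro sum_mono) (use \<delta> in \<open>simp add: mult_left_le\<close>)
  finally show ?thesis by simp
qed

section \<open>Tilings of the window and the energies of their cubes\<close>

definition "window N = (\<Union>j\<in>J. ball_inf j N)"

lemma finite_window: "finite (window N)"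
  unfolding window_def using finite_J finite_ball_inf by blast

definition "bases o' N = tile_base o' ` window N"

lemma finite_bases: "finite (bases o' N)"
  unfolding bases_def using finite_window by simp

lemma bases_block_disjoint:
  "b \<in> bases o' N \<Longrightarrow> b' \<in> bases o' N \<Longrightarrow> b \<noteq> b' \<Longrightarrow> block b \<inter> block b' = {}"
  unfolding bases_def using tile_base_mod by (intro block_disjoint[of b o' b']) auto

lemma window_subset: "window N \<subseteq> \<Union>(block ` bases o' N)"
  unfolding bases_def using in_block_tile_base by blast

lemma block_inj_on: "inj_on block (bases o' N)"
proof (rule inj_onI)
  fix b b' assume b: "b \<in> bases o' N" "b' \<in> bases o' N" "block b = block b'"
  have "b \<in> block b" by (simp add: block_def)
  then show "b = b'" using bases_block_disjoint[OF b(1,2)] b(3) by blast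
qed

text \<open>By \<open>energy_eq\<close> this is the second moment of the
  \<open>\<delta>\<close>-weighted number of sites in \<open>J\<close> with positive radius whose
  ball meets the cube, expanded so that the joint tails become visible.\<close>

definition "energy b = (\<Sum>k\<in>J. \<Sum>l\<in>J. \<delta> k * \<delta> l * law.prob
  {x\<in>space law. enat (block_dist (b - k)) \<le> rad k x \<and> enat (block_dist (b - l)) \<le> rad l x})"

lemma energy_eq:
  "(\<integral>x. (\<Sum>j\<in>J. \<delta> j * of_bool (enat (block_dist (b - j)) \<le> rad j x))\<^sup>2 \<partial>law) = energy b"
proof -
  let ?E = "\<lambda>k l. {x\<in>space law. enat (block_dist (b - k)) \<le> rad k x \<and> enat (block_dist (b - l)) \<le> rad l x}"
  have sets: "?E k l \<in> sets law" for k l by measurable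
  have int: "integrable law (\<lambda>x. \<delta> k * \<delta> l * indicator (?E k l) x)" for k l
    using sets by (intro integrable_mult_right integrable_real_indicator) (auto simp: law.emeasure_eq_measure)
  have "(\<integral>x. (\<Sum>j\<in>J. \<delta> j * of_bool (enat (block_dist (b - j)) \<le> rad j x))\<^sup>2 \<partial>law) =
    (\<integral>x. (\<Sum>k\<in>J. \<Sum>l\<in>J. \<delta> k * \<delta> l * indicator (?E k l) x) \<partial>law)"
  proof (rule Bochner_Integration.integral_cong[OF refl])
    fix x assume x: "x \<in> space law"
    have "\<delta> k * of_bool (enat (block_dist (b - k)) \<le> rad k x) * (\<delta> l * of_bool (enat (block_dist (b - l)) \<le> rad l x)) =
      \<delta> k * \<delta> l * indicator (?E k l) x" for k l
      using x by (simp add: indicator_def)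
    then show "(\<Sum>j\<in>J. \<delta> j * of_bool (enat (block_dist (b - j)) \<le> rad j x))\<^sup>2 =
      (\<Sum>k\<in>J. \<Sum>l\<in>J. \<delta> k * \<delta> l * indicator (?E k l) x)"
      by (simp only: power2_eq_square sum_product)
  qed
  also have "\<dots> = (\<Sum>k\<in>J. \<Sum>l\<in>J. \<integral>x. \<delta> k * \<delta> l * indicator (?E k l) x \<partial>law)"
    by (subst Bochner_Integration.integral_sum Bochner_Integration.integral_sum[OF int]; (intro refl sum.cong Bochner_Integration.integrable_sum Bochner_Integration.integral_sum int)?)
  also have "\<dots> = energy b"
    unfolding energy_def using sets by simp
  finally show ?thesis .
qed

text \<open>Thresholds up to \<open>N\<close> are decided in the ball of radius \<open>N\<close>, so
  they can be evaluated at a configuration that has been altered outside the window.\<close>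

lemma ge_cong:
  assumes x: "x \<in> space law" "y \<in> space law" and eq: "\<And>i. i \<in> ball_inf j N \<Longrightarrow> x i = y i" and p: "p \<le> N"
  shows "enat p \<le> rad j x \<longleftrightarrow> enat p \<le> rad j y"
proof (cases "p = 0")
  case True then show ?thesis by (simp add: zero_enat_def[symmetric])
next
  case False
  have sub: "i \<in> ball_inf j N" if "i \<in> ball_inf j (p - 1)" for i
    using p that by (simp add: ball_inf_def)
  have imp: "enat p \<le> rad j v" if "u \<in> space law" "v \<in> space law" "\<forall>i\<in>ball_inf j (p - 1). u i = v i" "enat p \<le> rad j u" for u v
  proof -
    have "1 \<le> p" using False by simp
    from determined_ge[OF this, of j, unfolded determined_on_def, rule_format, OF that(1,2), rule_format] that(1,3,4)
    have "v \<in> {x\<in>space law. enat p \<le> rad j x}" by simp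
    then show ?thesis by simp
  qed
  have "\<forall>i\<in>ball_inf j (p - 1). x i = y i" "\<forall>i\<in>ball_inf j (p - 1). y i = x i" using eq sub by simp_all
  then show ?thesis using imp[OF x] imp[OF x(2,1)] by blast
qed

text \<open>\<open>t * F N\<close> is transported to the finite product over the cubes that meet the
  window, where the block inequality applies. The offset \<open>o'\<close> stays free, to be chosen
  once the energies have been summed.\<close>

lemma truncated_exponential_bound:
  fixes o' :: "int ^ 'd"
  assumes t: "0 < t" and N: "1 \<le> N"
  shows "(\<integral>x. exp (t * F N x) \<partial>law) \<le>
    exp (t * (\<integral>x. F N x \<partial>law) + t\<^sup>2 * ((\<Sum>j\<in>J. (\<delta> j)\<^sup>2) + (\<Sum>b\<in>bases o' N. energy b)))"
proof -
  define \<C> where "\<C> = block ` bases o' N"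
  define \<Lambda> where "\<Lambda> = \<Union>\<C>"
  interpret \<nu>: prob_space \<nu> by (rule prob_\<nu>)
  interpret product_prob_space "\<lambda>_::int ^ 'd. \<nu>" UNIV by unfold_locales
  have \<C>1: "finite \<C>" unfolding \<C>_def by (rule finite_imageI[OF finite_bases])
  have \<C>2: "\<And>C. C \<in> \<C> \<Longrightarrow> finite C" unfolding \<C>_def by (elim imageE) (simp add: finite_block)
  have \<C>3: "disjoint \<C>"
    unfolding disjoint_def
  proof (intro ballI impI)
    fix C D assume "C \<in> \<C>" "D \<in> \<C>" "C \<noteq> D"
    then obtain b b' where "C = block b" "D = block b'" "b \<in> bases o' N" "b' \<in> bases o' N" "b \<noteq> b'"
      unfolding \<C>_def by (elim imageE) auto
    then show "C \<inter> D = {}" using bases_block_disjoint by simp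
  qed
  note \<C> = \<C>1 \<C>2 \<C>3
  have fin: "finite \<Lambda>" unfolding \<Lambda>_def using \<C> by auto
  have win: "window N \<subseteq> \<Lambda>" unfolding \<Lambda>_def \<C>_def by (rule window_subset)
  have ball: "ball_inf j N \<subseteq> \<Lambda>" if "j \<in> J" for j using that win by (auto simp: window_def)
  have J\<Lambda>: "J \<subseteq> \<Lambda>"
  proof
    fix j assume "j \<in> J"
    moreover have "j \<in> ball_inf j N" by (simp add: ball_inf_def linf_zero)
    ultimately show "j \<in> \<Lambda>" using ball by blast
  qed
  let ?P = "PiM \<Lambda> (\<lambda>_. \<nu>)"
  \<comment> \<open>Outside the cubes every configuration is replaced by \<open>origin\<close>. This
    changes neither \<open>F N\<close> nor, at the sites of \<open>J\<close>, the radius thresholds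
    up to \<open>N\<close>.\<close>
  define ext where "ext u = (\<lambda>i. if i \<in> \<Lambda> then u i else origin i)" for u
  have ext_space: "ext u \<in> space law" if "u \<in> space ?P" for u
    using that origin by (auto simp: ext_def space_PiM PiE_iff)
  have ext_meas: "ext \<in> measurable ?P law"
  proof (rule measurable_PiM_single')
    fix i
    have "origin i \<in> space \<nu>" using origin by (auto simp: space_PiM)
    then show "(\<lambda>u. ext u i) \<in> measurable ?P \<nu>" by (cases "i \<in> \<Lambda>") (simp_all add: ext_def)
  next
    show "ext \<in> space ?P \<rightarrow> (\<Pi>\<^sub>E i\<in>UNIV. space \<nu>)" using ext_space by (auto simp: space_PiM)
  qed
  have restr_meas: "(\<lambda>x. restrict x \<Lambda>) \<in> measurable law ?P" by (rule measurable_restrict_subset) simp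
  have restr_space: "restrict x \<Lambda> \<in> space ?P" if "x \<in> space law" for x
    using that by (auto simp: space_PiM)
  have transfer: "(\<integral>u. g (ext u) \<partial>?P) = (\<integral>x. g (ext (restrict x \<Lambda>)) \<partial>law)"
    if "g \<in> borel_measurable law" for g :: "_ \<Rightarrow> real"
  proof -
    have "(\<lambda>u. g (ext u)) \<in> borel_measurable ?P" by (rule measurable_compose[OF ext_meas that])
    then have "(\<integral>x. g (ext (restrict x \<Lambda>)) \<partial>law) = (\<integral>u. g (ext u) \<partial>distr law ?P (\<lambda>x. restrict x \<Lambda>))"
      by (intro integral_distr[symmetric] restr_meas)
    then show ?thesis using distr_PiM_restrict_finite[OF fin] by simp
  qed
  have F_ext: "F N (ext (restrict x \<Lambda>)) = F N x" if x: "x \<in> space law" for x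
  proof -
    have "x i = ext (restrict x \<Lambda>) i" if "j \<in> J" "linf (i - j) \<le> N" for i j
      using ball[OF that(1)] that(2) by (auto simp: ext_def ball_inf_def)
    then have "(\<Sum>j\<in>J. \<delta> j * of_bool (\<exists>i. linf (i - j) \<le> N \<and> enat (linf (i - j)) \<le> rad j x \<and> x i \<noteq> ext (restrict x \<Lambda>) i)) = 0"
      by (intro sum.neutral) auto
    then show ?thesis using F_cost[OF x ext_space[OF restr_space[OF x]], of N] by simp
  qed
  \<comment> \<open>Reach is cut off at \<open>N\<close> because \<open>F N\<close> ignores
    everything farther away. Radius 0 is excluded because it is charged to \<open>s\<close>.\<close>
  define touch where "touch C j x \<longleftrightarrow> 1 \<le> rad j x \<and> (\<exists>i\<in>C. linf (i - j) \<le> N \<and> enat (linf (i - j)) \<le> rad j x)" for C j x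
  have touch_meas: "{x\<in>space law. touch C j x} \<in> sets law" for C j
  proof -
    have "{x\<in>space law. touch C j x} = rad j -` {r. 1 \<le> r \<and> (\<exists>i\<in>C. linf (i - j) \<le> N \<and> enat (linf (i - j)) \<le> r)} \<inter> space law"
      by (auto simp: touch_def)
    then show ?thesis using measurable_sets[OF rad_measurable[of j]] by simp
  qed
  define L0 where "L0 C x = (\<Sum>j\<in>J. t * \<delta> j * of_bool (touch C j x))" for C x
  have L0_meas: "L0 C \<in> borel_measurable law" for C
  proof -
    have "(\<lambda>x. of_bool (touch C j x) :: real) \<in> borel_measurable law" for j
      using touch_meas[of C j] by (simp add: of_bool_def) measurable
    then show ?thesis unfolding L0_def by measurable
  qed
  have L0_nonneg: "0 \<le> L0 C x" for C x
    unfolding L0_def using t \<delta> by (intro sum_nonneg mult_nonneg_nonneg) auto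
  define D where "D = (\<Sum>j\<in>J. t * \<delta> j)"
  have L0_le: "L0 C x \<le> D" for C x
    unfolding L0_def D_def using t \<delta> by (intro sum_mono) (simp add: mult_left_le)
  define b where "b = t * (\<bar>f (\<phi> origin)\<bar> + (\<Sum>j\<in>J. \<delta> j)) + D"
  have D0: "0 \<le> D" unfolding D_def using t \<delta> by (intro sum_nonneg mult_nonneg_nonneg) auto
  have F_le: "\<bar>t * F N x\<bar> \<le> b" if "x \<in> space law" for x
  proof -
    have "\<bar>t * F N x\<bar> = t * \<bar>F N x\<bar>" using t by (simp add: abs_mult)
    also have "\<dots> \<le> t * (\<bar>f (\<phi> origin)\<bar> + (\<Sum>j\<in>J. \<delta> j))"
      unfolding F_def using t by (intro mult_left_mono f_bounded truncated_space that) auto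
    finally show ?thesis using D0 by (simp add: b_def)
  qed
  have D_le: "D \<le> b"
  proof -
    have "0 \<le> (\<Sum>j\<in>J. \<delta> j)" using \<delta> by (intro sum_nonneg)
    then have "0 \<le> t * (\<bar>f (\<phi> origin)\<bar> + (\<Sum>j\<in>J. \<delta> j))" using t by simp
    then show ?thesis by (simp add: b_def)
  qed
  define s where "s i = (if i \<in> J then t * \<delta> i else 0)" for i
  have cost: "t * F N (ext v) \<le> t * F N (ext u) + (\<Sum>C\<in>\<C>. L0 C (ext u) * of_bool (\<exists>i\<in>C. u i \<noteq> v i))
      + (\<Sum>i\<in>\<Union>\<C>. s i * of_bool (u i \<noteq> v i))"
    if u: "u \<in> space (PiM (\<Union>\<C>) (\<lambda>_. \<nu>))" and v: "v \<in> space (PiM (\<Union>\<C>) (\<lambda>_. \<nu>))" for u v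
  proof -
    let ?m = "\<lambda>j. \<exists>i. linf (i - j) \<le> N \<and> enat (linf (i - j)) \<le> rad j (ext u) \<and> ext u i \<noteq> ext v i"
    have m_le: "of_bool (?m j) \<le> (\<Sum>C\<in>\<C>. of_bool (touch C j (ext u)) * of_bool (\<exists>i\<in>C. u i \<noteq> v i)) + (of_bool (u j \<noteq> v j) :: real)" for j
    proof (cases "?m j")
      case False
      then have "(of_bool (?m j) :: real) = 0" by (simp only: of_bool_eq)
      moreover have "0 \<le> (\<Sum>C\<in>\<C>. of_bool (touch C j (ext u)) * of_bool (\<exists>i\<in>C. u i \<noteq> v i) :: real)"
        by (rule sum_nonneg) simp
      moreover have "0 \<le> (of_bool (u j \<noteq> v j) :: real)" by simp
      ultimately show ?thesis by linarith
    next
      case True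
      then obtain i where i: "linf (i - j) \<le> N" "enat (linf (i - j)) \<le> rad j (ext u)" "ext u i \<noteq> ext v i" by blast
      then have i\<Lambda>: "i \<in> \<Lambda>" "u i \<noteq> v i" by (auto simp: ext_def split: if_splits)
      then obtain C where C: "C \<in> \<C>" "i \<in> C" by (auto simp: \<Lambda>_def)
      \<comment> \<open>The changed site within reach lies in the cube \<open>C\<close>. If the
        radius is positive, \<open>C\<close> is touched; if it is 0, the changed site is
        \<open>j\<close> itself.\<close>
      show ?thesis
      proof (cases "1 \<le> rad j (ext u)")
        case r: True
        then have "touch C j (ext u)" "\<exists>i\<in>C. u i \<noteq> v i" using C i i\<Lambda> by (auto simp: touch_def)
        then have "1 = (of_bool (touch C j (ext u)) * of_bool (\<exists>i\<in>C. u i \<noteq> v i) :: real)" by simp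
        also have "\<dots> \<le> (\<Sum>C\<in>\<C>. of_bool (touch C j (ext u)) * of_bool (\<exists>i\<in>C. u i \<noteq> v i))"
          by (rule member_le_sum[OF C(1)]) (use \<C>(1) in simp_all)
        finally show ?thesis using True by simp
      next
        case False
        then have "rad j (ext u) = 0" by (cases "rad j (ext u)") (auto simp: one_enat_def zero_enat_def)
        then have "linf (i - j) = 0" using i(2) by (simp add: zero_enat_def)
        then have "i = j" using linf_le_iff[of "i - j" 0] by (simp add: vec_eq_iff)
        then have "(of_bool (u j \<noteq> v j) :: real) = 1" using i\<Lambda>(2) by simp
        moreover have "(of_bool (?m j) :: real) \<le> 1" by simp
        moreover have "0 \<le> (\<Sum>C\<in>\<C>. of_bool (touch C j (ext u)) * of_bool (\<exists>i\<in>C. u i \<noteq> v i) :: real)"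
          by (rule sum_nonneg) simp
        ultimately show ?thesis by linarith
      qed
    qed
    have "F N (ext v) \<le> F N (ext u) + (\<Sum>j\<in>J. \<delta> j * of_bool (?m j))"
      using F_cost[OF ext_space ext_space, of u v N] u v by (simp add: \<Lambda>_def)
    then have "t * F N (ext v) \<le> t * F N (ext u) + t * (\<Sum>j\<in>J. \<delta> j * of_bool (?m j))"
      using t by (simp add: distrib_left[symmetric])
    also have "t * (\<Sum>j\<in>J. \<delta> j * of_bool (?m j)) \<le>
      (\<Sum>j\<in>J. t * \<delta> j * ((\<Sum>C\<in>\<C>. of_bool (touch C j (ext u)) * of_bool (\<exists>i\<in>C. u i \<noteq> v i)) + of_bool (u j \<noteq> v j)))"
      unfolding sum_distrib_left mult.assoc[symmetric] using t \<delta> by (intro sum_mono mult_left_mono m_le) auto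
    also have "\<dots> = (\<Sum>j\<in>J. \<Sum>C\<in>\<C>. t * \<delta> j * (of_bool (touch C j (ext u)) * of_bool (\<exists>i\<in>C. u i \<noteq> v i)))
        + (\<Sum>j\<in>J. t * \<delta> j * of_bool (u j \<noteq> v j))"
      by (simp only: distrib_left sum.distrib sum_distrib_left)
    also have "(\<Sum>j\<in>J. \<Sum>C\<in>\<C>. t * \<delta> j * (of_bool (touch C j (ext u)) * of_bool (\<exists>i\<in>C. u i \<noteq> v i))) =
        (\<Sum>C\<in>\<C>. L0 C (ext u) * of_bool (\<exists>i\<in>C. u i \<noteq> v i))"
      unfolding L0_def sum_distrib_right by (subst sum.swap) (simp only: mult.assoc)
    also have "(\<Sum>j\<in>J. t * \<delta> j * of_bool (u j \<noteq> v j)) = (\<Sum>i\<in>\<Union>\<C>. s i * of_bool (u i \<noteq> v i))"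
      by (rule sum.mono_neutral_cong_left) (use fin J\<Lambda> in \<open>auto simp: s_def \<Lambda>_def\<close>)
    finally show ?thesis by simp
  qed
  have main: "(\<integral>u. exp (t * F N (ext u)) \<partial>?P) \<le> exp ((\<integral>u. t * F N (ext u) \<partial>?P) + (\<Sum>i\<in>\<Lambda>. (s i)\<^sup>2)
      + (\<Sum>C\<in>\<C>. \<integral>u. (L0 C (ext u))\<^sup>2 \<partial>?P))"
    unfolding \<Lambda>_def
  proof (rule expectation_exp_blocks[OF prob_\<nu> \<C>, where B=b])
    show "0 \<le> s i" for i using t \<delta> by (simp add: s_def)
    show "(\<lambda>u. t * F N (ext u)) \<in> borel_measurable (PiM (\<Union>\<C>) (\<lambda>_. \<nu>))"
      using measurable_compose[OF ext_meas F_measurable] unfolding \<Lambda>_def by measurable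
    show "\<bar>t * F N (ext u)\<bar> \<le> b" if "u \<in> space (PiM (\<Union>\<C>) (\<lambda>_. \<nu>))" for u
      using F_le[OF ext_space] that by (simp add: \<Lambda>_def)
    show "(\<lambda>u. L0 C (ext u)) \<in> borel_measurable (PiM (\<Union>\<C>) (\<lambda>_. \<nu>))" for C
      using measurable_compose[OF ext_meas L0_meas] unfolding \<Lambda>_def by simp
    show "0 \<le> L0 C (ext u)" for C u by (rule L0_nonneg)
    show "L0 C (ext u) \<le> b" for C u using L0_le D_le by (rule order_trans)
  qed (assumption, rule cost)
  have e1: "(\<integral>u. exp (t * F N (ext u)) \<partial>?P) = (\<integral>x. exp (t * F N x) \<partial>law)"
    by (subst transfer[of "\<lambda>x. exp (t * F N x)"]) (auto simp: F_ext intro!: Bochner_Integration.integral_cong)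
  have e2: "(\<integral>u. t * F N (ext u) \<partial>?P) = t * (\<integral>x. F N x \<partial>law)"
    by (subst transfer[of "\<lambda>x. t * F N x"]) (auto simp: F_ext simp flip: integral_mult_right_zero intro!: Bochner_Integration.integral_cong)
  have e3: "(\<Sum>i\<in>\<Lambda>. (s i)\<^sup>2) = t\<^sup>2 * (\<Sum>j\<in>J. (\<delta> j)\<^sup>2)"
  proof -
    have "(\<Sum>i\<in>\<Lambda>. (s i)\<^sup>2) = (\<Sum>j\<in>J. (t * \<delta> j)\<^sup>2)"
      by (rule sum.mono_neutral_cong_right) (use fin J\<Lambda> in \<open>auto simp: s_def\<close>)
    then show ?thesis by (simp add: power_mult_distrib sum_distrib_left)
  qed
  have e4: "(\<integral>u. (L0 (block b) (ext u))\<^sup>2 \<partial>?P) \<le> t\<^sup>2 * energy b" for b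
  proof -
    let ?H = "\<lambda>x. \<Sum>j\<in>J. \<delta> j * of_bool (enat (block_dist (b - j)) \<le> rad j x)"
    have le: "L0 (block b) (ext (restrict x \<Lambda>)) \<le> t * ?H x" if x: "x \<in> space law" for x
    proof -
      have "touch (block b) j (ext (restrict x \<Lambda>)) \<Longrightarrow> enat (block_dist (b - j)) \<le> rad j x" if j: "j \<in> J" for j
      proof -
        assume tc: "touch (block b) j (ext (restrict x \<Lambda>))"
        have agree: "ext (restrict x \<Lambda>) i = x i" if "i \<in> ball_inf j N" for i
          using ball[OF j] that by (auto simp: ext_def)
        have ge: "enat p \<le> rad j (ext (restrict x \<Lambda>)) \<longleftrightarrow> enat p \<le> rad j x" if "p \<le> N" for p
          by (rule ge_cong[OF ext_space[OF restr_space[OF x]] x agree that])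
        \<comment> \<open>The thresholds are moved from the extended configuration back to
          \<open>x\<close>; for the threshold 1 this uses \<open>1 \<le> N\<close>.\<close>
        obtain i where i: "i \<in> block b" "linf (i - j) \<le> N" "enat (linf (i - j)) \<le> rad j x" and "1 \<le> rad j x"
          using tc ge[of 1] N ge unfolding touch_def one_enat_def by blast
        \<comment> \<open>The maximum with 1 combines reach and positivity of the radius, in
          accordance with the lower bound 1 built into \<open>block_dist\<close>.\<close>
        then have "enat (max 1 (linf (i - j))) \<le> rad j x" by (auto simp: max_def one_enat_def)
        moreover have "block_dist (b - j) \<le> max 1 (linf (i - j))" by (rule block_dist_le[OF i(1)]) auto
        ultimately show ?thesis using enat_le_mono by blast
      qed
      then show ?thesis unfolding L0_def sum_distrib_left mult.assoc
        using t \<delta> by (intro sum_mono mult_left_mono) (auto simp: of_bool_def)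
    qed
    have H_meas: "?H \<in> borel_measurable law"
    proof -
      have "(\<lambda>x. of_bool (enat (block_dist (b - j)) \<le> rad j x) :: real) \<in> borel_measurable law" for j
        using measurable_compose[OF rad_measurable[of j], of "\<lambda>r. of_bool (enat (block_dist (b - j)) \<le> r)" borel] by simp
      then show ?thesis by measurable
    qed
    have bnd: "\<bar>(t * ?H x)\<^sup>2\<bar> \<le> D\<^sup>2" for x
    proof -
      have "0 \<le> t * ?H x" using t \<delta> by (intro mult_nonneg_nonneg sum_nonneg) auto
      moreover have "t * ?H x \<le> D"
        unfolding D_def sum_distrib_left using t \<delta> by (intro sum_mono mult_left_mono) (auto simp: mult_left_le)
      ultimately show ?thesis by (simp add: power_mono)
    qed
    have "(\<integral>u. (L0 (block b) (ext u))\<^sup>2 \<partial>?P) = (\<integral>x. (L0 (block b) (ext (restrict x \<Lambda>)))\<^sup>2 \<partial>law)"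
      using L0_meas by (intro transfer) measurable
    also have "\<dots> \<le> (\<integral>x. (t * ?H x)\<^sup>2 \<partial>law)"
    proof (rule integral_mono)
      have m: "(\<lambda>x. L0 (block b) (ext (restrict x \<Lambda>))) \<in> borel_measurable law"
        by (rule measurable_compose[OF restr_meas measurable_compose[OF ext_meas L0_meas]])
      show "integrable law (\<lambda>x. (L0 (block b) (ext (restrict x \<Lambda>)))\<^sup>2)"
        using m L0_nonneg L0_le by (intro law.integrable_const_bound[of _ "D\<^sup>2"]) (auto simp: power_mono)
      show "integrable law (\<lambda>x. (t * ?H x)\<^sup>2)"
        using H_meas bnd by (intro law.integrable_const_bound[of _ "D\<^sup>2"]) auto
      show "(L0 (block b) (ext (restrict x \<Lambda>)))\<^sup>2 \<le> (t * ?H x)\<^sup>2" if "x \<in> space law" for x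
        by (intro power_mono le that L0_nonneg)
    qed
    also have "\<dots> = t\<^sup>2 * energy b" by (simp add: power_mult_distrib energy_eq)
    finally show ?thesis .
  qed
  have e5: "(\<Sum>C\<in>\<C>. \<integral>u. (L0 C (ext u))\<^sup>2 \<partial>?P) \<le> t\<^sup>2 * (\<Sum>b\<in>bases o' N. energy b)"
    unfolding \<C>_def sum.reindex[OF block_inj_on] comp_def sum_distrib_left by (intro sum_mono e4)
  from main have "(\<integral>x. exp (t * F N x) \<partial>law) \<le> exp (t * (\<integral>x. F N x \<partial>law) + t\<^sup>2 * (\<Sum>j\<in>J. (\<delta> j)\<^sup>2)
      + (\<Sum>C\<in>\<C>. \<integral>u. (L0 C (ext u))\<^sup>2 \<partial>?P))"
    unfolding e1 e2 e3 .
  also have "\<dots> \<le> exp (t * (\<integral>x. F N x \<partial>law) + t\<^sup>2 * ((\<Sum>j\<in>J. (\<delta> j)\<^sup>2) + (\<Sum>b\<in>bases o' N. energy b)))"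
    using e5 by (simp add: distrib_left)
  finally show ?thesis .
qed

section \<open>Choice of a tiling and removal of the truncation\<close>

lemma coding_volume_ge_1: "1 \<le> coding_volume"
proof -
  have "(1::ennreal) = (\<integral>\<^sup>+x. 1 \<partial>law)" by (simp add: law.emeasure_space_1)
  also have "\<dots> \<le> coding_volume"
    unfolding coding_volume_def
  proof (rule nn_integral_mono)
    fix x
    have "(1::ennreal) ^ CARD('d) \<le> (2 * ennreal_of_enat (rad 0 x) + 1) ^ CARD('d)"
      by (rule power_mono) simp_all
    then show "1 \<le> (2 * ennreal_of_enat (rad 0 x) + 1) ^ CARD('d)" by simp
  qed
  finally show ?thesis .
qed

text \<open>\<open>S\<close> ranges over arbitrary finite sets of lower corners and may mix all
  tilings. This is the source of the factor \<open>4 ^ d\<close>, to be removed by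
  averaging.\<close>

lemma energy_sum_le:
  assumes v: "coding_volume = ennreal v" "0 \<le> v" and S: "finite S"
  shows "(\<Sum>b\<in>S. energy b) \<le> 4 ^ CARD('d) * (((1 / \<alpha>) ^ CARD('d) + 1) * v\<^sup>2 * (\<Sum>j\<in>J. (\<delta> j)\<^sup>2))"
proof -
  have "ennreal (\<Sum>b\<in>S. energy b) = (\<Sum>b\<in>S. \<Sum>k\<in>J. \<Sum>l\<in>J. ennreal (\<delta> k * \<delta> l) * emeasure law
      {x\<in>space law. enat (block_dist (b - k)) \<le> rad k x \<and> enat (block_dist (b - l)) \<le> rad l x})"
    unfolding energy_def using \<delta>
    by (simp add: sum_nonneg mult_nonneg_nonneg sum_ennreal[symmetric] ennreal_mult law.emeasure_eq_measure)
  also have "\<dots> \<le> ennreal (\<Sum>k\<in>J. (\<delta> k)\<^sup>2) * (ennreal (4 ^ CARD('d) * ((1 / \<alpha>) ^ CARD('d) + 1)) * coding_volume\<^sup>2)"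
    by (rule weighted_joint_tail_sum_le[OF finite_J S \<delta>])
  also have "\<dots> = ennreal ((\<Sum>k\<in>J. (\<delta> k)\<^sup>2) * (4 ^ CARD('d) * ((1 / \<alpha>) ^ CARD('d) + 1) * v\<^sup>2))"
    using \<alpha> v by (simp add: ennreal_mult sum_nonneg ennreal_power)
  finally have "(\<Sum>b\<in>S. energy b) \<le> (\<Sum>k\<in>J. (\<delta> k)\<^sup>2) * (4 ^ CARD('d) * ((1 / \<alpha>) ^ CARD('d) + 1) * v\<^sup>2)"
    using \<alpha> by (subst (asm) ennreal_le_iff) (auto intro!: mult_nonneg_nonneg sum_nonneg add_nonneg_nonneg)
  then show ?thesis by (simp only: mult_ac)
qed

text \<open>Different offsets have disjoint sets of corners, so the energies of all
  \<open>4 ^ d\<close> tilings form a single sum over corners, and some tiling does not exceed the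
  average.\<close>

lemma low_energy_tiling:
  assumes v: "coding_volume = ennreal v" "0 \<le> v"
  obtains o' where "(\<Sum>b\<in>bases o' N. energy b) \<le> ((1 / \<alpha>) ^ CARD('d) + 1) * v\<^sup>2 * (\<Sum>j\<in>J. (\<delta> j)\<^sup>2)"
proof -
  let ?R = "((1 / \<alpha>) ^ CARD('d) + 1) * v\<^sup>2 * (\<Sum>j\<in>J. (\<delta> j)\<^sup>2)"
  have disj: "bases o1 N \<inter> bases o2 N = {}" if o: "o1 \<in> offsets" "o2 \<in> offsets" "o1 \<noteq> o2" for o1 o2 :: "int ^ 'd"
  proof (rule ccontr)
    assume "bases o1 N \<inter> bases o2 N \<noteq> {}"
    then obtain b where "b \<in> bases o1 N" "b \<in> bases o2 N" by blast
    then obtain i1 i2 where "b = tile_base o1 i1" "b = tile_base o2 i2" unfolding bases_def by (elim imageE)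
    then have "(b $ c - o1 $ c) mod 4 = 0" "(b $ c - o2 $ c) mod 4 = 0" for c
      using tile_base_mod by metis+
    then have "o1 = o2" by (rule offset_unique[OF o(1,2)])
    with o(3) show False ..
  qed
  have "(\<Sum>o'\<in>offsets. \<Sum>b\<in>bases o' N. energy b) = (\<Sum>b\<in>(\<Union>o'\<in>offsets. bases o' N). energy b)"
    by (rule sum.UNION_disjoint[symmetric]) (use offsets(1) finite_bases disj in blast)+
  also have "\<dots> \<le> 4 ^ CARD('d) * ?R"
    by (rule energy_sum_le[OF v]) (use offsets(1) finite_bases in blast)
  also have "\<dots> = (\<Sum>o'\<in>(offsets :: (int ^ 'd) set). ?R)"
    by (simp add: offsets(2))
  finally have le: "(\<Sum>o'\<in>offsets. \<Sum>b\<in>bases o' N. energy b) \<le> (\<Sum>o'\<in>(offsets :: (int ^ 'd) set). ?R)" .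
  have ne: "offsets \<noteq> ({} :: (int ^ 'd) set)" using offsets(2) by (metis card.empty power_not_zero zero_neq_numeral)
  have "\<exists>o'\<in>offsets. (\<Sum>b\<in>bases o' N. energy b) \<le> ?R"
  proof (rule ccontr)
    assume "\<not> (\<exists>o'\<in>offsets. (\<Sum>b\<in>bases o' N. energy b) \<le> ?R)"
    then have "?R < (\<Sum>b\<in>bases o' N. energy b)" if "o' \<in> offsets" for o' using that by (meson not_le)
    then have "(\<Sum>o'\<in>(offsets :: (int ^ 'd) set). ?R) < (\<Sum>o'\<in>offsets. \<Sum>b\<in>bases o' N. energy b)"
      by (rule sum_strict_mono[OF offsets(1) ne])
    with le show False by linarith
  qed
  then show ?thesis using that by (elim bexE)
qed

lemma F_tendsto: "AE x in law. (\<lambda>N. F N x) \<longlonglongrightarrow> f (\<phi> x)"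
proof -
  have "AE x in law. \<forall>j\<in>J. rad j x < \<infinity>"
    using finite_J rad_finite by (simp add: AE_finite_all)
  then show ?thesis
    using AE_space
  proof eventually_elim
    case (elim x)
    have "\<exists>m. \<forall>j\<in>J. rad j x \<le> enat m"
    proof -
      have "rad j x \<le> enat (\<Sum>j\<in>J. the_enat (rad j x))" if j: "j \<in> J" for j
      proof -
        obtain r where r: "rad j x = enat r" using elim(1) j by (cases "rad j x") auto
        have "the_enat (rad j x) \<le> (\<Sum>j\<in>J. the_enat (rad j x))"
          by (rule member_le_sum[OF j]) (use finite_J in simp_all)
        then show ?thesis by (simp add: r)
      qed
      then show ?thesis by blast
    qed
    then obtain m where m: "\<And>j. j \<in> J \<Longrightarrow> rad j x \<le> enat m" by blast
    have "F N x = f (\<phi> x)" if "m \<le> N" for N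
    proof -
      have "rad j x \<le> enat N" if "j \<in> J" for j
        using m[OF that] \<open>m \<le> N\<close> order_trans[of _ "enat m" "enat N"] by simp
      then show ?thesis
        unfolding F_def by (intro f_local truncated_space \<phi>_space elim(2)) (simp add: truncated_def)
    qed
    then have "eventually (\<lambda>N. F N x = f (\<phi> x)) sequentially" by (auto simp: eventually_sequentially)
    then show ?case by (rule tendsto_eventually)
  qed
qed

lemma exponential_bound:
  assumes t: "0 < t" and v: "coding_volume = ennreal v" "0 \<le> v"
  shows "(\<integral>x. exp (t * (f (\<phi> x) - (\<integral>x. f (\<phi> x) \<partial>law))) \<partial>law) \<le>
    exp (3 * (1 / \<alpha>) ^ CARD('d) * t\<^sup>2 * v\<^sup>2 * (\<Sum>j\<in>J. (\<delta> j)\<^sup>2))"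
proof -
  define R where "R = 3 * (1 / \<alpha>) ^ CARD('d) * t\<^sup>2 * v\<^sup>2 * (\<Sum>j\<in>J. (\<delta> j)\<^sup>2)"
  define b where "b = \<bar>f (\<phi> origin)\<bar> + (\<Sum>j\<in>J. \<delta> j)"
  have Fb: "\<bar>F N x\<bar> \<le> b" if "x \<in> space law" for N x
    unfolding F_def b_def by (intro f_bounded truncated_space that)
  have f\<phi>_meas: "(\<lambda>x. f (\<phi> x)) \<in> borel_measurable law" by measurable
  have bound: "(\<integral>x. exp (t * F N x) \<partial>law) \<le> exp (t * (\<integral>x. F N x \<partial>law) + R)" if N: "1 \<le> N" for N
  proof -
    \<comment> \<open>The tiling may depend on \<open>N\<close>; its bound does not, which suffices
      for the limit.\<close>
    obtain o' where o': "(\<Sum>b\<in>bases o' N. energy b) \<le> ((1 / \<alpha>) ^ CARD('d) + 1) * v\<^sup>2 * (\<Sum>j\<in>J. (\<delta> j)\<^sup>2)"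
      using low_energy_tiling[OF v] .
    have "1 \<le> v" using coding_volume_ge_1 v by simp
    then have v1: "1 \<le> v\<^sup>2" by (simp add: one_le_power)
    have a1: "1 \<le> (1 / \<alpha>) ^ CARD('d)" using \<alpha> by (intro one_le_power) simp
    have s0: "0 \<le> (\<Sum>j\<in>J. (\<delta> j)\<^sup>2)" by (intro sum_nonneg) simp
    have av: "v\<^sup>2 \<le> (1 / \<alpha>) ^ CARD('d) * v\<^sup>2" using mult_right_mono[OF a1, of "v\<^sup>2"] by simp
    \<comment> \<open>The summand 1 stands for the radius 0 cost, the rest for the energy of the
      chosen tiling. Both \<open>v\<^sup>2\<close> and \<open>(1 / \<alpha>) ^ d\<close> are at
      least 1, so three copies of their product suffice.\<close>
    have "1 + ((1 / \<alpha>) ^ CARD('d) + 1) * v\<^sup>2 \<le> 3 * (1 / \<alpha>) ^ CARD('d) * v\<^sup>2"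
    proof -
      define w where "w = (1 / \<alpha>) ^ CARD('d) * v\<^sup>2"
      have "v\<^sup>2 \<le> w" using av by (simp only: w_def)
      moreover have "3 * (1 / \<alpha>) ^ CARD('d) * v\<^sup>2 = 3 * w" by (simp only: w_def mult.assoc)
      moreover have "((1 / \<alpha>) ^ CARD('d) + 1) * v\<^sup>2 = w + v\<^sup>2" by (simp only: w_def distrib_right mult_1)
      ultimately show ?thesis using v1 by linarith
    qed
    from mult_right_mono[OF this s0]
    have "(\<Sum>j\<in>J. (\<delta> j)\<^sup>2) + (\<Sum>b\<in>bases o' N. energy b) \<le> 3 * (1 / \<alpha>) ^ CARD('d) * v\<^sup>2 * (\<Sum>j\<in>J. (\<delta> j)\<^sup>2)"
      unfolding distrib_right mult_1 using o' unfolding distrib_right mult_1 by linarith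
    from mult_left_mono[OF this, of "t\<^sup>2"]
    have "t\<^sup>2 * ((\<Sum>j\<in>J. (\<delta> j)\<^sup>2) + (\<Sum>b\<in>bases o' N. energy b)) \<le> R"
      unfolding R_def by (simp only: mult_ac zero_le_power2 simp_thms)
    then show ?thesis
      by (intro order_trans[OF truncated_exponential_bound[OF t N, of o']]) simp
  qed
  have lim1: "(\<lambda>N. \<integral>x. F N x \<partial>law) \<longlonglongrightarrow> (\<integral>x. f (\<phi> x) \<partial>law)"
  proof (rule integral_dominated_convergence[where w="\<lambda>_. b"])
    show "AE x in law. norm (F N x) \<le> b" for N using Fb by (auto intro!: AE_I2)
  qed (use F_tendsto f\<phi>_meas in auto)
  have lim2: "(\<lambda>N. \<integral>x. exp (t * F N x) \<partial>law) \<longlonglongrightarrow> (\<integral>x. exp (t * f (\<phi> x)) \<partial>law)"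
  proof (rule integral_dominated_convergence[where w="\<lambda>_. exp (t * b)"])
    have "t * F N x \<le> t * b" if "x \<in> space law" for N x
      using Fb[OF that, of N] t by (intro mult_left_mono) auto
    then show "AE x in law. norm (exp (t * F N x)) \<le> exp (t * b)" for N by (auto intro!: AE_I2)
    show "AE x in law. (\<lambda>N. exp (t * F N x)) \<longlonglongrightarrow> exp (t * f (\<phi> x))"
      using F_tendsto by eventually_elim (intro tendsto_intros)
  qed (use f\<phi>_meas in \<open>auto intro!: measurable_compose[OF F_measurable]\<close>)
  have lim3: "(\<lambda>N. exp (t * (\<integral>x. F N x \<partial>law) + R)) \<longlonglongrightarrow> exp (t * (\<integral>x. f (\<phi> x) \<partial>law) + R)"
    by (intro tendsto_intros lim1)
  have "(\<integral>x. exp (t * f (\<phi> x)) \<partial>law) \<le> exp (t * (\<integral>x. f (\<phi> x) \<partial>law) + R)"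
    by (rule LIMSEQ_le[OF lim2 lim3]) (use bound in blast)
  then have "exp (- (t * (\<integral>x. f (\<phi> x) \<partial>law))) * (\<integral>x. exp (t * f (\<phi> x)) \<partial>law) \<le>
      exp (- (t * (\<integral>x. f (\<phi> x) \<partial>law))) * exp (t * (\<integral>x. f (\<phi> x) \<partial>law) + R)"
    by (rule mult_left_mono) simp
  also have "\<dots> = exp R" by (simp add: exp_add[symmetric])
  also have "exp (- (t * (\<integral>x. f (\<phi> x) \<partial>law))) * (\<integral>x. exp (t * f (\<phi> x)) \<partial>law) =
      (\<integral>x. exp (t * (f (\<phi> x) - (\<integral>x. f (\<phi> x) \<partial>law))) \<partial>law)"
    unfolding integral_mult_right_zero[symmetric] exp_add[symmetric]
    by (simp add: algebra_simps)
  finally show ?thesis unfolding R_def .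
qed

end

section \<open>A measurable coding radius\<close>

lemma INF_enat_le_iff: "(INF q. if P q then enat q else \<infinity>) \<le> enat n \<longleftrightarrow> (\<exists>r\<le>n. P r)"
proof -
  have "(INF q. if P q then enat q else \<infinity>) \<le> enat n \<longleftrightarrow> (INF q. if P q then enat q else \<infinity>) < enat (Suc n)"
    by (cases "INF q. if P q then enat q else \<infinity>") auto
  also have "\<dots> \<longleftrightarrow> (\<exists>r\<le>n. P r)"
    unfolding INF_less_iff by (auto simp: less_Suc_eq_le split: if_splits)
  finally show ?thesis .
qed

lemma Inf_enat_image: "Inf (enat ` {q. P q}) = (INF q. if P q then enat q else \<infinity>)"
proof (rule antisym)
  show "Inf (enat ` {q. P q}) \<le> (INF q. if P q then enat q else \<infinity>)"
    by (rule INF_greatest) (simp add: INF_lower)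
  show "(INF q. if P q then enat q else \<infinity>) \<le> Inf (enat ` {q. P q})"
  proof (rule INF_greatest)
    fix q assume "q \<in> {q. P q}"
    then show "(INF q. if P q then enat q else \<infinity>) \<le> enat q"
      by (intro INF_enat_le_iff[THEN iffD2]) auto
  qed
qed

lemma shift_measurable[measurable]: "shift k \<in> measurable (PiM UNIV (\<lambda>_. \<nu>)) (PiM UNIV (\<lambda>_. \<nu>))"
proof (rule measurable_PiM_single')
  show "(\<lambda>x. shift k x i) \<in> measurable (PiM UNIV (\<lambda>_. \<nu>)) \<nu>" for i
    unfolding shift_def by (rule measurable_component_singleton) simp
qed (auto simp: shift_def space_PiM)

lemma shift_space: "x \<in> space (PiM UNIV (\<lambda>_. \<nu>)) \<Longrightarrow> shift k x \<in> space (PiM UNIV (\<lambda>_. \<nu>))"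
  using measurable_space[OF shift_measurable] .

lemma distr_shift:
  fixes k :: "int ^ 'd::finite"
  assumes "prob_space \<nu>"
  shows "distr (PiM UNIV (\<lambda>_. \<nu>)) (PiM UNIV (\<lambda>_. \<nu>)) (shift k) = PiM UNIV (\<lambda>_. \<nu>)"
proof -
  have "distr (PiM UNIV (\<lambda>_. \<nu>)) (PiM UNIV (\<lambda>_. \<nu>)) (\<lambda>x. \<lambda>i\<in>UNIV. x (i + k)) = PiM UNIV (\<lambda>_. \<nu>)"
    by (rule distr_PiM_reindex[of UNIV "\<lambda>_. \<nu>" "\<lambda>i. i + k" UNIV]) (use assms in \<open>auto intro: injI\<close>)
  then show ?thesis by (simp add: shift_def[abs_def] restrict_def)
qed

lemma AE_shift:
  assumes "prob_space \<nu>" "AE x in PiM UNIV (\<lambda>_. \<nu>). P x"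
  shows "AE x in PiM UNIV (\<lambda>_. \<nu>). P (shift k x)"
proof (rule AE_distrD[OF shift_measurable])
  show "AE x in distr (PiM UNIV (\<lambda>_. \<nu>)) (PiM UNIV (\<lambda>_. \<nu>)) (shift k). P x"
    unfolding distr_shift[OF assms(1)] by (rule assms(2))
qed

text \<open>Comparing two arbitrary configurations of the fibre, instead of one with
  \<open>x\<close>, makes the condition depend on the restriction of \<open>x\<close> alone. The two
  forms are equivalent because \<open>x\<close> belongs to its own fibre.\<close>

lemma coding_radius_eq_INF:
  assumes x: "x \<in> space (config_space A)"
  shows "coding_radius A \<phi> x = (INF q. if restrict x (ball_inf 0 q) \<in>
    {u. \<not> (\<exists>y\<in>space (config_space A). \<exists>y'\<in>space (config_space A).
      (\<forall>i\<in>ball_inf 0 q. y i = u i) \<and> (\<forall>i\<in>ball_inf 0 q. y' i = u i) \<and> \<phi> y 0 \<noteq> \<phi> y' 0)} then enat q else \<infinity>)"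
proof -
  have "(\<forall>x'\<in>space (config_space A). (\<forall>i\<in>ball_inf 0 q. x' i = x i) \<longrightarrow> \<phi> x' 0 = \<phi> x 0) \<longleftrightarrow>
    restrict x (ball_inf 0 q) \<in> {u. \<not> (\<exists>y\<in>space (config_space A). \<exists>y'\<in>space (config_space A).
      (\<forall>i\<in>ball_inf 0 q. y i = u i) \<and> (\<forall>i\<in>ball_inf 0 q. y' i = u i) \<and> \<phi> y 0 \<noteq> \<phi> y' 0)}" (is "?L q \<longleftrightarrow> ?R q") for q
  proof -
    have r: "(\<forall>i\<in>ball_inf 0 q. y i = restrict x (ball_inf 0 q) i) \<longleftrightarrow> (\<forall>i\<in>ball_inf 0 q. y i = x i)" for y
      by simp
    show ?thesis
      unfolding mem_Collect_eq r
    proof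
      assume L: "?L q"
      show "\<not> (\<exists>y\<in>space (config_space A). \<exists>y'\<in>space (config_space A).
        (\<forall>i\<in>ball_inf 0 q. y i = x i) \<and> (\<forall>i\<in>ball_inf 0 q. y' i = x i) \<and> \<phi> y 0 \<noteq> \<phi> y' 0)"
        using L by metis
    next
      assume R: "\<not> (\<exists>y\<in>space (config_space A). \<exists>y'\<in>space (config_space A).
        (\<forall>i\<in>ball_inf 0 q. y i = x i) \<and> (\<forall>i\<in>ball_inf 0 q. y' i = x i) \<and> \<phi> y 0 \<noteq> \<phi> y' 0)"
      show "?L q" using R x by blast
    qed
  qed
  then show ?thesis unfolding coding_radius_def Inf_enat_image by presburger
qed

text \<open>
  The sets of local configurations that determine the output at the origin are shrunk to their
  \<^const>\<open>main_part\<close>, which costs a null set.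
\<close>

lemma measurable_radius:
  fixes \<phi> :: "(int ^ 'd::finite \<Rightarrow> 'a) \<Rightarrow> int ^ 'd \<Rightarrow> 'b"
  assumes A: "standard_borel A" and B: "standard_borel B" and \<phi>: "coding A B \<phi>"
    and \<nu>: "prob_space \<nu>" "sets \<nu> = sets A"
  obtains rad :: "int ^ 'd \<Rightarrow> (int ^ 'd \<Rightarrow> 'a) \<Rightarrow> enat" where
    "\<And>k. rad k \<in> measurable (PiM UNIV (\<lambda>_. \<nu>)) (count_space UNIV)"
    "\<And>k x. rad k x = rad 0 (shift k x)"
    "AE x in PiM UNIV (\<lambda>_. \<nu>). \<forall>k. rad k x = site_radius A \<phi> k x"
    "\<And>k q x y. x \<in> space (PiM UNIV (\<lambda>_. \<nu>)) \<Longrightarrow> y \<in> space (PiM UNIV (\<lambda>_. \<nu>)) \<Longrightarrow>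
      (\<And>i. i \<in> ball_inf k q \<Longrightarrow> x i = y i) \<Longrightarrow> rad k x \<le> enat q \<Longrightarrow> rad k y \<le> enat q"
    "\<And>k q x y. x \<in> space (PiM UNIV (\<lambda>_. \<nu>)) \<Longrightarrow> y \<in> space (PiM UNIV (\<lambda>_. \<nu>)) \<Longrightarrow>
      (\<And>i. i \<in> ball_inf k q \<Longrightarrow> x i = y i) \<Longrightarrow> rad k x \<le> enat q \<Longrightarrow> \<phi> x k = \<phi> y k"
proof -
  interpret \<nu>: prob_space \<nu> by fact
  interpret product_prob_space "\<lambda>_::int ^ 'd. \<nu>" UNIV by unfold_locales
  let ?law = "PiM UNIV (\<lambda>_::int ^ 'd. \<nu>)"
  have sp\<nu>: "space \<nu> = space A" using \<nu>(2) by (rule sets_eq_imp_space_eq)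
  have sp: "space ?law = space (config_space A)" by (simp add: space_PiM sp\<nu>)
  define ball where "ball q = (ball_inf 0 q :: (int ^ 'd) set)" for q
  have fin: "finite (ball q)" for q unfolding ball_def by (rule finite_ball_inf)
  define P where "P q = PiM (ball q) (\<lambda>_. \<nu>)" for q
  define E where "E q = {u. \<exists>y\<in>space (config_space A). \<exists>y'\<in>space (config_space A).
      (\<forall>i\<in>ball q. y i = u i) \<and> (\<forall>i\<in>ball q. y' i = u i) \<and> \<phi> y 0 \<noteq> \<phi> y' 0}" for q
  define C where "C q = space (P q) - E q" for q
  \<comment> \<open>Shrinking can only enlarge the radius. The output therefore stays locally
    determined for every configuration and not merely almost surely.\<close>
  define G where "G q = main_part (P q) (C q)" for q
  have probP: "prob_space (P q)" for q unfolding P_def by (rule prob_space_PiM) (rule \<nu>(1))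
  have setsP: "sets (P q) = sets (PiM (ball q) (\<lambda>_. A))" for q
    unfolding P_def by (rule sets_PiM_cong) (simp_all add: \<nu>(2))
  have \<phi>0: "(\<lambda>x. \<phi> x 0) \<in> measurable (config_space A) B"
    using measurable_compose[OF _ measurable_component_singleton[OF UNIV_I]] \<phi>[unfolded coding_def, THEN conjunct1] .
  have EP: "{u\<in>space (P q). \<exists>x\<in>space (PiM UNIV (\<lambda>_. A)). \<exists>x'\<in>space (PiM UNIV (\<lambda>_. A)).
    (\<forall>i\<in>ball q. x i = u i) \<and> (\<forall>i\<in>ball q. x' i = u i) \<and> \<phi> x 0 \<noteq> \<phi> x' 0} \<in> sets (completion (P q))" for q
    by (rule nonconstant_fibre_in_completion[OF A B \<phi>0 prob_space.finite_measure[OF probP] setsP])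
  have Ceq: "C q = space (completion (P q)) - {u\<in>space (P q). \<exists>x\<in>space (PiM UNIV (\<lambda>_. A)). \<exists>x'\<in>space (PiM UNIV (\<lambda>_. A)).
    (\<forall>i\<in>ball q. x i = u i) \<and> (\<forall>i\<in>ball q. x' i = u i) \<and> \<phi> x 0 \<noteq> \<phi> x' 0}" for q
    unfolding C_def E_def space_completion by blast
  have C: "C q \<in> sets (completion (P q))" for q
    unfolding Ceq by (rule sets.compl_sets[OF EP])
  have G: "G q \<in> sets (P q)" for q unfolding G_def using C by (rule main_part_sets)
  have GC: "G q \<subseteq> C q" for q
    unfolding G_def using main_part_null_part_Un[OF C[of q]] by blast
  \<comment> \<open>The sets \<open>G q\<close> need not grow with \<open>q\<close>, so
    \<open>rad k x \<le> enat q\<close> means membership at some level up to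
    \<open>q\<close>.\<close>
  define rad where "rad k x = (INF q. if restrict (shift k x) (ball q) \<in> G q then enat q else \<infinity>)" for k x
  have restr: "(\<lambda>x. restrict x (ball q)) \<in> measurable ?law (P q)" for q
    unfolding P_def by (rule measurable_restrict_subset) simp
  have restr_shift: "(\<lambda>x. restrict (shift k x) (ball q)) \<in> measurable ?law (P q)" for k q
    by (rule measurable_compose[OF shift_measurable restr])
  have 1: "rad k \<in> measurable ?law (count_space UNIV)" for k
    unfolding rad_def
  proof (rule measurable_INF)
    fix q
    have "{x\<in>space ?law. restrict (shift k x) (ball q) \<in> G q} \<in> sets ?law"
      using measurable_sets[OF restr_shift[of k q] G[of q]] by (simp add: vimage_def Int_def conj_commute)
    then show "(\<lambda>x. if restrict (shift k x) (ball q) \<in> G q then enat q else \<infinity>) \<in> measurable ?law (count_space UNIV)"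
      by (intro measurable_If) simp_all
  qed simp
  have 2: "rad k x = rad 0 (shift k x)" for k x
    unfolding rad_def by (simp add: shift_def)
  have 3: "AE x in ?law. \<forall>k. rad k x = site_radius A \<phi> k x"
  proof -
    \<comment> \<open>The null part lives in the finite product over the ball, whose measure is the
      image of the product law under restriction.\<close>
    have "AE x in ?law. restrict x (ball q) \<notin> null_part (P q) (C q)" for q
    proof (rule AE_distrD[OF restr])
      show "AE u in distr ?law (P q) (\<lambda>x. restrict x (ball q)). u \<notin> null_part (P q) (C q)"
        unfolding P_def distr_PiM_restrict_finite[OF fin subset_UNIV]
        using AE_notin_null_part[OF C[of q]] unfolding P_def .
    qed
    then have "AE x in ?law. \<forall>q. restrict x (ball q) \<notin> null_part (P q) (C q)"
      by (simp add: AE_all_countable)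
    then have "AE x in ?law. rad 0 x = coding_radius A \<phi> x"
      using AE_space
    proof eventually_elim
      case (elim x)
      have "restrict x (ball q) \<in> G q \<longleftrightarrow> restrict x (ball q) \<in> - E q" for q
        using elim(1) main_part_null_part_Un[OF C[of q]] measurable_space[OF restr elim(2), of q]
        unfolding G_def C_def by blast
      moreover have "shift 0 x = x" by (simp add: shift_def)
      ultimately show ?case
        unfolding rad_def coding_radius_eq_INF[OF elim(2)[unfolded sp]] E_def ball_def Collect_neg_eq by simp
    qed
    then have "AE x in ?law. rad 0 (shift k x) = coding_radius A \<phi> (shift k x)" for k
      by (rule AE_shift[OF \<nu>(1)])
    then have "AE x in ?law. rad k x = site_radius A \<phi> k x" for k
      by (simp add: 2[of k] site_radius_def)
    then show ?thesis by (simp add: AE_all_countable)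
  qed
  have eq: "restrict (shift k x) (ball r) = restrict (shift k y) (ball r)"
    if "\<And>i. i \<in> ball_inf k q \<Longrightarrow> x i = y i" "r \<le> q" for k q r and x y :: "int ^ 'd \<Rightarrow> 'a"
  proof (rule restrict_ext)
    fix i assume "i \<in> ball r"
    then have "i + k \<in> ball_inf k q" using that(2) by (simp add: ball_def ball_inf_def)
    then show "shift k x i = shift k y i" using that(1) by (simp add: shift_def)
  qed
  have le: "rad k x \<le> enat q \<longleftrightarrow> (\<exists>r\<le>q. restrict (shift k x) (ball r) \<in> G r)" for k x q
    unfolding rad_def by (rule INF_enat_le_iff)
  have 4: "rad k y \<le> enat q" if agree: "\<And>i. i \<in> ball_inf k q \<Longrightarrow> x i = y i" and r: "rad k x \<le> enat q" for k q x y
  proof -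
    obtain m where m: "m \<le> q" "restrict (shift k x) (ball m) \<in> G m" using r le by blast
    moreover have "restrict (shift k x) (ball m) = restrict (shift k y) (ball m)" by (rule eq[OF agree m(1)])
    ultimately show ?thesis unfolding le by auto
  qed
  \<comment> \<open>Outside \<open>E r\<close>, all extensions of a local pattern give the same
    output at the origin; equivariance moves this to the site \<open>k\<close>.\<close>
  have 5: "\<phi> x k = \<phi> y k" if x: "x \<in> space ?law" "y \<in> space ?law" and agree: "\<And>i. i \<in> ball_inf k q \<Longrightarrow> x i = y i"
    and r: "rad k x \<le> enat q" for k q x y
  proof -
    obtain r where r: "r \<le> q" "restrict (shift k x) (ball r) \<in> G r" using r le by blast
    then have nE: "restrict (shift k x) (ball r) \<notin> E r" using GC by (auto simp: C_def)
    have "restrict (shift k y) (ball r) = restrict (shift k x) (ball r)" using eq[OF agree r(1)] by simp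
    then have "\<forall>i\<in>ball r. shift k y i = restrict (shift k x) (ball r) i"
      "\<forall>i\<in>ball r. shift k x i = restrict (shift k x) (ball r) i" by (metis restrict_apply')+
    moreover have "shift k x \<in> space (config_space A)" "shift k y \<in> space (config_space A)"
      using x shift_space[of _ A] unfolding sp by blast+
    ultimately have "\<phi> (shift k x) 0 = \<phi> (shift k y) 0" using nE unfolding E_def by blast
    moreover have "\<phi> (shift k z) = shift k (\<phi> z)" if "z \<in> space ?law" for z
      using \<phi> that unfolding coding_def sp by blast
    ultimately show ?thesis using x by (simp add: shift_def)
  qed
  show ?thesis
    by (rule that[of rad]) (fact 1, fact 2, fact 3, erule (1) 4, rule 5)
qed

section \<open>The bound for finitary codings\<close>

lemma oscillation_upper:
  assumes "y \<in> space (config_space B)" "y' \<in> space (config_space B)" "\<And>l. l \<noteq> k \<Longrightarrow> y l = y' l"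
  shows "ennreal \<bar>f y - f y'\<bar> \<le> oscillation B f k"
  unfolding oscillation_def by (rule Sup_upper) (use assms in blast)

lemma oscillation_norm_sq_eq_sum:
  assumes "local_function B f" "bounded_difference B f"
  shows "oscillation_norm_sq B f = ennreal (\<Sum>j\<in>dep B f. (enn2real (oscillation B f j))\<^sup>2)"
proof -
  have fin: "finite (dep B f)" using assms(1) by (simp add: local_function_def)
  have osc: "oscillation B f j = ennreal (enn2real (oscillation B f j))" for j
    using assms(2) unfolding bounded_difference_def by (simp add: less_top)
  have "oscillation_norm_sq B f = (\<Sum>\<^sub>\<infinity>j\<in>dep B f. (oscillation B f j)\<^sup>2)"
    unfolding oscillation_norm_sq_def by (rule infsum_cong_neutral) (auto simp: dep_def)
  also have "\<dots> = (\<Sum>j\<in>dep B f. (oscillation B f j)\<^sup>2)" using fin by simp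
  also have "\<dots> = (\<Sum>j\<in>dep B f. ennreal ((enn2real (oscillation B f j))\<^sup>2))"
    by (subst osc) (simp add: ennreal_power)
  finally show ?thesis by (simp add: sum_ennreal)
qed

lemma iid_field_law:
  fixes X :: "int ^ 'd::finite \<Rightarrow> 'w \<Rightarrow> 'a"
  assumes M: "prob_space M" and X: "iid_field M A X"
  defines "\<nu> \<equiv> distr M A (X 0)"
  shows "prob_space \<nu>" and "(\<lambda>\<omega> i. X i \<omega>) \<in> measurable M (PiM UNIV (\<lambda>_. \<nu>))"
    and "distr M (PiM UNIV (\<lambda>_. \<nu>)) (\<lambda>\<omega> i. X i \<omega>) = PiM UNIV (\<lambda>_. \<nu>)"
proof -
  interpret prob_space M by fact
  have rv: "X i \<in> measurable M A" for i
    using X unfolding iid_field_def indep_vars_def by blast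
  show "prob_space \<nu>" unfolding \<nu>_def by (rule prob_space_distr[OF rv])
  show "(\<lambda>\<omega> i. X i \<omega>) \<in> measurable M (PiM UNIV (\<lambda>_. \<nu>))"
  proof (rule measurable_PiM_single')
    show "(\<lambda>\<omega>. X i \<omega>) \<in> measurable M \<nu>" for i unfolding \<nu>_def using rv[of i] by simp
  qed (use measurable_space[OF rv] in \<open>auto simp: \<nu>_def\<close>)
  have "distr M (PiM UNIV (\<lambda>_. A)) (\<lambda>\<omega>. \<lambda>i\<in>UNIV. X i \<omega>) = PiM UNIV (\<lambda>i. distr M A (X i))"
    using X indep_vars_iff_distr_eq_PiM[where I=UNIV and X=X and M'="\<lambda>_. A"] rv unfolding iid_field_def by blast
  also have "(\<lambda>i. distr M A (X i)) = (\<lambda>_. \<nu>)"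
    using X unfolding iid_field_def \<nu>_def by blast
  also have "distr M (PiM UNIV (\<lambda>_. A)) (\<lambda>\<omega>. \<lambda>i\<in>UNIV. X i \<omega>) = distr M (PiM UNIV (\<lambda>_. \<nu>)) (\<lambda>\<omega> i. X i \<omega>)"
    by (intro distr_cong sets_PiM_cong) (simp_all add: \<nu>_def restrict_def)
  finally show "distr M (PiM UNIV (\<lambda>_. \<nu>)) (\<lambda>\<omega> i. X i \<omega>) = PiM UNIV (\<lambda>_. \<nu>)" .
qed

text \<open>Transfers the hypotheses from \<open>M\<close> to the product law: the field has this
  law, and its coding radii almost surely coincide with the measurable substitute.\<close>

lemma coding_log_laplace_bound:
  fixes M :: "'w measure" and A :: "'a measure" and B :: "'b measure"
    and X :: "int ^ 'd::finite \<Rightarrow> 'w \<Rightarrow> 'a"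
    and \<phi> :: "(int ^ 'd \<Rightarrow> 'a) \<Rightarrow> (int ^ 'd \<Rightarrow> 'b)"
    and f :: "(int ^ 'd \<Rightarrow> 'b) \<Rightarrow> real"
  assumes M: "prob_space M" and A: "standard_borel A" and B: "standard_borel B"
    and X: "iid_field M A X" and \<phi>: "coding A B \<phi>" and fin: "finitary M A X \<phi>"
    and \<alpha>: "0 < \<alpha>" "\<alpha> \<le> 1" and srf: "short_range_factorization M A X \<phi> \<alpha>"
    and f: "local_function B f" "bounded_difference B f"
    and v: "(\<integral>\<^sup>+\<omega>. (2 * ennreal_of_enat (coding_radius A \<phi> (\<lambda>i. X i \<omega>)) + 1) ^ CARD('d) \<partial>completion M) = ennreal v" "0 \<le> v"
    and t: "0 < t"
  shows "(\<integral>\<omega>. exp (t * (f (\<phi> (\<lambda>i. X i \<omega>)) - (\<integral>\<omega>'. f (\<phi> (\<lambda>i. X i \<omega>')) \<partial>M))) \<partial>M) \<le>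
    exp (3 * (1 / \<alpha>) ^ CARD('d) * t\<^sup>2 * v\<^sup>2 * (\<Sum>j\<in>dep B f. (enn2real (oscillation B f j))\<^sup>2))"
proof -
  define \<nu> where "\<nu> = distr M A (X 0)"
  define Z where "Z = (\<lambda>\<omega> i. X i \<omega>)"
  let ?law = "PiM UNIV (\<lambda>_::int ^ 'd. \<nu>)"
  have \<nu>: "prob_space \<nu>" and Z: "Z \<in> measurable M ?law" and law: "distr M ?law Z = ?law"
    unfolding \<nu>_def Z_def by (rule iid_field_law[OF M X])+
  have sets\<nu>: "sets \<nu> = sets A" by (simp add: \<nu>_def)
  have sets_law: "sets ?law = sets (config_space A)" by (rule sets_PiM_cong) (simp_all add: sets\<nu>)
  obtain rad :: "int ^ 'd \<Rightarrow> (int ^ 'd \<Rightarrow> 'a) \<Rightarrow> enat" where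
    rad_meas: "\<And>k. rad k \<in> measurable ?law (count_space UNIV)" and
    rad_eq: "\<And>k x. rad k x = rad 0 (shift k x)" and
    rad_AE: "AE x in ?law. \<forall>k. rad k x = site_radius A \<phi> k x" and
    rad_local: "\<And>k q x y. x \<in> space ?law \<Longrightarrow> y \<in> space ?law \<Longrightarrow>
      (\<And>i. i \<in> ball_inf k q \<Longrightarrow> x i = y i) \<Longrightarrow> rad k x \<le> enat q \<Longrightarrow> rad k y \<le> enat q" and
    \<phi>_local: "\<And>k q x y. x \<in> space ?law \<Longrightarrow> y \<in> space ?law \<Longrightarrow>
      (\<And>i. i \<in> ball_inf k q \<Longrightarrow> x i = y i) \<Longrightarrow> rad k x \<le> enat q \<Longrightarrow> \<phi> x k = \<phi> y k"
    by (rule measurable_radius[OF A B \<phi> \<nu> sets\<nu>]) iprover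
  have AE_M: "AE \<omega> in M. \<forall>k. rad k (Z \<omega>) = site_radius A \<phi> k (Z \<omega>)"
    by (rule AE_distrD[OF Z], unfold law, rule rad_AE)
  have site0: "site_radius A \<phi> 0 x = coding_radius A \<phi> x" for x
    by (simp add: site_radius_def shift_def)
  have rad_sets: "{x\<in>space ?law. R (rad k x)} \<in> sets ?law" for R k
    using measurable_sets[OF rad_meas[of k], of "{r. R r}"] by (simp add: vimage_def Int_def conj_commute)
  \<comment> \<open>The event for the true radius need not be measurable. It differs from the
    measurable event for \<open>rad\<close> only on a null set, so its integral over the completion
    is the measure of the latter.\<close>
  have event: "(\<integral>\<^sup>+\<omega>. indicator {x. R (\<lambda>k. site_radius A \<phi> k x)} (Z \<omega>) \<partial>completion M) =
      emeasure ?law {x\<in>space ?law. R (\<lambda>k. rad k x)}"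
    if S: "{x\<in>space ?law. R (\<lambda>k. rad k x)} \<in> sets ?law" for R :: "(int ^ 'd \<Rightarrow> enat) \<Rightarrow> bool"
  proof -
    have "(\<integral>\<^sup>+\<omega>. indicator {x. R (\<lambda>k. site_radius A \<phi> k x)} (Z \<omega>) \<partial>completion M) =
      (\<integral>\<^sup>+\<omega>. indicator {x. R (\<lambda>k. site_radius A \<phi> k x)} (Z \<omega>) \<partial>M)"
      by (rule nn_integral_completion)
    also have "\<dots> = (\<integral>\<^sup>+\<omega>. indicator {x\<in>space ?law. R (\<lambda>k. rad k x)} (Z \<omega>) \<partial>M)"
    proof (rule nn_integral_cong_AE)
      show "AE \<omega> in M. (indicator {x. R (\<lambda>k. site_radius A \<phi> k x)} (Z \<omega>) :: ennreal) =
        indicator {x\<in>space ?law. R (\<lambda>k. rad k x)} (Z \<omega>)"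
        using AE_M AE_space
      proof eventually_elim
        case (elim \<omega>)
        then have "(\<lambda>k. site_radius A \<phi> k (Z \<omega>)) = (\<lambda>k. rad k (Z \<omega>))" by simp
        then show ?case using measurable_space[OF Z elim(2)] by (simp add: indicator_def)
      qed
    qed
    also have "\<dots> = (\<integral>\<^sup>+x. indicator {x\<in>space ?law. R (\<lambda>k. rad k x)} x \<partial>distr M ?law Z)"
      by (rule nn_integral_distr[OF Z, symmetric]) (use S in simp)
    also have "\<dots> = emeasure ?law {x\<in>space ?law. R (\<lambda>k. rad k x)}"
      unfolding law using S by (rule nn_integral_indicator)
    finally show ?thesis .
  qed
  have rad_shift: "emeasure ?law {x\<in>space ?law. R (rad k x)} = emeasure ?law {x\<in>space ?law. R (rad 0 x)}" for R k
  proof -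
    have "emeasure ?law {x\<in>space ?law. R (rad 0 x)} = emeasure (distr ?law ?law (shift k)) {x\<in>space ?law. R (rad 0 x)}"
      by (simp only: distr_shift[OF \<nu>])
    also have "\<dots> = emeasure ?law (shift k -` {x\<in>space ?law. R (rad 0 x)} \<inter> space ?law)"
      by (rule emeasure_distr[OF shift_measurable rad_sets])
    also have "shift k -` {x\<in>space ?law. R (rad 0 x)} \<inter> space ?law = {x\<in>space ?law. R (rad k x)}"
      unfolding rad_eq[of k] using shift_space by blast
    finally show ?thesis ..
  qed
  have rad_finite: "AE x in ?law. rad k x < \<infinity>" for k
  proof -
    have "AE \<omega> in M. coding_radius A \<phi> (Z \<omega>) < \<infinity>"
      using fin unfolding finitary_def AE_completion_iff Z_def .
    then have "AE \<omega> in M. rad 0 (Z \<omega>) < \<infinity>"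
      using AE_M
    proof eventually_elim
      case (elim \<omega>)
      then show ?case using site0[of "Z \<omega>"] by metis
    qed
    then have "AE x in distr M ?law Z. rad 0 x < \<infinity>"
      by (subst AE_distr_iff[OF Z rad_sets])
    then have "AE x in ?law. rad 0 (shift k x) < \<infinity>"
      unfolding law by (rule AE_shift[OF \<nu>])
    then show ?thesis by (simp only: rad_eq[of k])
  qed
  have rad_fact: "emeasure ?law {x\<in>space ?law. enat p \<le> rad k x \<and> enat (linf (l - k)) \<le> rad l x} \<le>
      emeasure ?law {x\<in>space ?law. enat p \<le> rad 0 x} *
      emeasure ?law {x\<in>space ?law. ennreal (\<alpha> * real (linf (l - k))) \<le> ennreal_of_enat (rad 0 x)}" for k l p
  proof -
    \<comment> \<open>The factorization property is only assumed at triples \<open>(k, l, i)\<close>; the site \<open>i\<close> makes \<open>p\<close> arbitrary.\<close>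
    obtain i where i: "linf (k - i) = p" "linf (l - i) = p + linf (l - k)" by (rule far_site)
    have "max (linf (l - i)) (max (linf (k - i)) (linf (l - k))) = linf (l - i)" using i by simp
    with srf have "(\<integral>\<^sup>+\<omega>. indicator {x. enat (linf (k - i)) \<le> site_radius A \<phi> k x} (Z \<omega>) *
              indicator {x. enat (linf (l - k)) \<le> site_radius A \<phi> l x} (Z \<omega>) \<partial>completion M)
        \<le> (\<integral>\<^sup>+\<omega>. indicator {x. enat (linf (k - i)) \<le> site_radius A \<phi> k x} (Z \<omega>) \<partial>completion M) *
          (\<integral>\<^sup>+\<omega>. indicator {x. ennreal (\<alpha> * real (linf (l - k))) \<le> ennreal_of_enat (site_radius A \<phi> l x)}
                 (Z \<omega>) \<partial>completion M)"
      unfolding short_range_factorization_def Z_def by blast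
    also have "(\<lambda>\<omega>. indicator {x. enat (linf (k - i)) \<le> site_radius A \<phi> k x} (Z \<omega>) *
              indicator {x. enat (linf (l - k)) \<le> site_radius A \<phi> l x} (Z \<omega>) :: ennreal) =
        (\<lambda>\<omega>. indicator {x. enat p \<le> site_radius A \<phi> k x \<and> enat (linf (l - k)) \<le> site_radius A \<phi> l x} (Z \<omega>))"
      by (simp add: fun_eq_iff indicator_def i(1))
    also have "(\<integral>\<^sup>+\<omega>. indicator {x. enat p \<le> site_radius A \<phi> k x \<and> enat (linf (l - k)) \<le> site_radius A \<phi> l x} (Z \<omega>) \<partial>completion M) =
      emeasure ?law {x\<in>space ?law. enat p \<le> rad k x \<and> enat (linf (l - k)) \<le> rad l x}"
    proof (rule event[where R="\<lambda>r. enat p \<le> r k \<and> enat (linf (l - k)) \<le> r l"])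
      have "{x\<in>space ?law. enat p \<le> rad k x \<and> enat (linf (l - k)) \<le> rad l x} =
        {x\<in>space ?law. enat p \<le> rad k x} \<inter> {x\<in>space ?law. enat (linf (l - k)) \<le> rad l x}" by blast
      then show "{x\<in>space ?law. enat p \<le> rad k x \<and> enat (linf (l - k)) \<le> rad l x} \<in> sets ?law"
        using sets.Int[OF rad_sets rad_sets] by simp
    qed
    also have "(\<integral>\<^sup>+\<omega>. indicator {x. enat (linf (k - i)) \<le> site_radius A \<phi> k x} (Z \<omega>) \<partial>completion M) =
      emeasure ?law {x\<in>space ?law. enat p \<le> rad 0 x}"
      unfolding i(1) rad_shift[of "\<lambda>r. enat p \<le> r" k, symmetric]
      by (rule event[where R="\<lambda>r. enat p \<le> r k", OF rad_sets])
    also have "(\<integral>\<^sup>+\<omega>. indicator {x. ennreal (\<alpha> * real (linf (l - k))) \<le> ennreal_of_enat (site_radius A \<phi> l x)}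
                 (Z \<omega>) \<partial>completion M) =
      emeasure ?law {x\<in>space ?law. ennreal (\<alpha> * real (linf (l - k))) \<le> ennreal_of_enat (rad 0 x)}"
      unfolding rad_shift[of "\<lambda>r. ennreal (\<alpha> * real (linf (l - k))) \<le> ennreal_of_enat r" l, symmetric]
      by (rule event[where R="\<lambda>r. ennreal (\<alpha> * real (linf (l - k))) \<le> ennreal_of_enat (r l)", OF rad_sets])
    finally show ?thesis .
  qed
  have \<phi>_meas: "\<phi> \<in> measurable ?law (config_space B)"
    using \<phi> unfolding coding_def measurable_cong_sets[OF sets_law refl] by blast
  have f_meas: "f \<in> borel_measurable (config_space B)" and dep: "finite (dep B f)"
    and f_local: "\<And>y y'. y \<in> space (config_space B) \<Longrightarrow> y' \<in> space (config_space B) \<Longrightarrow>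
      (\<And>j. j \<in> dep B f \<Longrightarrow> y j = y' j) \<Longrightarrow> f y = f y'"
    using f(1) unfolding local_function_def by blast+
  have f_osc: "\<bar>f y - f y'\<bar> \<le> enn2real (oscillation B f k)"
    if "y \<in> space (config_space B)" "y' \<in> space (config_space B)" "\<And>l. l \<noteq> k \<Longrightarrow> y l = y' l" for y y' k
  proof -
    have "oscillation B f k < top" using f(2) by (simp add: bounded_difference_def)
    with oscillation_upper[OF that] have "enn2real (ennreal \<bar>f y - f y'\<bar>) \<le> enn2real (oscillation B f k)"
      by (intro enn2real_mono)
    then show ?thesis by simp
  qed
  interpret coded_field \<nu> rad \<alpha> B \<phi> f "dep B f" "\<lambda>j. enn2real (oscillation B f j)"
    by (intro coded_field.intro radius_field.intro coded_field_axioms.intro) (fact \<nu> rad_meas rad_local rad_shift rad_finite \<alpha> rad_fact \<phi>_meas \<phi>_local f_meas dep f_local f_osc enn2real_nonneg)+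
  have "coding_volume = (\<integral>\<^sup>+x. (2 * ennreal_of_enat (rad 0 x) + 1) ^ CARD('d) \<partial>distr M ?law Z)"
    unfolding coding_volume_def law ..
  also have "\<dots> = (\<integral>\<^sup>+\<omega>. (2 * ennreal_of_enat (rad 0 (Z \<omega>)) + 1) ^ CARD('d) \<partial>M)"
    by (intro nn_integral_distr[OF Z] measurable_compose[OF rad_meas[of 0]]) simp
  also have "\<dots> = (\<integral>\<^sup>+\<omega>. (2 * ennreal_of_enat (coding_radius A \<phi> (Z \<omega>)) + 1) ^ CARD('d) \<partial>M)"
    by (rule nn_integral_cong_AE) (use AE_M in eventually_elim, simp add: site0)
  also have "\<dots> = ennreal v"
    unfolding v(1)[symmetric] Z_def by (rule nn_integral_completion[symmetric])
  finally have "coding_volume = ennreal v" .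
  from exponential_bound[OF t this v(2)]
  have le: "(\<integral>x. exp (t * (f (\<phi> x) - (\<integral>x. f (\<phi> x) \<partial>?law))) \<partial>?law) \<le>
    exp (3 * (1 / \<alpha>) ^ CARD('d) * t\<^sup>2 * v\<^sup>2 * (\<Sum>j\<in>dep B f. (enn2real (oscillation B f j))\<^sup>2))" .
  have f\<phi>: "(\<lambda>x. f (\<phi> x)) \<in> borel_measurable ?law" by (rule measurable_compose[OF \<phi>_meas f_meas])
  have int: "(\<integral>x. g (f (\<phi> x)) \<partial>?law) = (\<integral>\<omega>. g (f (\<phi> (Z \<omega>))) \<partial>M)" if "g \<in> borel_measurable borel" for g :: "real \<Rightarrow> real"
    using integral_distr[OF Z measurable_compose[OF f\<phi> that]] unfolding law .
  have "(\<integral>x. f (\<phi> x) \<partial>?law) = (\<integral>\<omega>. f (\<phi> (Z \<omega>)) \<partial>M)" by (rule int[of "\<lambda>y. y"]) simp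
  moreover have "(\<integral>x. exp (t * (f (\<phi> x) - c)) \<partial>?law) = (\<integral>\<omega>. exp (t * (f (\<phi> (Z \<omega>)) - c)) \<partial>M)" for c
    by (rule int[of "\<lambda>y. exp (t * (y - c))"]) measurable
  ultimately show ?thesis using le unfolding Z_def by simp
qed

theorem theorem3p3:
  fixes M :: "'w measure" and A :: "'a measure" and B :: "'b measure"
    and X :: "int ^ 'd::finite \<Rightarrow> 'w \<Rightarrow> 'a"
    and Y :: "'w \<Rightarrow> int ^ 'd \<Rightarrow> 'b"
    and \<phi> :: "(int ^ 'd \<Rightarrow> 'a) \<Rightarrow> (int ^ 'd \<Rightarrow> 'b)"
    and f :: "(int ^ 'd \<Rightarrow> 'b) \<Rightarrow> real"
    and \<alpha> :: real
  assumes "prob_space M"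
    and "standard_borel A" and "standard_borel B"
    and "iid_field M A X"
    and "coding A B \<phi>" and "finitary M A X \<phi>"
    and "\<And>\<omega>. Y \<omega> = \<phi> (\<lambda>i. X i \<omega>)"
    and "0 < \<alpha>" and "\<alpha> \<le> 1"
    and "short_range_factorization M A X \<phi> \<alpha>"
    and "local_function B f" and "bounded_difference B f"
  shows "\<forall>t::real. t > 0 \<longrightarrow>
    ereal (ln (\<integral>\<omega>. exp (t * (f (Y \<omega>) - (\<integral>\<omega>'. f (Y \<omega>') \<partial>M))) \<partial>M))
    \<le> enn2ereal (ennreal (3 * (1 / \<alpha>) ^ CARD('d) * t\<^sup>2) *
        (\<integral>\<^sup>+\<omega>. (2 * ennreal_of_enat (coding_radius A \<phi> (\<lambda>i. X i \<omega>)) + 1) ^ CARD('d) \<partial>completion M)\<^sup>2 *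
        oscillation_norm_sq B f)"
proof (intro allI impI)
  fix t :: real assume t: "t > 0"
  interpret prob_space M by fact
  let ?V = "\<integral>\<^sup>+\<omega>. (2 * ennreal_of_enat (coding_radius A \<phi> (\<lambda>i. X i \<omega>)) + 1) ^ CARD('d) \<partial>completion M"
  let ?I = "\<integral>\<omega>. exp (t * (f (Y \<omega>) - (\<integral>\<omega>'. f (Y \<omega>') \<partial>M))) \<partial>M"
  define D where "D = (\<Sum>j\<in>dep B f. (enn2real (oscillation B f j))\<^sup>2)"
  have D: "0 \<le> D" unfolding D_def by (intro sum_nonneg) simp
  have norm: "oscillation_norm_sq B f = ennreal D"
    unfolding D_def by (rule oscillation_norm_sq_eq_sum) fact+
  have a: "0 < 3 * (1 / \<alpha>) ^ CARD('d) * t\<^sup>2" using \<open>0 < \<alpha>\<close> t by simp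
  show "ereal (ln ?I) \<le> enn2ereal (ennreal (3 * (1 / \<alpha>) ^ CARD('d) * t\<^sup>2) * ?V\<^sup>2 * oscillation_norm_sq B f)"
  proof (cases "?V = top")
    case False
    then obtain v where v: "?V = ennreal v" "0 \<le> v" by (cases ?V) auto
    let ?c = "3 * (1 / \<alpha>) ^ CARD('d) * t\<^sup>2 * v\<^sup>2 * D"
    have c: "0 \<le> ?c" by (rule mult_nonneg_nonneg[OF mult_nonneg_nonneg[OF less_imp_le[OF a] zero_le_power2] D])
    have le: "?I \<le> exp ?c"
      unfolding D_def \<open>\<And>\<omega>. Y \<omega> = \<phi> (\<lambda>i. X i \<omega>)\<close>
      by (rule coding_log_laplace_bound[OF assms(1-6,8-12) v t])
    \<comment> \<open>If the integral were 0, \<open>ln\<close> would return its default value 0,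
      which is below the nonnegative right-hand side.\<close>
    have "ln ?I \<le> ?c"
    proof (cases "?I = 0")
      case True
      then show ?thesis using c by simp
    next
      case False
      moreover have "0 \<le> ?I" by (intro Bochner_Integration.integral_nonneg) simp
      ultimately have "0 < ?I" by linarith
      with le have "ln ?I \<le> ln (exp ?c)" by (intro ln_mono) auto
      then show ?thesis by simp
    qed
    moreover have "ennreal (3 * (1 / \<alpha>) ^ CARD('d) * t\<^sup>2) * ?V\<^sup>2 * oscillation_norm_sq B f = ennreal ?c"
    proof -
      have "ennreal K * (ennreal v)\<^sup>2 * ennreal D = ennreal (K * v\<^sup>2 * D)" if "0 \<le> K" for K
        using that v(2) D by (simp add: ennreal_power ennreal_mult)
      from this[OF less_imp_le[OF a]] show ?thesis unfolding v(1) norm .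
    qed
    ultimately show ?thesis using c by (simp add: enn2ereal_ennreal)
  next
    case inf: True
    \<comment> \<open>With infinite expected volume the right-hand side is infinite unless
      \<open>D = 0\<close>. In that case \<open>top * 0 = 0\<close> turns the claim into
      \<open>ln ?I \<le> 0\<close>, which holds because \<open>f\<close> is constant and the
      integral is 1.\<close>
    show ?thesis
    proof (cases "D = 0")
      case True
      have "dep B f = {}"
      proof (rule ccontr)
        assume "dep B f \<noteq> {}"
        then obtain j where j: "j \<in> dep B f" by blast
        have "finite (dep B f)" using \<open>local_function B f\<close> by (simp add: local_function_def)
        then have "(enn2real (oscillation B f j))\<^sup>2 = 0"
          using True j unfolding D_def by (subst (asm) sum_nonneg_eq_0_iff) auto
        moreover have "0 < oscillation B f j" "oscillation B f j < top"
          using j \<open>bounded_difference B f\<close> by (auto simp: dep_def bounded_difference_def)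
        ultimately show False by (auto simp: enn2real_eq_0_iff)
      qed
      then have const: "f y = f y'" if "y \<in> space (config_space B)" "y' \<in> space (config_space B)" for y y'
        using \<open>local_function B f\<close> that unfolding local_function_def by blast
      have Y: "Y \<omega> \<in> space (config_space B)" if "\<omega> \<in> space M" for \<omega>
      proof -
        have "(\<lambda>\<omega> i. X i \<omega>) \<in> measurable M (PiM UNIV (\<lambda>_. distr M A (X 0)))"
          by (rule iid_field_law(2)) fact+
        from measurable_space[OF this that] have "(\<lambda>i. X i \<omega>) \<in> space (config_space A)" by (simp add: space_PiM)
        moreover have "\<phi> \<in> measurable (config_space A) (config_space B)"
          using \<open>coding A B \<phi>\<close> by (simp add: coding_def)
        ultimately show ?thesis unfolding \<open>\<And>\<omega>. Y \<omega> = \<phi> (\<lambda>i. X i \<omega>)\<close> by (rule measurable_space[rotated])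
      qed
      obtain \<omega>0 where \<omega>0: "\<omega>0 \<in> space M" using not_empty by blast
      have c: "f (Y \<omega>) = f (Y \<omega>0)" if "\<omega> \<in> space M" for \<omega> by (rule const[OF Y[OF that] Y[OF \<omega>0]])
      have "(\<integral>\<omega>. f (Y \<omega>) \<partial>M) = (\<integral>\<omega>. f (Y \<omega>0) \<partial>M)" by (rule Bochner_Integration.integral_cong[OF refl c])
      then have E: "(\<integral>\<omega>. f (Y \<omega>) \<partial>M) = f (Y \<omega>0)" by (simp add: prob_space)
      have "?I = (\<integral>\<omega>. 1 \<partial>M)"
        unfolding E by (rule Bochner_Integration.integral_cong[OF refl]) (simp add: c)
      then have "?I = 1" by (simp add: prob_space)
      then show ?thesis by (simp add: zero_ereal_def[symmetric])
    next
      case False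
      then have "ennreal (3 * (1 / \<alpha>) ^ CARD('d) * t\<^sup>2) * ?V\<^sup>2 * oscillation_norm_sq B f = top"
        unfolding inf norm using a D by (simp add: ennreal_mult_eq_top_iff power2_eq_square ennreal_eq_0_iff not_le)
      then show ?thesis by simp
    qed
  qed
qed

end
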